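(* There is an algorithm which, given an instance of the linear exchange market with $n$ agents whose utilities $u_{ij}$ are integers in $\{0,1,\ldots,U\}$ (and which satisfies the standing assumptions listed in the context), computes an equilibrium price vector using $O(n^9\log(nU))$ arithmetic operations on rational numbers, of which only $O(n^8\log(nU))$ are multiplications and divisions.
   Context: Linear exchange market: there are $n$ agents; agent $i$ owns exactly one unit of good $i$. Agent $i$ has a linear utility $\sum_j u_{ij}x_{ij}$, where $x_{ij}\ge 0$ is the amount of good $j$ it receives. Standing assumptions: (a) for every $i$ there is $j$ with $u_{ij}>0$; (b) for every $j$ there is $i$ with $u_{ij}>0$; (c) (irreducibility) for every nonempty proper subset $P$ of agents there are $i\in P$, $j\notin P$ with $u_{ij}>0$; (d) each $u_{ij}$ is an integer between $0$ and $U$. An equilibrium is a vector $p$ of positive prices together with allocations $x_{ij}\ge 0$ such that $\sum_i x_{ij}=1$ for all $j$, $\sum_j x_{ij}p_j=p_i$ for all $i$, and $x_{ij}>0\Rightarrow u_{ij}/p_j=\max_\ell u_{i\ell}/p_\ell$. An equilibrium price vector is the price part of an equilibrium. *)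

theory Defs
  imports Complex_Main
begin

section \<open>Linear exchange markets\<close>

text \<open>
  Agents and goods are the numbers in \<open>{..<n}\<close>; agent \<open>i\<close> owns one unit of good \<open>i\<close>.
\<close>

definition exchange_market :: "nat \<Rightarrow> (nat \<Rightarrow> nat \<Rightarrow> nat) \<Rightarrow> bool" where
  "exchange_market n u \<longleftrightarrow>
     0 < n \<and>
     (\<forall>i<n. \<exists>j<n. u i j > 0) \<and>
     (\<forall>j<n. \<exists>i<n. u i j > 0) \<and>
     (\<forall>P. P \<noteq> {} \<and> P \<subset> {..<n} \<longrightarrow> (\<exists>i\<in>P. \<exists>j\<in>{..<n} - P. u i j > 0))"

definition equilibrium ::
  "nat \<Rightarrow> (nat \<Rightarrow> nat \<Rightarrow> nat) \<Rightarrow> (nat \<Rightarrow> real) \<Rightarrow> (nat \<Rightarrow> nat \<Rightarrow> real) \<Rightarrow> bool" where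
  "equilibrium n u p x \<longleftrightarrow>
     (\<forall>j<n. p j > 0) \<and>
     (\<forall>i<n. \<forall>j<n. x i j \<ge> 0) \<and>
     (\<forall>j<n. (\<Sum>i<n. x i j) = 1) \<and>
     (\<forall>i<n. (\<Sum>j<n. x i j * p j) = p i) \<and>
     (\<forall>i<n. \<forall>j<n. x i j > 0 \<longrightarrow>
        real (u i j) / p j = Max ((\<lambda>l. real (u i l) / p l) ` {..<n}))"

definition equilibrium_prices :: "nat \<Rightarrow> (nat \<Rightarrow> nat \<Rightarrow> nat) \<Rightarrow> (nat \<Rightarrow> real) \<Rightarrow> bool" where
  "equilibrium_prices n u p \<longleftrightarrow> (\<exists>x. equilibrium n u p x)"


section \<open>Algorithms over the rationals\<close>

text \<open>
  An algorithm is a program of a small imperative language, run on a random access machine with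
  two memories, one holding rational numbers (the data) and one holding natural numbers (indices,
  counters and combinatorial structures such as graphs). Both consist of two-dimensional
  arrays named by natural numbers; a scalar variable is the cell \<open>(0, 0)\<close> of an array. A program
  is one finite piece of syntax with finitely many constants, independent of the input. The only
  way in which information passes from the rational memory to the index memory is through the
  outcome of comparisons in \<open>Cond\<close> and \<open>While\<close>; there is no rounding operation.
\<close>

datatype iexp =
    IConst nat
  | IGet nat iexp iexp
  | IAdd iexp iexp
  | ISub iexp iexp

datatype qexp =
    QConst rat
  | QGet nat iexp iexp
  | QAdd qexp qexp
  | QSub qexp qexp
  | QMul qexp qexp
  | QDiv qexp qexp

datatype bexp =
    ILess iexp iexp
  | QLess qexp qexp
  | BNot bexp
  | BAnd bexp bexp

datatype com =
    Skip
  | ISet nat iexp iexp iexp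
  | QSet nat iexp iexp qexp
  | Seq com com
  | Cond bexp com com
  | While bexp com

record state =
  imem :: "nat \<Rightarrow> nat \<Rightarrow> nat \<Rightarrow> nat"
  qmem :: "nat \<Rightarrow> nat \<Rightarrow> nat \<Rightarrow> rat"

primrec ival :: "iexp \<Rightarrow> state \<Rightarrow> nat" where
  "ival (IConst c) s = c"
| "ival (IGet a e f) s = imem s a (ival e s) (ival f s)"
| "ival (IAdd e f) s = ival e s + ival f s"
| "ival (ISub e f) s = ival e s - ival f s"

primrec qval :: "qexp \<Rightarrow> state \<Rightarrow> rat" where
  "qval (QConst c) s = c"
| "qval (QGet a e f) s = qmem s a (ival e s) (ival f s)"
| "qval (QAdd e f) s = qval e s + qval f s"
| "qval (QSub e f) s = qval e s - qval f s"
| "qval (QMul e f) s = qval e s * qval f s"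
| "qval (QDiv e f) s = qval e s / qval f s"

primrec bval :: "bexp \<Rightarrow> state \<Rightarrow> bool" where
  "bval (ILess e f) s \<longleftrightarrow> ival e s < ival f s"
| "bval (QLess e f) s \<longleftrightarrow> qval e s < qval f s"
| "bval (BNot b) s \<longleftrightarrow> \<not> bval b s"
| "bval (BAnd b c) s \<longleftrightarrow> bval b s \<and> bval c s"

definition iset :: "nat \<Rightarrow> nat \<Rightarrow> nat \<Rightarrow> nat \<Rightarrow> state \<Rightarrow> state" where
  "iset a i j v s = s\<lparr>imem := (imem s)(a := (imem s a)(i := (imem s a i)(j := v)))\<rparr>"

definition qset :: "nat \<Rightarrow> nat \<Rightarrow> nat \<Rightarrow> rat \<Rightarrow> state \<Rightarrow> state" where
  "qset a i j v s = s\<lparr>qmem := (qmem s)(a := (qmem s a)(i := (qmem s a i)(j := v)))\<rparr>"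

text \<open>
  The functions \<open>iops\<close>, \<open>qops\<close>, \<open>bops\<close> count all arithmetic operations and comparisons, in both
  memories; \<open>qmuls\<close> and \<open>bmuls\<close> count the multiplications and divisions among them (indices are
  only added and subtracted). Index operations have to be charged: otherwise a program could read
  off the integer input by comparisons and then do all its arithmetic in the index memory for free.
  As every test contains a comparison, every loop iteration is charged, so the number of elementary
  steps of any kind is at most a program-dependent constant times one plus the number of
  operations counted.
\<close>

primrec iops :: "iexp \<Rightarrow> nat" where
  "iops (IConst c) = 0"
| "iops (IGet a e f) = iops e + iops f"
| "iops (IAdd e f) = iops e + iops f + 1"
| "iops (ISub e f) = iops e + iops f + 1"

primrec qops :: "qexp \<Rightarrow> nat" where
  "qops (QConst c) = 0"
| "qops (QGet a e f) = iops e + iops f"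
| "qops (QAdd e f) = qops e + qops f + 1"
| "qops (QSub e f) = qops e + qops f + 1"
| "qops (QMul e f) = qops e + qops f + 1"
| "qops (QDiv e f) = qops e + qops f + 1"

primrec bops :: "bexp \<Rightarrow> nat" where
  "bops (ILess e f) = iops e + iops f + 1"
| "bops (QLess e f) = qops e + qops f + 1"
| "bops (BNot b) = bops b"
| "bops (BAnd b c) = bops b + bops c"

primrec qmuls :: "qexp \<Rightarrow> nat" where
  "qmuls (QConst c) = 0"
| "qmuls (QGet a e f) = 0"
| "qmuls (QAdd e f) = qmuls e + qmuls f"
| "qmuls (QSub e f) = qmuls e + qmuls f"
| "qmuls (QMul e f) = qmuls e + qmuls f + 1"
| "qmuls (QDiv e f) = qmuls e + qmuls f + 1"

primrec bmuls :: "bexp \<Rightarrow> nat" where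
  "bmuls (ILess e f) = 0"
| "bmuls (QLess e f) = qmuls e + qmuls f"
| "bmuls (BNot b) = bmuls b"
| "bmuls (BAnd b c) = bmuls b + bmuls c"

text \<open>
  \<open>exec c s k m t\<close>: started in state \<open>s\<close>, program \<open>c\<close> terminates in state \<open>t\<close> and performs
  \<open>k\<close> operations, \<open>m\<close> of which are multiplications or divisions.
\<close>

inductive exec :: "com \<Rightarrow> state \<Rightarrow> nat \<Rightarrow> nat \<Rightarrow> state \<Rightarrow> bool" where
  Skip: "exec Skip s 0 0 s"
| ISet: "exec (ISet a e f g) s (iops e + iops f + iops g) 0
           (iset a (ival e s) (ival f s) (ival g s) s)"
| QSet: "exec (QSet a e f g) s (iops e + iops f + qops g) (qmuls g)
           (qset a (ival e s) (ival f s) (qval g s) s)"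
| Seq: "exec c s k m s' \<Longrightarrow> exec d s' k' m' t \<Longrightarrow> exec (Seq c d) s (k + k') (m + m') t"
| CondTrue: "bval b s \<Longrightarrow> exec c s k m t \<Longrightarrow> exec (Cond b c d) s (bops b + k) (bmuls b + m) t"
| CondFalse: "\<not> bval b s \<Longrightarrow> exec d s k m t \<Longrightarrow> exec (Cond b c d) s (bops b + k) (bmuls b + m) t"
| WhileFalse: "\<not> bval b s \<Longrightarrow> exec (While b c) s (bops b) (bmuls b) s"
| WhileTrue: "bval b s \<Longrightarrow> exec c s k m s' \<Longrightarrow> exec (While b c) s' k' m' t \<Longrightarrow>
    exec (While b c) s (bops b + k + k') (bmuls b + m + m') t"

inductive_cases exec_SkipE: "exec Skip s k m t"
  and exec_ISetE: "exec (ISet a e f g) s k m t"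
  and exec_QSetE: "exec (QSet a e f g) s k m t"
  and exec_SeqE: "exec (Seq c d) s k m t"
  and exec_CondE: "exec (Cond b c d) s k m t"
  and exec_WhileE: "exec (While b c) s k m t"

lemma exec_deterministic:
  assumes "exec c s k m t" and "exec c s k' m' t'"
  shows "k' = k \<and> m' = m \<and> t' = t"
  using assms
proof (induction arbitrary: k' m' t' rule: exec.induct)
  case Skip
  then show ?case by (auto elim: exec_SkipE)
next
  case ISet
  then show ?case by (auto elim: exec_ISetE)
next
  case QSet
  then show ?case by (auto elim: exec_QSetE)
next
  case Seq
  from Seq.prems show ?case by (rule exec_SeqE) (use Seq.IH in blast)
next
  case CondTrue
  from CondTrue.prems show ?case by (rule exec_CondE) (use CondTrue.IH CondTrue.hyps in blast)+
next
  case CondFalse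
  from CondFalse.prems show ?case by (rule exec_CondE) (use CondFalse.IH CondFalse.hyps in blast)+
next
  case WhileFalse
  from WhileFalse.prems show ?case by (rule exec_WhileE) (use WhileFalse.hyps in blast)+
next
  case WhileTrue
  from WhileTrue.prems show ?case by (rule exec_WhileE) (use WhileTrue.IH WhileTrue.hyps in blast)+
qed

text \<open>
  The input is \<open>n\<close>, in index array \<open>0\<close>, and the utility matrix, in rational array \<open>0\<close>; the upper
  bound on the utilities is not part of it. The output is read from column \<open>0\<close> of rational
  array \<open>1\<close>.
\<close>

definition market_input :: "nat \<Rightarrow> (nat \<Rightarrow> nat \<Rightarrow> nat) \<Rightarrow> state" where
  "market_input n u =
     \<lparr>imem = (\<lambda>a i j. if a = 0 \<and> i = 0 \<and> j = 0 then n else 0),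
      qmem = (\<lambda>a i j. if a = 0 \<and> i < n \<and> j < n then of_nat (u i j) else 0)\<rparr>"

definition market_output :: "state \<Rightarrow> nat \<Rightarrow> real" where
  "market_output t i = of_rat (qmem t 1 i 0)"

end

theory Submission imports Defs "HOL-Analysis.Analysis" "Jordan_Normal_Form.Determinant" begin

text \<open>
  At a price vector \<open>q\<close> let every agent demand a best good, and let \<open>Z\<close> be the excess demand. Then
  \<open>Z \<bullet> q = 0\<close> by Walras' law, while \<open>Z \<bullet> p \<ge> 0\<close> at every equilibrium price vector \<open>p\<close>. So \<open>Z\<close> cuts
  the cone of candidate prices, and the simplicial cutting-plane method of Yamnitsky and Levin
  applies: as long as it goes on, the determinant of the coordinate functionals of its cone grows
  by a factor \<open>1 + 1 / (8 n\<^sup>2)\<close> per iteration, so after few iterations some demand cut enters a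
  functional with a huge weight, which makes \<open>Z \<bullet> p\<close> tiny for the query \<open>q\<close> of that cut. If no
  cut separates the cone, the centre itself is such a query.

  A logarithmic inequality shows that at such a query all edges used by an equilibrium flow are
  almost optimal and that the ratio \<open>q i / p i\<close> is almost constant along them. Some equilibrium
  flow is integral and of size \<open>(n U) ^ O(n)\<close> (rigidity of a flow with a maximal set of active
  constraints, and the pigeonhole principle as in Siegel's lemma). Hence, choosing a threshold \<open>d\<close>
  with a wide gap above it, the edges that are optimal up to the factor \<open>1 + d\<close> are consistent around
  cycles: they determine exact price ratios within each connected class. Each agent then passes
  its money to the goods of its class in proportion to these prices; a stationary distribution of this
  Markov chain is found by state elimination. Normalised on each recurrent class by a price of the
  query, it stays close to the query, so the gap keeps all other edges from becoming optimal and
  the vector is an equilibrium price vector.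
\<close>

subsection \<open>Linear systems with integer coefficients\<close>

text \<open>The required precision determines the running time. Around a cycle of price ratios some
  \<open>2 * n^2\<close> integers are multiplied, each as large as a money flow, that is
  \<open>base ^ O(n)\<close>. Telling such products apart needs precision
  \<open>base ^ O(n^3)\<close>, so \<open>H = base ^ (n ^ 3)\<close> is the unit of all thresholds.
  While all weights stay below \<open>H ^ 100\<close>, the determinant is roughly at most
  \<open>H ^ O(n)\<close>, which stops its growth after \<open>O(n^6 log base)\<close> iterations of
  cost \<open>O(n^2)\<close>. All operations together thus fit into the bound for multiplications.
  The obstacle is that the machine cannot round and knows neither \<open>U\<close> nor any
  equilibrium. Prices are therefore not recovered by rounding numbers: the program only multiplies
  ratios of given utilities inside a class. Ratios between classes, which depend on the unknown
  flow, are replaced by those of a stationary vector. The integral flow, the exact prices and the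
  functionals of the cone exist only in the proof.\<close>

lemma homog_nontrivial:
  fixes A :: "'r \<Rightarrow> 's \<Rightarrow> real"
  assumes "finite R" "finite S" "card R < card S"
  shows "\<exists>x. (\<exists>s\<in>S. x s \<noteq> 0) \<and> (\<forall>r\<in>R. (\<Sum>s\<in>S. A r s * x s) = 0)"
  using assms
proof (induction R arbitrary: S A rule: finite_induct)
  case empty
  then obtain s where "s \<in> S" by fastforce
  then show ?case by (intro exI[of _ "\<lambda>_. 1"]) auto
next
  case (insert r R)
  show ?case
  proof (cases "\<forall>s\<in>S. A r s = 0")
    case True
    from insert.hyps insert.prems have "card R < card S" by simp
    from insert.IH[OF insert.prems(1) this, of A] True show ?thesis by auto
  next
    case False
    then obtain t where t: "t \<in> S" "A r t \<noteq> 0" by auto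
    define S' where "S' = S - {t}"
    have S': "finite S'" "card R < card S'" "t \<notin> S'" "S = insert t S'"
      using insert.hyps insert.prems t by (auto simp: S'_def)
    \<comment> \<open>Gaussian elimination with pivot \<open>A r t\<close>. The reduced row
      \<open>r\<close> vanishes identically, so the induction hypothesis is needed only for the
      other rows, and \<open>y t\<close> is solved from row \<open>r\<close>.\<close>
    define A' where "A' q s = A q s - A q t * A r s / A r t" for q s
    obtain x where x: "\<exists>s\<in>S'. x s \<noteq> 0" "\<And>q. q \<in> R \<Longrightarrow> (\<Sum>s\<in>S'. A' q s * x s) = 0"
      using insert.IH[OF S'(1,2), of A'] by blast
    define y where "y s = (if s = t then - (\<Sum>s\<in>S'. A r s * x s) / A r t else x s)" for s
    have y: "(\<Sum>s\<in>S. A q s * y s) = (\<Sum>s\<in>S'. A' q s * x s)" for q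
    proof -
      have "(\<Sum>s\<in>S. A q s * y s) = A q t * y t + (\<Sum>s\<in>S'. A q s * y s)"
        using S' by simp
      also have "(\<Sum>s\<in>S'. A q s * y s) = (\<Sum>s\<in>S'. A q s * x s)"
        using S' by (intro sum.cong) (auto simp: y_def)
      also have "A q t * y t = - (\<Sum>s\<in>S'. A q t * A r s / A r t * x s)"
        by (simp add: y_def sum_distrib_left sum_divide_distrib mult_ac)
      finally show ?thesis
        by (simp add: A'_def left_diff_distrib sum_subtractf)
    qed
    have "A' r s = 0" for s using t by (simp add: A'_def)
    then have "(\<Sum>s\<in>S. A q s * y s) = 0" if "q \<in> insert r R" for q
      using that x(2) y by auto
    moreover have "\<exists>s\<in>S. y s \<noteq> 0" using x(1) S' by (auto simp: y_def)
    ultimately show ?thesis by blast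
  qed
qed

text \<open>A minimal system of rows with the given kernel has fewer rows than unknowns: otherwise
  the vectors separating each row from the others, together with the kernel vector, would be
  too many to be independent.\<close>

lemma few_rows_suffice:
  fixes A :: "'r \<Rightarrow> 's \<Rightarrow> real" and f :: "'s \<Rightarrow> real"
  assumes fin: "finite R" "finite S"
    and f0: "\<exists>s\<in>S. f s \<noteq> 0" and fR: "\<And>r. r \<in> R \<Longrightarrow> (\<Sum>s\<in>S. A r s * f s) = 0"
    and ker: "\<And>g. (\<And>r. r \<in> R \<Longrightarrow> (\<Sum>s\<in>S. A r s * g s) = 0) \<Longrightarrow> \<exists>c. \<forall>s\<in>S. g s = c * f s"
  obtains R0 where "R0 \<subseteq> R" "card R0 < card S"
    "\<And>g. (\<And>r. r \<in> R0 \<Longrightarrow> (\<Sum>s\<in>S. A r s * g s) = 0) \<Longrightarrow> \<exists>c. \<forall>s\<in>S. g s = c * f s"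
proof -
  define good where "good Q \<longleftrightarrow> Q \<subseteq> R \<and>
    (\<forall>g. (\<forall>r\<in>Q. (\<Sum>s\<in>S. A r s * g s) = 0) \<longrightarrow> (\<exists>c. \<forall>s\<in>S. g s = c * f s))" for Q
  have "good R" using ker by (auto simp: good_def)
  then obtain R0 where R0: "good R0" "\<And>Q. good Q \<Longrightarrow> card R0 \<le> card Q"
    using ex_has_least_nat[of good R card] by blast
  have finR0: "finite R0" using R0(1) fin by (auto simp: good_def intro: finite_subset)
  have *: "\<exists>x. (\<forall>q\<in>R0 - {r}. (\<Sum>s\<in>S. A q s * x s) = 0) \<and> (\<Sum>s\<in>S. A r s * x s) \<noteq> 0"
    if r: "r \<in> R0" for r
  proof (rule ccontr)
    assume H: "\<not> ?thesis"
    have "good (R0 - {r})"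
      unfolding good_def
    proof (intro conjI allI impI)
      show "R0 - {r} \<subseteq> R" using R0(1) by (auto simp: good_def)
      fix g assume "\<forall>q\<in>R0 - {r}. (\<Sum>s\<in>S. A q s * g s) = 0"
      moreover from this H have "(\<Sum>s\<in>S. A r s * g s) = 0" by blast
      ultimately have "\<forall>q\<in>R0. (\<Sum>s\<in>S. A q s * g s) = 0" by auto
      then show "\<exists>c. \<forall>s\<in>S. g s = c * f s" using R0(1) by (auto simp: good_def)
    qed
    from R0(2)[OF this] card_Diff1_less[OF finR0 r] show False by simp
  qed
  then obtain x where x: "\<And>r q. r \<in> R0 \<Longrightarrow> q \<in> R0 \<Longrightarrow> q \<noteq> r \<Longrightarrow> (\<Sum>s\<in>S. A q s * x r s) = 0"
      "\<And>r. r \<in> R0 \<Longrightarrow> (\<Sum>s\<in>S. A r s * x r s) \<noteq> 0"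
  proof -
    assume that: "\<And>x. (\<And>r q. r \<in> R0 \<Longrightarrow> q \<in> R0 \<Longrightarrow> q \<noteq> r \<Longrightarrow> (\<Sum>s\<in>S. A q s * x r s) = 0) \<Longrightarrow>
      (\<And>r. r \<in> R0 \<Longrightarrow> (\<Sum>s\<in>S. A r s * x r s) \<noteq> 0) \<Longrightarrow> thesis"
    have "\<forall>r\<in>R0. \<exists>x. (\<forall>q\<in>R0 - {r}. (\<Sum>s\<in>S. A q s * x s) = 0) \<and> (\<Sum>s\<in>S. A r s * x s) \<noteq> 0"
      using * by blast
    from bchoice[OF this] obtain y where "\<forall>r\<in>R0. (\<forall>q\<in>R0 - {r}. (\<Sum>s\<in>S. A q s * y r s) = 0) \<and> (\<Sum>s\<in>S. A r s * y r s) \<noteq> 0"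
      by blast
    then show thesis by (intro that[of y]) auto
  qed
  have "card R0 < card S"
  proof (rule ccontr)
    assume "\<not> ?thesis"
    \<comment> \<open>\<open>None\<close> stands for the kernel vector \<open>f\<close>,
      \<open>Some r\<close> for the vector that separates row \<open>r\<close> from the other rows.
      More than \<open>card S\<close> vectors in \<open>card S\<close> coordinates are dependent,
      and applying row \<open>r\<close> to a dependency isolates its coefficient at
      \<open>Some r\<close>.\<close>
    then have "card S < card (insert None (Some ` R0))"
      using finR0 by (simp add: card_image image_iff)
    from homog_nontrivial[OF fin(2) _ this, of "\<lambda>s v. case v of None \<Rightarrow> f s | Some r \<Rightarrow> x r s"] finR0
    obtain z where z: "\<exists>v\<in>insert None (Some ` R0). z v \<noteq> 0"
      "\<And>s. s \<in> S \<Longrightarrow> (\<Sum>v\<in>insert None (Some ` R0). (case v of None \<Rightarrow> f s | Some r \<Rightarrow> x r s) * z v) = 0"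
      by auto
    have zs: "f s * z None + (\<Sum>r\<in>R0. x r s * z (Some r)) = 0" if "s \<in> S" for s
      using z(2)[OF that] finR0 by (simp add: sum.reindex image_iff)
    have "z (Some r) = 0" if r: "r \<in> R0" for r
    proof -
      have "0 = (\<Sum>s\<in>S. A r s * (f s * z None + (\<Sum>q\<in>R0. x q s * z (Some q))))"
        using zs by simp
      also have "\<dots> = (\<Sum>s\<in>S. A r s * f s) * z None + (\<Sum>s\<in>S. \<Sum>q\<in>R0. A r s * x q s * z (Some q))"
        by (simp add: algebra_simps sum.distrib sum_distrib_left sum_distrib_right)
      also have "(\<Sum>s\<in>S. A r s * f s) = 0" using r R0(1) fR by (auto simp: good_def)
      also have "(\<Sum>s\<in>S. \<Sum>q\<in>R0. A r s * x q s * z (Some q)) = (\<Sum>q\<in>R0. (\<Sum>s\<in>S. A r s * x q s) * z (Some q))"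
        by (subst sum.swap) (simp add: sum_distrib_right)
      also have "\<dots> = (\<Sum>q\<in>R0. if q = r then (\<Sum>s\<in>S. A r s * x r s) * z (Some r) else 0)"
        using x(1) r by (intro sum.cong) auto
      also have "\<dots> = (\<Sum>s\<in>S. A r s * x r s) * z (Some r)"
        using r finR0 by simp
      finally show ?thesis using x(2)[OF r] by simp
    qed
    then have "z None \<noteq> 0" using z(1) by auto
    moreover have "f s * z None = 0" if "s \<in> S" for s
      using zs[OF that] \<open>\<And>r. r \<in> R0 \<Longrightarrow> z (Some r) = 0\<close> by simp
    ultimately show False using f0 by auto
  qed
  with R0(1) show thesis by (intro that[of R0]) (auto simp: good_def)
qed

text \<open>Siegel's lemma for a kernel that is a line. Two points of an integral box have equal row
  values, so their difference is an integral kernel vector; as a multiple of the positive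
  \<open>f\<close> it has constant sign and no zero entry, and absolute values do the rest. The
  pigeonhole count requires fewer rows than unknowns, hence \<open>few_rows_suffice\<close>.\<close>

lemma siegel_positive:
  fixes A :: "'r \<Rightarrow> 's \<Rightarrow> int" and f :: "'s \<Rightarrow> real" and U :: nat
  assumes fin: "finite R" "finite S" "S \<noteq> {}"
    and A: "\<And>r s. r \<in> R \<Longrightarrow> s \<in> S \<Longrightarrow> \<bar>A r s\<bar> \<le> int U" and U: "U \<ge> 1"
    and f0: "\<And>s. s \<in> S \<Longrightarrow> f s > 0"
    and fR: "\<And>r. r \<in> R \<Longrightarrow> (\<Sum>s\<in>S. of_int (A r s) * f s) = 0"
    and ker: "\<And>g. (\<And>r. r \<in> R \<Longrightarrow> (\<Sum>s\<in>S. of_int (A r s) * g s) = 0) \<Longrightarrow> \<exists>c. \<forall>s\<in>S. g s = c * f s"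
  obtains g :: "'s \<Rightarrow> nat" and c where "c > 0" "\<And>s. s \<in> S \<Longrightarrow> real (g s) = c * f s"
    "\<And>s. s \<in> S \<Longrightarrow> 1 \<le> g s \<and> g s \<le> (2 * U * card S) ^ card S"
proof -
  obtain R0 where R0: "R0 \<subseteq> R" "card R0 < card S"
    "\<And>g. (\<And>r. r \<in> R0 \<Longrightarrow> (\<Sum>s\<in>S. of_int (A r s) * g s) = 0) \<Longrightarrow> \<exists>c. \<forall>s\<in>S. g s = c * f s"
  proof (rule few_rows_suffice[OF fin(1,2), of f "\<lambda>r s. of_int (A r s)"])
    show "\<exists>s\<in>S. f s \<noteq> 0" using f0 fin(3) by fastforce
  qed (use fR ker in blast)+
  define N where "N = card S"
  have N: "N \<ge> 1" using fin by (simp add: N_def Suc_leI card_gt_0_iff)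
  \<comment> \<open>Chosen so that \<open>(2 * U * N) ^ (N - 1) <= B\<close>: at most
    \<open>N - 1\<close> rows, each with \<open>2 * U * N * B + 1\<close> possible values, then give
    fewer value vectors than the \<open>(B + 1) ^ N\<close> points of the box.\<close>
  define B where "B = (2 * U * N) ^ N"
  define X where "X = PiE S (\<lambda>_. {0..int B})"
  define Y where "Y = PiE R0 (\<lambda>_. {- int (U * N * B)..int (U * N * B)})"
  define h where "h x = restrict (\<lambda>r. \<Sum>s\<in>S. A r s * x s) R0" for x :: "'s \<Rightarrow> int"
  have finR0: "finite R0" using R0(1) fin by (auto intro: finite_subset)
  have cX: "card X = (B + 1) ^ N"
    using fin by (simp add: X_def card_PiE N_def nat_add_distrib)
  have cY: "card Y = (2 * U * N * B + 1) ^ card R0"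
    using finR0 by (simp add: Y_def card_PiE nat_add_distrib nat_mult_distrib algebra_simps)
  have "card Y < card X"
  proof -
    have one: "1 \<le> 2 * U * N" using U N by simp
    have "card Y \<le> (2 * U * N * B + 1) ^ (N - 1)"
      unfolding cY using R0(2) by (intro power_increasing) (auto simp: N_def)
    also have "\<dots> \<le> (2 * U * N * (B + 1)) ^ (N - 1)"
      using one by (intro power_mono) (auto simp: algebra_simps)
    also have "\<dots> = (2 * U * N) ^ (N - 1) * (B + 1) ^ (N - 1)" by (rule power_mult_distrib)
    also have "\<dots> \<le> B * (B + 1) ^ (N - 1)"
      unfolding B_def using one by (intro mult_right_mono power_increasing) auto
    also have "\<dots> < (B + 1) * (B + 1) ^ (N - 1)" by simp
    also have "\<dots> = card X" using N by (simp add: cX power_eq_if)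
    finally show ?thesis .
  qed
  moreover have "h ` X \<subseteq> Y"
  proof
    fix y assume "y \<in> h ` X"
    then obtain x where x: "x \<in> X" "y = h x" by auto
    have "\<bar>\<Sum>s\<in>S. A r s * x s\<bar> \<le> int (U * N * B)" if "r \<in> R0" for r
    proof -
      have "\<bar>\<Sum>s\<in>S. A r s * x s\<bar> \<le> (\<Sum>s\<in>S. \<bar>A r s * x s\<bar>)" by (rule sum_abs)
      also have "\<dots> \<le> (\<Sum>s\<in>S. int U * int B)"
        unfolding abs_mult using x that R0(1) A by (intro sum_mono mult_mono) (auto simp: X_def PiE_iff)
      also have "\<dots> = int (U * N * B)" by (simp add: N_def)
      finally show ?thesis .
    qed
    then show "y \<in> Y" unfolding x(2) h_def Y_def by (force simp: abs_le_iff minus_le_iff)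
  qed
  moreover have "finite Y" unfolding Y_def using finR0 by (intro finite_PiE) auto
  ultimately have "\<not> inj_on h X"
    using card_inj_on_le[of h X Y] by linarith
  then obtain x y where xy: "x \<in> X" "y \<in> X" "x \<noteq> y" "h x = h y" by (auto simp: inj_on_def)
  define d where "d s = x s - y s" for s
  have "(\<Sum>s\<in>S. of_int (A r s) * of_int (d s)) = (0::real)" if "r \<in> R0" for r
  proof -
    have "(\<Sum>s\<in>S. A r s * x s) = (\<Sum>s\<in>S. A r s * y s)"
      using fun_cong[OF xy(4), of r] that by (simp add: h_def)
    then have "(\<Sum>s\<in>S. A r s * d s) = 0" by (simp add: d_def algebra_simps sum_subtractf)
    then have "real_of_int (\<Sum>s\<in>S. A r s * d s) = 0" by simp
    then show ?thesis by simp
  qed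
  from R0(3)[of "\<lambda>s. of_int (d s)", OF this] obtain c where c: "\<And>s. s \<in> S \<Longrightarrow> of_int (d s) = c * f s"
    by blast
  have dB: "\<bar>d s\<bar> \<le> int B" if "s \<in> S" for s
  proof -
    have "0 \<le> x s \<and> x s \<le> int B" "0 \<le> y s \<and> y s \<le> int B"
      using xy(1,2) that unfolding X_def by auto
    then show ?thesis by (auto simp: d_def abs_le_iff)
  qed
  have "\<exists>s\<in>S. d s \<noteq> 0"
  proof (rule ccontr)
    assume "\<not> ?thesis"
    then have "x = y" using xy(1,2) unfolding X_def d_def by (intro PiE_ext[of x S _ y]) auto
    with xy(3) show False by simp
  qed
  then have "c \<noteq> 0" using c by auto
  show thesis
  proof (rule that[of "\<bar>c\<bar>" "\<lambda>s. nat \<bar>d s\<bar>"])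
    show "0 < \<bar>c\<bar>" using \<open>c \<noteq> 0\<close> by simp
    fix s assume s: "s \<in> S"
    have "real_of_int \<bar>d s\<bar> = \<bar>c\<bar> * f s" using c[OF s] f0[OF s] by (simp add: abs_mult)
    then show *: "real (nat \<bar>d s\<bar>) = \<bar>c\<bar> * f s" by simp
    have "real (nat \<bar>d s\<bar>) > 0" unfolding * using \<open>c \<noteq> 0\<close> f0[OF s] by simp
    then show "1 \<le> nat \<bar>d s\<bar> \<and> nat \<bar>d s\<bar> \<le> (2 * U * card S) ^ card S"
      using dB[OF s] by (simp add: B_def N_def nat_le_iff)
  qed
qed

subsection \<open>Existence of equilibria\<close>

lemma convergent_subseq_finite:
  fixes X :: "nat \<Rightarrow> 'a \<Rightarrow> real"
  assumes "finite S" and "\<And>m s. s \<in> S \<Longrightarrow> \<bar>X m s\<bar> \<le> B"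
  shows "\<exists>\<sigma> L. strict_mono (\<sigma> :: nat \<Rightarrow> nat) \<and> (\<forall>s\<in>S. (\<lambda>m. X (\<sigma> m) s) \<longlonglongrightarrow> L s)"
  using assms
proof (induction S rule: finite_induct)
  case empty
  show ?case by (intro exI[of _ id]) (auto simp: strict_mono_def)
next
  case (insert a S)
  then obtain \<sigma> L where \<sigma>: "strict_mono \<sigma>" "\<forall>s\<in>S. (\<lambda>m. X (\<sigma> m) s) \<longlonglongrightarrow> L s" by auto
  have "bounded (range (\<lambda>m. X (\<sigma> m) a))"
    using insert.prems by (auto simp: bounded_iff)
  then obtain l \<rho> where \<rho>: "strict_mono \<rho>" "((\<lambda>m. X (\<sigma> m) a) \<circ> \<rho>) \<longlonglongrightarrow> l"
    using bounded_imp_convergent_subsequence by blast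
  have "(\<lambda>m. X ((\<sigma> \<circ> \<rho>) m) s) \<longlonglongrightarrow> (L(a := l)) s" if "s \<in> insert a S" for s
  proof (cases "s = a")
    case True
    then show ?thesis using \<rho>(2) by (simp add: o_def)
  next
    case False
    then have "(\<lambda>m. X (\<sigma> m) s) \<longlonglongrightarrow> L s" using that \<sigma>(2) by auto
    from LIMSEQ_subseq_LIMSEQ[OF this \<rho>(1)] False show ?thesis by (simp add: o_def)
  qed
  moreover have "strict_mono (\<sigma> \<circ> \<rho>)" using \<sigma>(1) \<rho>(1) by (simp add: strict_mono_o)
  ultimately show ?case by blast
qed

text \<open>Brouwer's theorem with the dimension as a variable of the statement, hence sequential
  continuity for functions on \<open>nat\<close>. Kuhn's lemma on the grid of mesh
  \<open>1 / Suc p\<close> yields a small cell in which every coordinate has a corner that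
  \<open>f\<close> does not decrease and one that it does not increase. The cells converge along a
  subsequence, and both inequalities pass to the limit.\<close>

lemma brouwer_cube_nat:
  fixes f :: "(nat \<Rightarrow> real) \<Rightarrow> nat \<Rightarrow> real"
  assumes cont: "\<And>X x i. (\<And>m j. j < n \<Longrightarrow> 0 \<le> X m j \<and> X m j \<le> 1) \<Longrightarrow>
      (\<And>j. j < n \<Longrightarrow> (\<lambda>m. X m j) \<longlonglongrightarrow> x j) \<Longrightarrow> i < n \<Longrightarrow> (\<lambda>m::nat. f (X m) i) \<longlonglongrightarrow> f x i"
    and self: "\<And>x i. (\<And>j. j < n \<Longrightarrow> 0 \<le> x j \<and> x j \<le> 1) \<Longrightarrow> i < n \<Longrightarrow> 0 \<le> f x i \<and> f x i \<le> 1"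
  obtains x where "\<And>j. j < n \<Longrightarrow> 0 \<le> x j \<and> x j \<le> 1" "\<And>i. i < n \<Longrightarrow> f x i = x i"
proof -
  define sc where "sc p y = (\<lambda>j. real (y j) / real (Suc p))" for p and y :: "nat \<Rightarrow> nat"
  \<comment> \<open>Kuhn's lemma forces the labels on opposite faces. There the sign of
    \<open>f x i - x i\<close> is automatic, because \<open>f\<close> maps into the cube.\<close>
  define label where "label p y i =
      (if y i = 0 then 0 else if y i = Suc p then 1 else if f (sc p y) i \<ge> sc p y i then 0 else (1::nat))" for p y i
  define P where "P p q r s \<longleftrightarrow> (\<forall>i<n. q i < Suc p) \<and> (\<forall>i<n. (\<forall>j<n. q j \<le> r i j \<and> r i j \<le> q j + 1) \<and>
      (\<forall>j<n. q j \<le> s i j \<and> s i j \<le> q j + 1) \<and> label p (r i) i = 0 \<and> label p (s i) i = 1)" for p q r s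
  have "\<forall>p. \<exists>q r s. P p q r s"
  proof
    fix p
    obtain q where q: "\<forall>i<n. q i < Suc p" "\<forall>i<n. \<exists>r s. (\<forall>j<n. q j \<le> r j \<and> r j \<le> q j + 1) \<and>
       (\<forall>j<n. q j \<le> s j \<and> s j \<le> q j + 1) \<and> label p r i \<noteq> label p s i"
      by (rule kuhn_lemma[of "Suc p" n "label p"]) (auto simp: label_def)
    have l01: "label p r i = 0 \<or> label p r i = 1" for r i by (auto simp: label_def)
    define R where "R i r s \<longleftrightarrow> (\<forall>j<n. q j \<le> r j \<and> r j \<le> q j + 1) \<and>
       (\<forall>j<n. q j \<le> s j \<and> s j \<le> q j + 1) \<and> label p r i = 0 \<and> label p s i = 1" for i r s
    have "\<exists>r s. R i r s" if "i < n" for i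
    proof -
      from q(2)[rule_format, OF that] obtain r where "\<exists>s. (\<forall>j<n. q j \<le> r j \<and> r j \<le> q j + 1) \<and>
        (\<forall>j<n. q j \<le> s j \<and> s j \<le> q j + 1) \<and> label p r i \<noteq> label p s i" ..
      then obtain s where "(\<forall>j<n. q j \<le> r j \<and> r j \<le> q j + 1) \<and>
        (\<forall>j<n. q j \<le> s j \<and> s j \<le> q j + 1) \<and> label p r i \<noteq> label p s i" ..
      then have "R i r s \<or> R i s r" using l01[of r i] l01[of s i] unfolding R_def by auto
      then show ?thesis by blast
    qed
    then have "\<forall>i. \<exists>r s. i < n \<longrightarrow> R i r s" by blast
    then obtain r s where "\<forall>i. i < n \<longrightarrow> R i (r i) (s i)" by metis
    then have "P p q r s" using q(1) by (auto simp: R_def P_def)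
    then show "\<exists>q r s. P p q r s" by blast
  qed
  then obtain q r s where "\<forall>p. P p (q p) (r p) (s p)" by metis
  then have q: "\<And>p i. i < n \<Longrightarrow> q p i < Suc p"
    and r: "\<And>p i j. i < n \<Longrightarrow> j < n \<Longrightarrow> q p j \<le> r p i j \<and> r p i j \<le> q p j + 1"
    and s: "\<And>p i j. i < n \<Longrightarrow> j < n \<Longrightarrow> q p j \<le> s p i j \<and> s p i j \<le> q p j + 1"
    and lr: "\<And>p i. i < n \<Longrightarrow> label p (r p i) i = 0" and ls: "\<And>p i. i < n \<Longrightarrow> label p (s p i) i = 1"
    unfolding P_def by blast+
  have bnd: "0 \<le> sc p y j \<and> sc p y j \<le> 1" if "y j \<le> Suc p" for p y j
    using that by (auto simp: sc_def divide_simps)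
  have "\<bar>sc p (q p) j\<bar> \<le> 1" if "j \<in> {..<n}" for p j
    using bnd[of "q p" j p] q[of j p] that by (simp add: abs_le_iff)
  then have "\<exists>\<sigma> x. strict_mono \<sigma> \<and> (\<forall>j\<in>{..<n}. (\<lambda>m. sc (\<sigma> m) (q (\<sigma> m)) j) \<longlonglongrightarrow> x j)"
    by (intro convergent_subseq_finite) auto
  then obtain \<sigma> x where \<sigma>: "strict_mono (\<sigma> :: nat \<Rightarrow> nat)"
    and x': "\<forall>j\<in>{..<n}. (\<lambda>m. sc (\<sigma> m) (q (\<sigma> m)) j) \<longlonglongrightarrow> x j" by blast
  have x: "(\<lambda>m. sc (\<sigma> m) (q (\<sigma> m)) j) \<longlonglongrightarrow> x j" if "j < n" for j
    using x' that by simp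
  have lim0: "(\<lambda>m. 1 / real (Suc (\<sigma> m))) \<longlonglongrightarrow> 0"
    using LIMSEQ_subseq_LIMSEQ[OF LIMSEQ_inverse_real_of_nat \<sigma>] by (simp add: o_def inverse_eq_divide)
  have near: "(\<lambda>m. sc (\<sigma> m) (y m) j) \<longlonglongrightarrow> x j"
    if "j < n" and y: "\<And>m. q (\<sigma> m) j \<le> y m j \<and> y m j \<le> q (\<sigma> m) j + 1" for y j
  proof (rule tendsto_sandwich)
    show "\<forall>\<^sub>F m in sequentially. sc (\<sigma> m) (q (\<sigma> m)) j \<le> sc (\<sigma> m) (y m) j"
      using y by (intro always_eventually allI) (simp add: sc_def divide_right_mono)
    show "\<forall>\<^sub>F m in sequentially. sc (\<sigma> m) (y m) j \<le> sc (\<sigma> m) (q (\<sigma> m)) j + 1 / real (Suc (\<sigma> m))"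
    proof (intro always_eventually allI)
      fix m
      have "real (y m j) \<le> real (q (\<sigma> m) j) + 1" using y[of m] by linarith
      then show "sc (\<sigma> m) (y m) j \<le> sc (\<sigma> m) (q (\<sigma> m)) j + 1 / real (Suc (\<sigma> m))"
        unfolding sc_def add_divide_distrib[symmetric] by (intro divide_right_mono) auto
    qed
    show "(\<lambda>m. sc (\<sigma> m) (q (\<sigma> m)) j) \<longlonglongrightarrow> x j" by (rule x[OF that(1)])
    show "(\<lambda>m. sc (\<sigma> m) (q (\<sigma> m)) j + 1 / real (Suc (\<sigma> m))) \<longlonglongrightarrow> x j"
      using tendsto_add[OF x[OF that(1)] lim0] by simp
  qed
  have x01: "0 \<le> x j \<and> x j \<le> 1" if "j < n" for j
  proof -
    have b: "\<And>m. 0 \<le> sc (\<sigma> m) (q (\<sigma> m)) j \<and> sc (\<sigma> m) (q (\<sigma> m)) j \<le> 1"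
      using bnd q[OF that] by (simp add: less_imp_le)
    show ?thesis
      using LIMSEQ_le_const[OF x[OF that], of 0] LIMSEQ_le_const2[OF x[OF that], of 1] b by blast
  qed
  have "f x i = x i" if i: "i < n" for i
  proof (rule antisym)
    have le: "r p i j \<le> Suc p" "s p i j \<le> Suc p" if "j < n" for p j
      using r[OF i that, of p] s[OF i that, of p] q[OF that, of p] by auto
    have fr: "f (sc p (r p i)) i \<ge> sc p (r p i) i" for p
    proof (cases "r p i i = 0")
      case True
      then have "sc p (r p i) i = 0" by (simp add: sc_def)
      moreover have "0 \<le> f (sc p (r p i)) i" using self[of "sc p (r p i)" i] bnd le i by blast
      ultimately show ?thesis by simp
    next
      case False
      then show ?thesis using lr[OF i, of p] by (auto simp: label_def split: if_splits)
    qed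
    have fs: "f (sc p (s p i)) i \<le> sc p (s p i) i" for p
    proof (cases "s p i i = Suc p")
      case True
      then have "sc p (s p i) i = 1" by (simp add: sc_def)
      moreover have "f (sc p (s p i)) i \<le> 1" using self[of "sc p (s p i)" i] bnd le i by blast
      ultimately show ?thesis by simp
    next
      case False
      then show ?thesis using ls[OF i, of p] by (auto simp: label_def split: if_splits)
    qed
    have l1: "(\<lambda>m. f (sc (\<sigma> m) (r (\<sigma> m) i)) i) \<longlonglongrightarrow> f x i"
      by (rule cont) (use bnd le near[of _ "\<lambda>m. r (\<sigma> m) i"] r i in auto)
    have l2: "(\<lambda>m. sc (\<sigma> m) (r (\<sigma> m) i) i) \<longlonglongrightarrow> x i"
      using near[of i "\<lambda>m. r (\<sigma> m) i"] r i by auto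
    show "x i \<le> f x i" by (rule LIMSEQ_le[OF l2 l1]) (use fr in blast)
    have l1: "(\<lambda>m. f (sc (\<sigma> m) (s (\<sigma> m) i)) i) \<longlonglongrightarrow> f x i"
      by (rule cont) (use bnd le near[of _ "\<lambda>m. s (\<sigma> m) i"] s i in auto)
    have l2: "(\<lambda>m. sc (\<sigma> m) (s (\<sigma> m) i) i) \<longlonglongrightarrow> x i"
      using near[of i "\<lambda>m. s (\<sigma> m) i"] s i by auto
    show "f x i \<le> x i" by (rule LIMSEQ_le[OF l1 l2]) (use fs in blast)
  qed
  with x01 that show thesis by blast
qed

text \<open>Money flows: \<open>f i j\<close> is what agent \<open>i\<close> spends on good \<open>j\<close>, so that prices are row sums.\<close>

definition eqflow :: "nat \<Rightarrow> (nat \<Rightarrow> nat \<Rightarrow> nat) \<Rightarrow> (nat \<Rightarrow> nat \<Rightarrow> real) \<Rightarrow> bool" where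
  "eqflow n u f \<longleftrightarrow> (\<forall>i<n. \<forall>j<n. 0 \<le> f i j) \<and>
     (\<forall>i<n. 0 < (\<Sum>j<n. f i j)) \<and> (\<forall>i<n. (\<Sum>j<n. f j i) = (\<Sum>j<n. f i j)) \<and>
     (\<forall>i<n. \<forall>j<n. f i j > 0 \<longrightarrow>
        (\<forall>k<n. real (u i k) * (\<Sum>l<n. f j l) \<le> real (u i j) * (\<Sum>l<n. f k l)))"

text \<open>This is where irreducibility enters. If the agents with positive price were a proper
  subset, one of them would like a good of price zero; then any good on which it spends money must
  have price zero as well, although money flows into it.\<close>

lemma eqflow_positive:
  assumes m: "exchange_market n u"
    and nonneg: "\<And>i j. i < n \<Longrightarrow> j < n \<Longrightarrow> 0 \<le> f i j"
    and row: "\<And>i. i < n \<Longrightarrow> (\<Sum>j<n. f i j) = p i" and col: "\<And>j. j < n \<Longrightarrow> (\<Sum>i<n. f i j) = p j"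
    and pos: "\<exists>i<n. p i > 0"
    and tight: "\<And>i j k. i < n \<Longrightarrow> j < n \<Longrightarrow> k < n \<Longrightarrow> f i j > 0 \<Longrightarrow> real (u i k) * p j \<le> real (u i j) * p k"
    and i: "i < n"
  shows "(p i :: real) > 0"
proof (rule ccontr)
  assume "\<not> p i > 0"
  define Q where "Q = {i. i < n \<and> p i > 0}"
  have "Q \<noteq> {}" "Q \<subset> {..<n}" using pos \<open>\<not> p i > 0\<close> i by (auto simp: Q_def)
  then obtain a b where ab: "a \<in> Q" "b \<in> {..<n} - Q" "u a b > 0"
    using m unfolding exchange_market_def by meson
  have p0: "p j \<ge> 0" if "j < n" for j using row[OF that] sum_nonneg[of "{..<n}" "f j"] nonneg that by auto
  have pb: "p b = 0" using ab(2) p0[of b] by (auto simp: Q_def)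
  have "(\<Sum>j<n. f a j) > 0" using row[of a] ab(1) by (simp add: Q_def)
  then obtain j where j: "j < n" "f a j > 0"
    using sum_nonpos[of "{..<n}" "f a"] by force
  have "real (u a b) * p j \<le> 0" using tight[of a j b] ab j pb by (auto simp: Q_def)
  then have "p j \<le> 0" using ab(3) by (simp add: mult_le_0_iff)
  moreover have "f a j \<le> (\<Sum>i<n. f i j)"
    using ab(1) nonneg j by (intro member_le_sum) (auto simp: Q_def)
  ultimately show False using col[OF j(1)] j(2) by simp
qed

lemma eqflow_equilibrium:
  assumes f: "eqflow n u f"
  shows "equilibrium_prices n u (\<lambda>i. \<Sum>j<n. f i j)"
proof -
  define p where "p i = (\<Sum>j<n. f i j)" for i
  have pos: "p i > 0" if "i < n" for i using f that by (simp add: eqflow_def p_def)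
  have "equilibrium n u p (\<lambda>i j. f i j / p j)"
    unfolding equilibrium_def
  proof (intro conjI allI impI)
    fix i j assume ij: "i < n" "j < n"
    show "0 \<le> f i j / p j" using pos[of j] f ij by (simp add: eqflow_def)
    assume "0 < f i j / p j"
    then have fp: "f i j > 0" using pos[OF ij(2)] by (simp add: zero_less_divide_iff)
    have "real (u i l) / p l \<le> real (u i j) / p j" if "l < n" for l
    proof -
      have "real (u i l) * p j \<le> real (u i j) * p l" using f ij that fp by (simp add: eqflow_def p_def)
      then show ?thesis using pos that ij by (simp add: divide_simps mult.commute)
    qed
    then show "real (u i j) / p j = Max ((\<lambda>l. real (u i l) / p l) ` {..<n})"
      using ij by (intro Max_eqI[symmetric]) auto
  next
    fix j assume j: "j < n"
    have "(\<Sum>i<n. f i j / p j) = (\<Sum>i<n. f i j) / p j" by (simp add: sum_divide_distrib)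
    also have "(\<Sum>i<n. f i j) = p j" using f j by (simp add: eqflow_def p_def)
    finally show "(\<Sum>i<n. f i j / p j) = 1" using pos[OF j] by simp
  next
    fix i assume "i < n"
    have "(\<Sum>j<n. f i j / p j * p j) = (\<Sum>j<n. f i j)" using pos by (intro sum.cong) (auto simp: less_imp_neq[symmetric])
    then show "(\<Sum>j<n. f i j / p j * p j) = p i" by (simp add: p_def)
  qed (use pos in auto)
  then show ?thesis by (auto simp: equilibrium_prices_def p_def[abs_def])
qed

text \<open>Agents spread their money with weights \<open>(u i j / b j) ^ K\<close>; a fixed point of the induced
  circulation of money is an equilibrium in the limit \<open>K \<rightarrow> \<infinity>\<close>.\<close>

lemma approximate_equilibrium:
  assumes m: "exchange_market n u" and e: "0 < e"
  obtains b :: "nat \<Rightarrow> real" and g where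
    "\<And>i. i < n \<Longrightarrow> b i > 0" "(\<Sum>i<n. b i) = 1"
    "\<And>i j. i < n \<Longrightarrow> j < n \<Longrightarrow> 0 \<le> g i j"
    "\<And>i. i < n \<Longrightarrow> (\<Sum>j<n. g i j) = b i" "\<And>j. j < n \<Longrightarrow> (\<Sum>i<n. g i j) = (1 + real n * e) * b j - e"
    "\<And>i j k. i < n \<Longrightarrow> j < n \<Longrightarrow> k < n \<Longrightarrow> u i k > 0 \<Longrightarrow> g i j \<le> (real (u i j) * b k / (real (u i k) * b j)) ^ K"
proof -
  \<comment> \<open>The perturbation \<open>e\<close> keeps the prices \<open>bb x\<close> positive,
    so that the weights \<open>ww\<close> are continuous on the whole cube. At a fixed point, whose
    entries sum to 1, it reappears as the defect in the column sums
    \<open>(1 + real n * e) * b j - e\<close>.\<close>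
  define bb where "bb x i = (x i + e) / ((\<Sum>k<n. x k) + real n * e)" for x i
  define ww where "ww x i j = (real (u i j) / bb x j) ^ K" for x i j
  define mm where "mm x i j = ww x i j / (\<Sum>k<n. ww x i k)" for x i j
  define F where "F x j = (\<Sum>i<n. bb x i * mm x i j)" for x j
  have n: "n > 0" using m by (simp add: exchange_market_def)
  have den: "(\<Sum>k<n. x k) + real n * e > 0" if "\<And>j. j < n \<Longrightarrow> 0 \<le> x j" for x
    using that n e by (intro add_nonneg_pos sum_nonneg) auto
  have bpos: "bb x i > 0" if "\<And>j. j < n \<Longrightarrow> 0 \<le> x j" "i < n" for x i
    unfolding bb_def using den[of x] that e by (intro divide_pos_pos) (auto intro: add_nonneg_pos)
  have bsum: "(\<Sum>i<n. bb x i) = 1" if "\<And>j. j < n \<Longrightarrow> 0 \<le> x j" for x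
    using den[of x] that by (simp add: bb_def sum_divide_distrib[symmetric] sum.distrib)
  have wpos: "ww x i j \<ge> 0" if "\<And>j. j < n \<Longrightarrow> 0 \<le> x j" "j < n" for x i j
    using bpos[of x j] that by (simp add: ww_def)
  have Wpos: "(\<Sum>k<n. ww x i k) > 0" if "\<And>j. j < n \<Longrightarrow> 0 \<le> x j" "i < n" for x i
  proof -
    have "\<exists>k<n. u i k > 0" using m that(2) by (simp add: exchange_market_def)
    then obtain k where k: "k < n" "u i k > 0" by blast
    have "0 < ww x i k" using bpos[of x k] that k by (simp add: ww_def)
    also have "\<dots> \<le> (\<Sum>k<n. ww x i k)" using k wpos that by (intro member_le_sum) auto
    finally show ?thesis .
  qed
  have mpos: "mm x i j \<ge> 0" if "\<And>j. j < n \<Longrightarrow> 0 \<le> x j" "i < n" "j < n" for x i j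
    using wpos[of x j i] Wpos[of x i] that by (simp add: mm_def)
  have msum: "(\<Sum>j<n. mm x i j) = 1" if "\<And>j. j < n \<Longrightarrow> 0 \<le> x j" "i < n" for x i
    using Wpos[of x i] that by (simp add: mm_def sum_divide_distrib[symmetric])
  have Fpos: "F x j \<ge> 0" if "\<And>j. j < n \<Longrightarrow> 0 \<le> x j" "j < n" for x j
    unfolding F_def using that mpos[of x] bpos[of x] by (intro sum_nonneg mult_nonneg_nonneg) (auto intro: less_imp_le)
  have Fsum: "(\<Sum>j<n. F x j) = 1" if "\<And>j. j < n \<Longrightarrow> 0 \<le> x j" for x
  proof -
    have "(\<Sum>j<n. F x j) = (\<Sum>i<n. bb x i * (\<Sum>j<n. mm x i j))"
      unfolding F_def by (subst sum.swap) (simp add: sum_distrib_left)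
    also have "\<dots> = 1" using msum[of x] bsum[of x] that by simp
    finally show ?thesis .
  qed
  obtain x where x: "\<And>j. j < n \<Longrightarrow> 0 \<le> x j \<and> x j \<le> 1" "\<And>i. i < n \<Longrightarrow> F x i = x i"
  proof (rule brouwer_cube_nat[of n F])
    fix x i assume *: "\<And>j. j < n \<Longrightarrow> (0::real) \<le> x j \<and> x j \<le> 1" "i < n"
    then have "F x i \<le> (\<Sum>j<n. F x j)" using Fpos by (intro member_le_sum) auto
    then show "0 \<le> F x i \<and> F x i \<le> 1" using Fpos Fsum * by auto
  next
    fix X x i assume *: "\<And>m j. j < n \<Longrightarrow> (0::real) \<le> X m j \<and> X m j \<le> 1"
       "\<And>j. j < n \<Longrightarrow> (\<lambda>m::nat. X m j) \<longlonglongrightarrow> x j" "i < n"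
    have x0: "0 \<le> x j" if "j < n" for j using LIMSEQ_le_const[OF *(2)[OF that], of 0] *(1)[OF that] by simp
    have b: "(\<lambda>m. bb (X m) j) \<longlonglongrightarrow> bb x j" if "j < n" for j
      unfolding bb_def using den[of x] x0 *(2) that by (intro tendsto_intros) auto
    have w: "(\<lambda>m. ww (X m) j k) \<longlonglongrightarrow> ww x j k" if "k < n" for j k
      unfolding ww_def using b[OF that] bpos[of x k] x0 that by (intro tendsto_intros) auto
    have mt: "(\<lambda>m. mm (X m) j k) \<longlonglongrightarrow> mm x j k" if "j < n" "k < n" for j k
      unfolding mm_def using w that Wpos[of x j] x0 by (intro tendsto_intros) auto
    show "(\<lambda>m. F (X m) i) \<longlonglongrightarrow> F x i"
      unfolding F_def using b mt *(3) by (intro tendsto_intros) auto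
  qed blast
  have x0: "\<And>j. j < n \<Longrightarrow> 0 \<le> x j" using x(1) by blast
  have xs: "(\<Sum>j<n. x j) = 1" using Fsum[of x] x0 x(2) by simp
  define g where "g i j = bb x i * mm x i j" for i j
  have gb: "(\<Sum>j<n. g i j) = bb x i" if "i < n" for i
    using msum[of x i] x0 that by (simp add: g_def sum_distrib_left[symmetric])
  show thesis
  proof (rule that[of "bb x" g])
    show "(\<Sum>i<n. g i j) = (1 + real n * e) * bb x j - e" if "j < n" for j
    proof -
      have "(\<Sum>i<n. g i j) = x j" using x(2)[OF that] by (simp add: F_def g_def)
      moreover have "(1 + real n * e) * bb x j = x j + e"
        using den[of x] x0 xs by (simp add: bb_def)
      ultimately show ?thesis by simp
    qed
    fix i j assume ij: "i < n" "j < n"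
    show g0: "0 \<le> g i j" using mpos[of x i j] bpos[of x i] x0 ij by (simp add: g_def)
    fix k assume k: "k < n" "u i k > 0"
    have "bb x i \<le> (\<Sum>i<n. bb x i)" using ij bpos[of x] x0 by (intro member_le_sum) (auto intro: less_imp_le)
    then have "g i j \<le> 1 * mm x i j"
      unfolding g_def using bsum[of x] mpos[of x i j] x0 ij by (intro mult_right_mono) auto
    also have "1 * mm x i j \<le> ww x i j / ww x i k"
      unfolding mm_def mult_1
    proof (rule divide_left_mono)
      show "ww x i k \<le> (\<Sum>k<n. ww x i k)" using k wpos[of x] x0 by (intro member_le_sum) auto
      have "0 < ww x i k" using bpos[of x k] k x0 by (simp add: ww_def)
      then show "0 < (\<Sum>k<n. ww x i k) * ww x i k" using Wpos[of x i] x0 ij by simp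
    qed (use wpos[of x] x0 ij in auto)
    also have "\<dots> = (real (u i j) * bb x k / (real (u i k) * bb x j)) ^ K"
      by (simp add: ww_def power_divide[symmetric] mult.commute)
    finally show "g i j \<le> (real (u i j) * bb x k / (real (u i k) * bb x j)) ^ K" .
  qed (use bpos[of x] bsum[of x] x0 gb in auto)
qed

lemma eqflow_exists:
  assumes m: "exchange_market n u"
  obtains f where "eqflow n u f"
proof -
  define P where "P K b g \<longleftrightarrow> (\<forall>i<n. b i > 0) \<and> (\<Sum>i<n. b i) = 1 \<and> (\<forall>i<n. \<forall>j<n. 0 \<le> g i j) \<and>
    (\<forall>i<n. (\<Sum>j<n. g i j) = b i) \<and> (\<forall>j<n. (\<Sum>i<n. g i j) = (1 + real n * (1 / real (Suc K))) * b j - 1 / real (Suc K)) \<and>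
    (\<forall>i<n. \<forall>j<n. \<forall>k<n. u i k > 0 \<longrightarrow> g i j \<le> (real (u i j) * b k / (real (u i k) * b j)) ^ K)"
    for K :: nat and b :: "nat \<Rightarrow> real" and g :: "nat \<Rightarrow> nat \<Rightarrow> real"
  have "\<forall>K. \<exists>b g. P K b g"
  proof
    fix K
    have e: "0 < 1 / real (Suc K)" by simp
    show "\<exists>b g. P K b g"
    proof (rule approximate_equilibrium[OF m e, of K], goal_cases)
      case (1 b g)
      then have "P K b g" unfolding P_def by simp
      then show ?case by blast
    qed
  qed
  then obtain b g where "\<forall>K. P K (b K) (g K)" by metis
  then have bpos: "\<And>K i. i < n \<Longrightarrow> b K i > 0" and bsum: "\<And>K. (\<Sum>i<n. b K i) = 1"
    and gpos: "\<And>K i j. i < n \<Longrightarrow> j < n \<Longrightarrow> 0 \<le> g K i j"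
    and grow: "\<And>K i. i < n \<Longrightarrow> (\<Sum>j<n. g K i j) = b K i"
    and gcol: "\<And>K j. j < n \<Longrightarrow> (\<Sum>i<n. g K i j) = (1 + real n * (1 / real (Suc K))) * b K j - 1 / real (Suc K)"
    and gt: "\<And>K i j k. i < n \<Longrightarrow> j < n \<Longrightarrow> k < n \<Longrightarrow> u i k > 0 \<Longrightarrow> g K i j \<le> (real (u i j) * b K k / (real (u i k) * b K j)) ^ K"
    unfolding P_def by simp_all
  have b1: "b K i \<le> 1" if "i < n" for K i
    using member_le_sum[of i "{..<n}" "b K"] bpos bsum that by (auto intro: less_imp_le)
  have g1: "g K i j \<le> 1" if "i < n" "j < n" for K i j
    using member_le_sum[of j "{..<n}" "g K i"] gpos grow[of i K] b1[of i K] that by auto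
  have "\<exists>\<sigma> L. strict_mono \<sigma> \<and> (\<forall>s\<in>{..<n} \<times> {..<n}. (\<lambda>m. case s of (i, j) \<Rightarrow> g (\<sigma> m) i j) \<longlonglongrightarrow> L s)"
    by (rule convergent_subseq_finite[where B = 1]) (use g1 gpos in auto)
  then obtain \<sigma> L where \<sigma>: "strict_mono \<sigma>" and L: "\<And>i j. i < n \<Longrightarrow> j < n \<Longrightarrow> (\<lambda>m. g (\<sigma> m) i j) \<longlonglongrightarrow> L (i, j)"
    by auto
  define f where "f i j = L (i, j)" for i j
  define p where "p i = (\<Sum>j<n. f i j)" for i
  have fl: "(\<lambda>m. g (\<sigma> m) i j) \<longlonglongrightarrow> f i j" if "i < n" "j < n" for i j using L that by (simp add: f_def)
  have f0: "0 \<le> f i j" if "i < n" "j < n" for i j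
    using LIMSEQ_le_const[OF fl[OF that], of 0] gpos that by blast
  have "(\<lambda>m. \<Sum>j<n. g (\<sigma> m) i j) \<longlonglongrightarrow> p i" if "i < n" for i
    unfolding p_def using fl that by (intro tendsto_intros) auto
  then have bl: "(\<lambda>m. b (\<sigma> m) i) \<longlonglongrightarrow> p i" if "i < n" for i using grow that by simp
  have ps: "(\<Sum>i<n. p i) = 1"
  proof -
    have "(\<lambda>m. \<Sum>i<n. b (\<sigma> m) i) \<longlonglongrightarrow> (\<Sum>i<n. p i)" using bl by (intro tendsto_intros) auto
    then show ?thesis using bsum by (simp add: LIMSEQ_const_iff)
  qed
  have lim0: "(\<lambda>m. 1 / real (Suc (\<sigma> m))) \<longlonglongrightarrow> 0"
    using LIMSEQ_subseq_LIMSEQ[OF LIMSEQ_inverse_real_of_nat \<sigma>] by (simp add: o_def inverse_eq_divide)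
  have col: "(\<Sum>i<n. f i j) = p j" if j: "j < n" for j
  proof -
    have "(\<lambda>m. \<Sum>i<n. g (\<sigma> m) i j) \<longlonglongrightarrow> (\<Sum>i<n. f i j)" using fl j by (intro tendsto_intros) auto
    moreover have "(\<lambda>m. \<Sum>i<n. g (\<sigma> m) i j) \<longlonglongrightarrow> (1 + real n * 0) * p j - 0"
      unfolding gcol[OF j] using bl[OF j] lim0 by (intro tendsto_intros)
    ultimately show ?thesis using LIMSEQ_unique by force
  qed
  have tight: "real (u i k) * p j \<le> real (u i j) * p k"
    if i: "i < n" and j: "j < n" and k: "k < n" and fp: "f i j > 0" for i j k
  proof (rule ccontr)
    assume "\<not> ?thesis"
    then have viol: "real (u i j) * p k < real (u i k) * p j" by simp
    have p0: "p i \<ge> 0" if "i < n" for i unfolding p_def using f0 that by (intro sum_nonneg) auto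
    have "0 \<le> real (u i j) * p k" using p0[OF k] by simp
    with viol have "0 < real (u i k) * p j" by linarith
    then have uk: "u i k > 0" and pj: "p j > 0" using p0[OF j] by (auto simp: zero_less_mult_iff)
    \<comment> \<open>Bang per buck of good \<open>j\<close> relative to the better good
      \<open>k\<close>. Along the subsequence it stays below some \<open>c < 1\<close>, so agent
      \<open>i\<close> sends at most \<open>c ^ \<sigma> m\<close> to \<open>j\<close>, which
      vanishes in the limit.\<close>
    define \<rho> where "\<rho> = real (u i j) * p k / (real (u i k) * p j)"
    have \<rho>: "0 \<le> \<rho>" "\<rho> < 1" using viol uk pj p0[OF k] by (auto simp: \<rho>_def divide_simps)
    obtain c where c: "\<rho> < c" "c < 1" using \<rho>(2) dense by blast
    have "(\<lambda>m. real (u i j) * b (\<sigma> m) k / (real (u i k) * b (\<sigma> m) j)) \<longlonglongrightarrow> \<rho>"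
      unfolding \<rho>_def using bl j k uk pj by (intro tendsto_intros) auto
    then have "\<forall>\<^sub>F m in sequentially. real (u i j) * b (\<sigma> m) k / (real (u i k) * b (\<sigma> m) j) < c"
      using c(1) by (rule order_tendstoD)
    then have "\<forall>\<^sub>F m in sequentially. g (\<sigma> m) i j \<le> c ^ \<sigma> m"
    proof eventually_elim
      case (elim m)
      have "g (\<sigma> m) i j \<le> (real (u i j) * b (\<sigma> m) k / (real (u i k) * b (\<sigma> m) j)) ^ \<sigma> m"
        by (rule gt[OF i j k uk])
      also have "\<dots> \<le> c ^ \<sigma> m" using elim bpos[OF j, of "\<sigma> m"] bpos[OF k, of "\<sigma> m"]
        by (intro power_mono) (auto intro: less_imp_le)
      finally show ?case .
    qed
    moreover have "(\<lambda>m. c ^ \<sigma> m) \<longlonglongrightarrow> 0"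
      using LIMSEQ_subseq_LIMSEQ[OF LIMSEQ_realpow_zero[of c] \<sigma>] c \<rho>(1) by (simp add: o_def)
    ultimately have "f i j \<le> 0"
      using tendsto_le[OF trivial_limit_sequentially _ fl[OF i j], of "\<lambda>m. c ^ \<sigma> m" 0] by auto
    with fp show False by simp
  qed
  have ex: "\<exists>i<n. p i > 0"
  proof (rule ccontr)
    assume "\<not> ?thesis"
    then have "(\<Sum>i<n. p i) \<le> 0" by (intro sum_nonpos) auto
    with ps show False by simp
  qed
  have "p i > 0" if "i < n" for i
    by (rule eqflow_positive[OF m f0 _ col ex tight that]) (auto simp: p_def)
  then have "eqflow n u f"
    using f0 col tight by (auto simp: eqflow_def p_def)
  then show thesis by (rule that)
qed

subsection \<open>Integral equilibria of bounded size\<close>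

text \<open>Slack of the tightness condition of \<open>eqflow\<close>: in spite of the name,
  nonnegative on the used edges of an equilibrium. It is linear in \<open>f\<close>, so along a line
  of flows every constraint varies affinely.\<close>

definition violation :: "nat \<Rightarrow> (nat \<Rightarrow> nat \<Rightarrow> nat) \<Rightarrow> (nat \<Rightarrow> nat \<Rightarrow> real) \<Rightarrow> nat \<Rightarrow> nat \<Rightarrow> nat \<Rightarrow> real" where
  "violation n u f i j k = real (u i j) * (\<Sum>l<n. f k l) - real (u i k) * (\<Sum>l<n. f j l)"

lemma violation_add_scaled:
  "violation n u (\<lambda>i j. f i j + t * g i j) i j k = violation n u f i j k + t * violation n u g i j k"
  by (simp add: violation_def sum.distrib sum_distrib_left[symmetric] algebra_simps)

lemma sum_zero_has_neg:
  fixes g :: "'a \<Rightarrow> real"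
  assumes "finite D" "(\<Sum>s\<in>D. g s) = 0" "\<exists>s\<in>D. g s \<noteq> 0"
  obtains s where "s \<in> D" "g s < 0"
  using assms sum_nonneg_eq_0_iff[OF assms(1), of g] not_less by blast

text \<open>Take an equilibrium with as many active constraints (zero flows, ties of bang per buck) as
  possible: moving along another solution of the active equations would activate one more.\<close>

lemma eqflow_rigid:
  assumes m: "exchange_market n u"
  obtains f where "eqflow n u f"
    "\<And>g :: nat \<Rightarrow> nat \<Rightarrow> real. (\<And>i j. i < n \<Longrightarrow> j < n \<Longrightarrow> f i j = 0 \<Longrightarrow> g i j = 0) \<Longrightarrow>
        (\<And>i. i < n \<Longrightarrow> (\<Sum>j<n. g j i) = (\<Sum>j<n. g i j)) \<Longrightarrow>
        (\<And>i j k. i < n \<Longrightarrow> j < n \<Longrightarrow> k < n \<Longrightarrow> f i j > 0 \<Longrightarrow> violation n u f i j k = 0 \<Longrightarrow> violation n u g i j k = 0) \<Longrightarrow>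
        \<exists>c. \<forall>i<n. \<forall>j<n. g i j = c * f i j"
proof -
  define D where "D = {..<n} \<times> {..<n}"
  define Z where "Z f = {(i, j) \<in> D. f i j = (0::real)}" for f
  define H where "H f = {(i, j, k) \<in> {..<n} \<times> D. f i j = 0 \<or> violation n u f i j k = 0}" for f
  have fin: "finite D" "finite (Z f)" "finite (H f)" for f
    by (auto simp: D_def Z_def H_def intro: finite_subset[of _ "{..<n} \<times> {..<n}"] finite_subset[of _ "{..<n} \<times> {..<n} \<times> {..<n}"])
  define act where "act f = card (Z f) + card (H f)" for f
  have "card (Z f) \<le> card D" for f
    by (rule card_mono) (use fin in \<open>auto simp: Z_def\<close>)
  moreover have "card (H f) \<le> card ({..<n} \<times> D)" for f
    by (rule card_mono) (use fin in \<open>auto simp: H_def\<close>)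
  ultimately have "act f < card D + card ({..<n} \<times> D) + 1" for f
    unfolding act_def by (metis add_mono less_Suc_eq_le Suc_eq_plus1)
  moreover obtain f0 where "eqflow n u f0" using eqflow_exists[OF m] .
  ultimately obtain f where f: "eqflow n u f" and max: "\<And>g. eqflow n u g \<Longrightarrow> act g \<le> act f"
    using ex_has_greatest_nat[of "eqflow n u" f0 act] by blast
  have f0: "0 \<le> f i j" if "i < n" "j < n" for i j using f that by (simp add: eqflow_def)
  have fp: "(\<Sum>j<n. f i j) > 0" if "i < n" for i using f that by (simp add: eqflow_def)
  have n: "0 < n" using m by (simp add: exchange_market_def)
  show thesis
  proof (rule that[OF f])
    fix g
    assume gz: "\<And>i j. i < n \<Longrightarrow> j < n \<Longrightarrow> f i j = 0 \<Longrightarrow> g i j = 0"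
      and gb: "\<And>i. i < n \<Longrightarrow> (\<Sum>j<n. g j i) = (\<Sum>j<n. g i j)"
      and gt: "\<And>i j k. i < n \<Longrightarrow> j < n \<Longrightarrow> k < n \<Longrightarrow> f i j > 0 \<Longrightarrow> violation n u f i j k = 0 \<Longrightarrow> violation n u g i j k = 0"
    define tot where "tot = (\<Sum>i<n. \<Sum>j<n. f i j)"
    have tot: "tot > 0" unfolding tot_def by (rule sum_pos) (use fp n in auto)
    \<comment> \<open>This \<open>c\<close> gives \<open>d\<close> total zero. A nonzero
      \<open>d\<close> then has a negative entry, so moving along it does hit a constraint, and the
      total money is preserved, so the new flow is not zero.\<close>
    define c where "c = (\<Sum>i<n. \<Sum>j<n. g i j) / tot"
    define d where "d i j = g i j + (- c) * f i j" for i j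
    show "\<exists>c. \<forall>i<n. \<forall>j<n. g i j = c * f i j"
    proof (rule ccontr)
      assume "\<not> ?thesis"
      then have "\<exists>i<n. \<exists>j<n. g i j \<noteq> c * f i j" by blast
      then obtain i0 j0 where "i0 < n" "j0 < n" "d i0 j0 \<noteq> 0" by (auto simp: d_def)
      then have dn0: "\<exists>s\<in>D. (case s of (i, j) \<Rightarrow> d i j) \<noteq> 0" by (auto simp: D_def intro!: bexI[of _ "(i0, j0)"])
      have "(\<Sum>i<n. \<Sum>j<n. d i j) = (\<Sum>i<n. \<Sum>j<n. g i j) + (- c) * tot"
        by (simp only: d_def sum.distrib sum_distrib_left[symmetric] tot_def)
      then have dsum: "(\<Sum>i<n. \<Sum>j<n. d i j) = 0" using tot by (simp add: c_def)
      then have "(\<Sum>s\<in>D. case s of (i, j) \<Rightarrow> d i j) = 0" by (simp add: D_def sum.cartesian_product)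
      from sum_zero_has_neg[OF fin(1) this dn0] obtain s where s: "s \<in> D" "(case s of (i, j) \<Rightarrow> d i j) < 0" .
      obtain i1 j1 where "s = (i1, j1)" by (cases s)
      with s have ij1: "i1 < n" "j1 < n" "d i1 j1 < 0" by (auto simp: D_def)
      define C where "C = (\<lambda>(i, j). (f i j, d i j)) ` D \<union>
        (\<lambda>(i, j, k). (violation n u f i j k, violation n u d i j k)) ` {(i, j, k) \<in> {..<n} \<times> D. f i j > 0}"
      have finC: "finite C" unfolding C_def
        by (intro finite_UnI finite_imageI) (auto simp: D_def intro: finite_subset[of _ "{..<n} \<times> {..<n} \<times> {..<n}"])
      have dz: "d i j = 0" if "i < n" "j < n" "f i j = 0" for i j using gz that by (simp add: d_def)
      have dt: "violation n u d i j k = 0" if "i < n" "j < n" "k < n" "f i j > 0" "violation n u f i j k = 0" for i j k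
        unfolding d_def violation_add_scaled using gt that by simp
      have db: "(\<Sum>j<n. d j i) = (\<Sum>j<n. d i j)" if "i < n" for i
        using gb[OF that] f that unfolding d_def
        by (simp add: sum.distrib sum_subtractf sum_distrib_left[symmetric] eqflow_def)
      have CA: "A \<ge> 0 \<and> (A = 0 \<longrightarrow> B = 0)" if "(A, B) \<in> C" for A B
      proof -
        from that consider i j where "i < n" "j < n" "A = f i j" "B = d i j"
          | i j k where "i < n" "j < n" "k < n" "f i j > 0" "A = violation n u f i j k" "B = violation n u d i j k"
          by (auto simp: C_def D_def)
        then show ?thesis
        proof cases
          case 1
          then show ?thesis using f0 dz by auto
        next
          case 2
          then have "A \<ge> 0" using f by (auto simp: eqflow_def violation_def)
          then show ?thesis using dt 2 by auto
        qed
      qed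
      \<comment> \<open>Ratio test: the largest step along \<open>d\<close> that keeps all
        constraints, each being a pair of current value and rate of change. It is positive because a
        constraint already at zero has rate zero, and some constraint becomes active at
        \<open>T\<close>.\<close>
      define T where "T = Min ((\<lambda>(A, B). A / (- B)) ` {(A, B) \<in> C. B < 0})"
      have finT: "finite ((\<lambda>(A, B). A / (- B)) ` {(A, B) \<in> C. B < 0})"
        using finC by (auto intro: finite_subset)
      have "(f i1 j1, d i1 j1) \<in> C" using ij1 by (auto simp: C_def D_def)
      then have ne: "(\<lambda>(A, B). A / (- B)) ` {(A, B) \<in> C. B < 0} \<noteq> {}" using ij1 by blast
      obtain A0 B0 where AB: "(A0, B0) \<in> C" "B0 < 0" "T = A0 / (- B0)"
        using Min_in[OF finT ne] unfolding T_def by auto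
      have A0: "A0 > 0" using CA[OF AB(1)] AB(2) by auto
      then have T0: "T > 0" unfolding AB(3) using AB(2) by (intro divide_pos_pos) auto
      have CT: "A + T * B \<ge> 0" if "(A, B) \<in> C" for A B
      proof (cases "B < 0")
        case True
        have "A / (- B) \<in> (\<lambda>(A, B). A / (- B)) ` {(A, B) \<in> C. B < 0}" using that True by force
        then have "T \<le> A / (- B)" unfolding T_def using finT by (rule Min_le[rotated])
        then show ?thesis using True by (simp add: field_simps)
      next
        case False
        then show ?thesis using CA[OF that] T0 by (simp add: add_nonneg_nonneg)
      qed
      define f' where "f' i j = f i j + T * d i j" for i j
      have f'0: "0 \<le> f' i j" if "i < n" "j < n" for i j
      proof -
        have "(f i j, d i j) \<in> C" using that by (force simp: C_def D_def)
        from CT[OF this] show ?thesis by (simp add: f'_def)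
      qed
      have f'b: "(\<Sum>j<n. f' j i) = (\<Sum>j<n. f' i j)" if "i < n" for i
        using db[OF that] f that by (simp add: f'_def sum.distrib sum_distrib_left[symmetric] eqflow_def)
      have f'z: "f i j > 0" if "f' i j > 0" "i < n" "j < n" for i j
        using that f0[OF that(2,3)] dz[OF that(2,3)] by (cases "f i j = 0") (auto simp: f'_def)
      have f't: "violation n u f' i j k \<ge> 0" if "f' i j > 0" "i < n" "j < n" "k < n" for i j k
      proof -
        have "(violation n u f i j k, violation n u d i j k) \<in> C" using f'z[OF that(1-3)] that
          by (force simp: C_def D_def)
        from CT[OF this] show ?thesis unfolding f'_def violation_add_scaled .
      qed
      have t': "real (u i k) * (\<Sum>l<n. f' j l) \<le> real (u i j) * (\<Sum>l<n. f' k l)"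
        if "i < n" "j < n" "k < n" "f' i j > 0" for i j k
        using f't[OF that(4,1-3)] by (simp add: violation_def)
      have ex': "\<exists>i<n. (\<Sum>j<n. f' i j) > 0"
      proof (rule ccontr)
        assume "\<not> ?thesis"
        then have "(\<Sum>j<n. f' i j) \<le> 0" if "i < n" for i using that by (meson not_less)
        then have "(\<Sum>i<n. \<Sum>j<n. f' i j) \<le> 0" by (metis lessThan_iff sum_nonpos)
        moreover have "(\<Sum>i<n. \<Sum>j<n. f' i j) = tot"
          using dsum by (simp add: f'_def sum.distrib sum_distrib_left[symmetric] tot_def)
        ultimately show False using tot by simp
      qed
      have "(\<Sum>l<n. f' i l) > 0" if "i < n" for i
        by (rule eqflow_positive[OF m f'0 refl f'b ex' t' that])
      then have f': "eqflow n u f'" using f'0 f'b t' by (simp add: eqflow_def)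
      have Zm: "Z f \<subseteq> Z f'" using dz by (auto simp: Z_def D_def f'_def)
      have Hm: "H f \<subseteq> H f'"
      proof
        fix s assume "s \<in> H f"
        then obtain i j k where s: "s = (i, j, k)" "i < n" "j < n" "k < n" "f i j = 0 \<or> violation n u f i j k = 0"
          by (auto simp: H_def D_def)
        show "s \<in> H f'"
        proof (cases "f i j = 0")
          case True
          then show ?thesis using s dz by (auto simp: H_def D_def f'_def)
        next
          case False
          then have "violation n u f i j k = 0" "violation n u d i j k = 0"
            using s dt[of i j k] f0[of i j] by (auto simp: less_le)
          then have "violation n u f' i j k = 0" unfolding f'_def violation_add_scaled by simp
          then show ?thesis using s by (auto simp: H_def D_def)
        qed
      qed
      have T1: "A0 + T * B0 = 0" using AB by simp
      from AB(1) consider i j where "i < n" "j < n" "A0 = f i j" "B0 = d i j"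
          | i j k where "i < n" "j < n" "k < n" "f i j > 0" "A0 = violation n u f i j k" "B0 = violation n u d i j k"
        by (auto simp: C_def D_def)
      then have "Z f \<noteq> Z f' \<or> H f \<noteq> H f'"
      proof cases
        case 1
        then have "(i, j) \<in> Z f'" "(i, j) \<notin> Z f" using T1 A0 by (auto simp: Z_def D_def f'_def)
        then show ?thesis by blast
      next
        case 2
        then have "violation n u f' i j k = 0" using T1 unfolding f'_def violation_add_scaled by simp
        then have "(i, j, k) \<in> H f'" "(i, j, k) \<notin> H f" using 2 A0 by (auto simp: H_def D_def)
        then show ?thesis by blast
      qed
      then have "act f < act f'"
        unfolding act_def using Zm Hm psubset_card_mono[OF fin(2), of "Z f" f'] psubset_card_mono[OF fin(3), of "H f" f']
          card_mono[OF fin(2) Zm] card_mono[OF fin(3) Hm] by force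
      with max[OF f'] show False by simp
    qed
  qed
qed

lemma sum_support_fst:
  fixes g :: "nat \<times> nat \<Rightarrow> real"
  assumes S: "S \<subseteq> {..<n} \<times> {..<n}" and "i < n"
  shows "(\<Sum>s\<in>S. (if fst s = i then c else 0) * g s) = c * (\<Sum>j<n. if (i, j) \<in> S then g (i, j) else 0)"
proof -
  have "(\<Sum>s\<in>S. (if fst s = i then c else 0) * g s)
      = (\<Sum>s\<in>{..<n} \<times> {..<n}. if fst s = i then c * (if s \<in> S then g s else 0) else 0)"
    using S by (intro sum.mono_neutral_cong_left) auto
  also have "\<dots> = (\<Sum>a<n. if a = i then \<Sum>j<n. c * (if (i, j) \<in> S then g (i, j) else 0) else 0)"
    unfolding sum.cartesian_product' by (intro sum.cong) auto
  also have "\<dots> = c * (\<Sum>j<n. if (i, j) \<in> S then g (i, j) else 0)"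
    using \<open>i < n\<close> by (simp add: sum_distrib_left)
  finally show ?thesis .
qed

lemma sum_support_snd:
  fixes g :: "nat \<times> nat \<Rightarrow> real"
  assumes S: "S \<subseteq> {..<n} \<times> {..<n}" and "i < n"
  shows "(\<Sum>s\<in>S. (if snd s = i then c else 0) * g s) = c * (\<Sum>j<n. if (j, i) \<in> S then g (j, i) else 0)"
proof -
  have "(\<Sum>s\<in>S. (if snd s = i then c else 0) * g s) = (\<Sum>s\<in>prod.swap ` S. (if fst s = i then c else 0) * g (prod.swap s))"
    by (subst sum.reindex) (auto intro: inj_onI)
  also have "\<dots> = c * (\<Sum>j<n. if (i, j) \<in> prod.swap ` S then g (prod.swap (i, j)) else 0)"
    using S \<open>i < n\<close> by (intro sum_support_fst) auto
  also have "(\<lambda>j. (i, j) \<in> prod.swap ` S) = (\<lambda>j. (j, i) \<in> S)" by force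
  finally show ?thesis by (simp cong: if_cong)
qed

text \<open>On its support the rigid flow is the only solution, up to a factor, of an integral
  system (balance of each agent, ties between goods), so Siegel's lemma applies. The exponent
  \<open>2 * n\<close> bounds the size of the support.\<close>

lemma eqflow_integral:
  assumes m: "exchange_market n u" and U: "\<And>i j. i < n \<Longrightarrow> j < n \<Longrightarrow> u i j \<le> U"
  obtains F :: "nat \<Rightarrow> nat \<Rightarrow> nat" where "eqflow n u (\<lambda>i j. real (F i j))"
    "\<And>i j. i < n \<Longrightarrow> j < n \<Longrightarrow> F i j \<le> (4 * n * U) ^ (2 * n)"
proof (rule eqflow_rigid[OF m])
  fix f
  assume f: "eqflow n u f" and rigid:
    "\<And>g :: nat \<Rightarrow> nat \<Rightarrow> real. (\<And>i j. i < n \<Longrightarrow> j < n \<Longrightarrow> f i j = 0 \<Longrightarrow> g i j = 0) \<Longrightarrow>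
        (\<And>i. i < n \<Longrightarrow> (\<Sum>j<n. g j i) = (\<Sum>j<n. g i j)) \<Longrightarrow>
        (\<And>i j k. i < n \<Longrightarrow> j < n \<Longrightarrow> k < n \<Longrightarrow> f i j > 0 \<Longrightarrow> violation n u f i j k = 0 \<Longrightarrow> violation n u g i j k = 0) \<Longrightarrow>
        \<exists>c. \<forall>i<n. \<forall>j<n. g i j = c * f i j"
  have n: "n > 0" using m by (simp add: exchange_market_def)
  have "\<exists>j<n. u 0 j > 0" using m n by (simp add: exchange_market_def)
  then have U1: "U \<ge> 1" using U[of 0] n by fastforce
  have f0: "0 \<le> f i j" if "i < n" "j < n" for i j using f that by (simp add: eqflow_def)
  have fp: "(\<Sum>j<n. f i j) > 0" if "i < n" for i using f that by (simp add: eqflow_def)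
  define S where "S = {(i, j) \<in> {..<n} \<times> {..<n}. f i j > 0}"
  have SD: "S \<subseteq> {..<n} \<times> {..<n}" by (auto simp: S_def)
  have finS: "finite S" using SD by (rule finite_subset) auto
  define ext where "ext g i j = (if (i, j) \<in> S then g (i, j) else (0::real))" for g :: "nat \<times> nat \<Rightarrow> real" and i j
  \<comment> \<open>\<open>Inl i\<close> is the balance of agent \<open>i\<close>, and
    \<open>Inr (i, j, k)\<close> the tie of goods \<open>j\<close> and \<open>k\<close> for agent
    \<open>i\<close>; prices being row sums, the utilities are the coefficients.\<close>
  define A where "A r s = (case r of Inl i \<Rightarrow> (if fst s = i then 1 else 0) - (if snd s = i then 1 else 0)
      | Inr (i, j, k) \<Rightarrow> (if fst s = k then int (u i j) else 0) - (if fst s = j then int (u i k) else 0))"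
    for r :: "nat + nat \<times> nat \<times> nat" and s :: "nat \<times> nat"
  have Al: "(\<Sum>s\<in>S. of_int (A (Inl i) s) * g s) = (\<Sum>j<n. ext g i j) - (\<Sum>j<n. ext g j i)" if "i < n" for i g
    using sum_support_fst[OF SD that, of 1 g] sum_support_snd[OF SD that, of 1 g]
    by (simp add: A_def ext_def left_diff_distrib sum_subtractf) (simp add: if_distrib cong: if_cong)
  have Ar: "(\<Sum>s\<in>S. of_int (A (Inr (i, j, k)) s) * g s) = violation n u (ext g) i j k"
    if "i < n" "j < n" "k < n" for i j k g
  proof -
    have "(\<Sum>s\<in>S. of_int (A (Inr (i, j, k)) s) * g s) =
        (\<Sum>s\<in>S. (if fst s = k then real (u i j) else 0) * g s) - (\<Sum>s\<in>S. (if fst s = j then real (u i k) else 0) * g s)"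
      unfolding sum_subtractf[symmetric] by (intro sum.cong) (auto simp: A_def left_diff_distrib)
    then show ?thesis unfolding sum_support_fst[OF SD that(3)] sum_support_fst[OF SD that(2)]
      by (simp add: violation_def ext_def)
  qed
  have rigidS: "\<exists>c. \<forall>s\<in>S. g s = c * (case s of (i, j) \<Rightarrow> f i j)"
    if b: "\<And>i. i < n \<Longrightarrow> (\<Sum>j<n. ext g j i) = (\<Sum>j<n. ext g i j)"
      and t: "\<And>i j k. i < n \<Longrightarrow> j < n \<Longrightarrow> k < n \<Longrightarrow> f i j > 0 \<Longrightarrow> violation n u f i j k = 0 \<Longrightarrow> violation n u (ext g) i j k = 0" for g
  proof -
    have "\<exists>c. \<forall>i<n. \<forall>j<n. ext g i j = c * f i j"
      by (rule rigid[OF _ b t]) (auto simp: ext_def S_def)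
    then obtain c where c: "\<forall>i<n. \<forall>j<n. ext g i j = c * f i j" ..
    have "g (i, j) = c * f i j" if "(i, j) \<in> S" for i j
      using c[rule_format, of i j] that by (auto simp: ext_def S_def)
    then have "\<forall>s\<in>S. g s = c * (case s of (i, j) \<Rightarrow> f i j)" by auto
    then show ?thesis ..
  qed
  have extf: "ext (\<lambda>(i, j). f i j) i j = f i j" if "i < n" "j < n" for i j
    using f0[OF that] that by (auto simp: ext_def S_def)
  have "\<exists>j<n. f 0 j > 0" using fp[OF n] sum_nonpos[of "{..<n}" "f 0"] by force
  then have Sne: "S \<noteq> {}" using n by (auto simp: S_def)
  \<comment> \<open>More than \<open>2 * n\<close> edges would carry a nonzero \<open>x\<close> with
    all row and column sums zero. It changes no price, hence respects all ties, so rigidity makes it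
    a multiple of \<open>f\<close>; its zero row sums then force the factor 0.\<close>
  have card: "card S \<le> 2 * n"
  proof (rule ccontr)
    assume "\<not> ?thesis"
    then have *: "card (Inl ` {..<n} \<union> Inr ` {..<n} :: (nat + nat) set) < card S"
      by (subst card_Un_disjoint) (auto simp: card_image)
    define B where "B r s = (case r of Inl i \<Rightarrow> if fst s = i then 1 else 0 | Inr i \<Rightarrow> if snd s = i then 1 else (0::real))"
      for r :: "nat + nat" and s :: "nat \<times> nat"
    have "finite (Inl ` {..<n} \<union> Inr ` {..<n} :: (nat + nat) set)" by simp
    note homog_nontrivial[OF this finS *, of B]
    then obtain x where x: "\<exists>s\<in>S. x s \<noteq> 0" and x': "\<forall>r\<in>Inl ` {..<n} \<union> Inr ` {..<n}. (\<Sum>s\<in>S. B r s * x s) = 0"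
      by (elim exE conjE)
    have x2: "(\<Sum>s\<in>S. (if fst s = i then 1 else 0) * x s) = 0" if "i < n" for i
      using x'[rule_format, of "Inl i"] that by (simp add: B_def)
    have x3: "(\<Sum>s\<in>S. (if snd s = i then 1 else 0) * x s) = 0" if "i < n" for i
      using x'[rule_format, of "Inr i"] that by (simp add: B_def)
    have r: "(\<Sum>j<n. ext x i j) = 0" if "i < n" for i
      using x2[OF that] sum_support_fst[OF SD that, of 1 x] by (simp add: ext_def)
    have s: "(\<Sum>j<n. ext x j i) = 0" if "i < n" for i
      using x3[OF that] sum_support_snd[OF SD that, of 1 x] by (simp add: ext_def)
    have "\<exists>c. \<forall>s\<in>S. x s = c * (case s of (i, j) \<Rightarrow> f i j)"
      by (rule rigidS) (use r s in \<open>auto simp: violation_def\<close>)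
    then obtain c where "\<forall>s\<in>S. x s = c * (case s of (i, j) \<Rightarrow> f i j)" ..
    then have c: "x (i, j) = c * f i j" if "(i, j) \<in> S" for i j using that by fastforce
    have "ext x 0 j = c * f 0 j" if "j < n" for j
      using c[of 0 j] f0[of 0 j] n that by (auto simp: ext_def S_def)
    then have "(\<Sum>j<n. ext x 0 j) = c * (\<Sum>j<n. f 0 j)" by (simp add: sum_distrib_left)
    then have "c = 0" using r[OF n] fp[OF n] by simp
    with c x show False by auto
  qed
  define R where "R = Inl ` {..<n} \<union> Inr ` {(i, j, k) \<in> {..<n} \<times> {..<n} \<times> {..<n}. f i j > 0 \<and> violation n u f i j k = 0}"
  have finR: "finite R" unfolding R_def
    by (intro finite_UnI finite_imageI) (auto intro: finite_subset[of _ "{..<n} \<times> {..<n} \<times> {..<n}"])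
  have vext: "violation n u (ext (\<lambda>(i, j). f i j)) i j k = violation n u f i j k" if "j < n" "k < n" for i j k
    using that by (simp add: violation_def extf)
  obtain g c where g: "c > 0" "\<And>s. s \<in> S \<Longrightarrow> real (g s) = c * (case s of (i, j) \<Rightarrow> f i j)"
    "\<And>s. s \<in> S \<Longrightarrow> 1 \<le> g s \<and> g s \<le> (2 * U * card S) ^ card S"
  proof (rule siegel_positive[OF finR finS Sne, of A U "\<lambda>(i, j). f i j"])
    fix r s assume r: "r \<in> R" and s: "s \<in> S"
    have d: "\<bar>(if P then int a else 0) - (if Q then int b else 0)\<bar> \<le> int U" if "a \<le> U" "b \<le> U" for P Q a b
      using that by auto
    from r show "\<bar>A r s\<bar> \<le> int U"
      unfolding R_def A_def using d[of 1 1] U1 U d by auto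
  next
    show "0 < (case s of (i, j) \<Rightarrow> f i j)" if "s \<in> S" for s using that by (auto simp: S_def)
  next
    fix r assume "r \<in> R"
    then show "(\<Sum>s\<in>S. of_int (A r s) * (case s of (i, j) \<Rightarrow> f i j)) = 0"
      using f by (auto simp: R_def Al Ar extf vext eqflow_def)
  next
    fix g :: "nat \<times> nat \<Rightarrow> real" assume *: "\<And>r. r \<in> R \<Longrightarrow> (\<Sum>s\<in>S. of_int (A r s) * g s) = 0"
    show "\<exists>c. \<forall>s\<in>S. g s = c * (case s of (i, j) \<Rightarrow> f i j)"
    proof (rule rigidS)
      show "(\<Sum>j<n. ext g j i) = (\<Sum>j<n. ext g i j)" if "i < n" for i
        using *[of "Inl i"] that by (simp add: R_def Al)
      show "violation n u (ext g) i j k = 0" if "i < n" "j < n" "k < n" "f i j > 0" "violation n u f i j k = 0" for i j k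
        using *[of "Inr (i, j, k)"] that by (simp add: R_def Ar image_iff)
    qed
  qed (use U1 in auto)
  define F where "F i j = (if (i, j) \<in> S then g (i, j) else 0)" for i j
  have F: "real (F i j) = c * f i j" if "i < n" "j < n" for i j
    using g(2)[of "(i, j)"] f0[OF that] that by (auto simp: F_def S_def)
  show thesis
  proof (rule that)
    have "(\<Sum>j<n. real (F i j)) = c * (\<Sum>j<n. f i j)" if "i < n" for i using that by (simp add: F sum_distrib_left)
    moreover have "(\<Sum>j<n. real (F j i)) = c * (\<Sum>j<n. f j i)" if "i < n" for i using that by (simp add: F sum_distrib_left)
    ultimately show "eqflow n u (\<lambda>i j. real (F i j))"
      using f g(1) by (simp add: eqflow_def F zero_less_mult_iff mult.left_commute[of _ c])
    fix i j assume "i < n" "j < n"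
    have "F i j \<le> (2 * U * card S) ^ card S" using g(3) by (simp add: F_def)
    also have "\<dots> \<le> (4 * n * U) ^ card S" using card by (intro power_mono) auto
    also have "\<dots> \<le> (4 * n * U) ^ (2 * n)" using card n U1 by (intro power_increasing) auto
    finally show "F i j \<le> (4 * n * U) ^ (2 * n)" .
  qed
qed

subsection \<open>Near equilibria and rounding\<close>

text \<open>With \<open>x = ln r\<close> the hypothesis reads \<open>exp x - 1 - x <= e\<close>, and
  near 0 the left side is at least a multiple of \<open>x^2\<close>: by the quadratic Taylor bound
  for \<open>x >= 0\<close>, by the cubic one for \<open>-1 <= x < 0\<close>. For
  \<open>x < -1\<close> it is at least \<open>1 / 4\<close>, which \<open>e <= 1 / 16\<close>
  forbids.\<close>

lemma ln_le_minus_one_sq: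
  fixes r e :: real
  assumes r: "r > 0" and e: "0 \<le> e" "e \<le> 1 / 16" and h: "r - 1 - ln r \<le> e"
  shows "\<bar>ln r\<bar> \<le> 4 * sqrt e"
proof -
  define x where "x = ln r"
  have ex: "exp x = r" using r by (simp add: x_def)
  have h': "exp x - 1 - x \<le> e" using h ex by (simp add: x_def)
  have main: "x\<^sup>2 \<le> 16 * e"
  proof (cases "x \<ge> 0")
    case True
    have "exp x \<ge> 1 + x + x\<^sup>2 / 2" using True by (rule exp_lower_Taylor_quadratic)
    then show ?thesis using h' e by (simp add: power2_eq_square)
  next
    case False
    define y where "y = - x"
    have y: "y > 0" using False by (simp add: y_def)
    have "exp (- y) \<ge> 1 - y + y\<^sup>2 / 2 - y ^ 3 / 6" if "y \<le> 1"
    proof -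
      have "exp y * (1 - y + y\<^sup>2 / 2 - y ^ 3 / 6) \<le> 1"
      proof -
        define g where "g = (\<lambda>t::real. exp t * (1 - t + t\<^sup>2 / 2 - t ^ 3 / 6))"
        have "g y \<le> g 0"
        proof (rule DERIV_nonpos_imp_nonincreasing[of 0 y g])
          fix t :: real assume "0 \<le> t" "t \<le> y"
          have "(g has_real_derivative (exp t * (1 - t + t\<^sup>2 / 2 - t ^ 3 / 6) + exp t * (- 1 + t - t\<^sup>2 / 2))) (at t)"
            unfolding g_def by (auto intro!: derivative_eq_intros simp: power2_eq_square field_simps)
          moreover have "exp t * (1 - t + t\<^sup>2 / 2 - t ^ 3 / 6) + exp t * (- 1 + t - t\<^sup>2 / 2) = - exp t * t ^ 3 / 6"
            by (simp add: algebra_simps)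
          ultimately show "\<exists>d. DERIV g t :> d \<and> d \<le> 0" using \<open>0 \<le> t\<close> by (intro exI[of _ "- exp t * t ^ 3 / 6"]) auto
        qed (use y in auto)
        then show ?thesis by (simp add: g_def)
      qed
      then show ?thesis by (simp add: exp_minus field_simps)
    qed
    moreover have "y ^ 3 \<le> y\<^sup>2" if "y \<le> 1" using that y by (intro power_decreasing) auto
    ultimately have *: "y \<le> 1 \<Longrightarrow> y\<^sup>2 / 3 \<le> e" using h' by (auto simp: y_def)
    have "y \<le> 1"
    proof (rule ccontr)
      assume "\<not> y \<le> 1"
      then have "1 / 4 \<le> y - 1 + exp (- y)"
      proof -
        have d: "(\<lambda>t::real. t - 1 + exp (- t)) 1 \<le> (\<lambda>t. t - 1 + exp (- t)) y"
        proof (rule DERIV_nonneg_imp_nondecreasing[of 1 y "\<lambda>t. t - 1 + exp (- t)"])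
          fix t :: real assume "1 \<le> t"
          show "\<exists>d. ((\<lambda>t. t - 1 + exp (- t)) has_real_derivative d) (at t) \<and> 0 \<le> d"
            using \<open>1 \<le> t\<close> by (intro exI[of _ "1 - exp (- t)"]) (auto intro!: derivative_eq_intros)
        qed (use \<open>\<not> y \<le> 1\<close> in auto)
        have "exp (1::real) \<le> 3" by (rule exp_le)
        then have "exp (- 1::real) \<ge> 1 / 3" by (simp add: exp_minus field_simps)
        then show ?thesis using d by simp
      qed
      then show False using h' e by (simp add: y_def)
    qed
    then show ?thesis using * e by (simp add: y_def)
  qed
  have "\<bar>x\<bar> = sqrt (x\<^sup>2)" by simp
  also have "\<dots> \<le> sqrt (16 * e)" using main by (rule real_sqrt_le_mono)
  also have "\<dots> = 4 * sqrt e" by (simp add: real_sqrt_mult)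
  finally show ?thesis by (simp add: x_def)
qed

text \<open>With \<open>r i\<close> the ratio of the utilities of agent \<open>i\<close> at the prices \<open>q\<close> and \<open>p\<close>, the excess value
  of the demand at \<open>q\<close> is at least the sum of \<open>F i j * (r i - 1)\<close>, and the logarithms
  \<open>s i - s j\<close> cancel along the circulation \<open>F\<close>.\<close>

lemma demand_excess:
  fixes F :: "nat \<Rightarrow> nat \<Rightarrow> nat" and q :: "nat \<Rightarrow> real"
  assumes f: "eqflow n u (\<lambda>i j. real (F i j))" and p: "\<And>i. p i = (\<Sum>j<n. real (F i j))"
    and q: "\<And>i. i < n \<Longrightarrow> q i > 0"
    and b: "\<And>i. i < n \<Longrightarrow> b i < n" "\<And>i j. i < n \<Longrightarrow> j < n \<Longrightarrow> real (u i j) * q (b i) \<le> real (u i (b i)) * q j"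
    and m: "exchange_market n u"
    and r: "\<And>i. r i = q i * p (b i) / (q (b i) * p i)" and s: "\<And>i. s i = ln (q i / p i)"
    and g: "\<And>i j. g i j = ln (real (u i (b i)) * q j) - ln (real (u i j) * q (b i))"
  shows "(\<Sum>i<n. q i * p (b i) / q (b i)) - (\<Sum>i<n. p i) = (\<Sum>i<n. \<Sum>j<n. real (F i j) * (r i - 1 - (s i - s j)))"
    and "\<And>i. i < n \<Longrightarrow> r i > 0" "\<And>i. i < n \<Longrightarrow> ln (r i) \<le> r i - 1"
    and "\<And>i j. i < n \<Longrightarrow> j < n \<Longrightarrow> F i j > 0 \<Longrightarrow> u i j > 0 \<and> 0 \<le> g i j \<and> s i - s j + g i j \<le> ln (r i)"
    and "\<And>i j. i < n \<Longrightarrow> j < n \<Longrightarrow> 0 \<le> real (F i j) * (r i - 1 - (s i - s j))"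
proof -
  have pp: "p i > 0" if "i < n" for i using f that by (simp add: eqflow_def p)
  have col: "(\<Sum>i<n. real (F i j)) = p j" if "j < n" for j using f that by (simp add: eqflow_def p)
  have tight: "real (u i k) * p j \<le> real (u i j) * p k" if "i < n" "j < n" "k < n" "F i j > 0" for i j k
    using f that by (simp add: eqflow_def p)
  have upos: "u i j > 0" if "i < n" "j < n" "F i j > 0" for i j
  proof -
    have "\<exists>k<n. u i k > 0" using m that by (simp add: exchange_market_def)
    then obtain k where k: "k < n" "u i k > 0" by blast
    have "0 < real (u i k) * p j" using k pp that by simp
    also have "\<dots> \<le> real (u i j) * p k" using tight that k by simp
    finally show ?thesis by (simp add: zero_less_mult_iff)
  qed
  have ubpos: "u i (b i) > 0" if "i < n" for i
  proof -
    have "\<exists>k<n. u i k > 0" using m that by (simp add: exchange_market_def)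
    then obtain k where k: "k < n" "u i k > 0" by blast
    have "0 < real (u i k) * q (b i)" using k q b that by simp
    also have "\<dots> \<le> real (u i (b i)) * q k" using b that k by simp
    finally show ?thesis by (simp add: zero_less_mult_iff)
  qed
  show rpos: "r i > 0" if "i < n" for i using q pp b that by (simp add: r)
  show lnr: "ln (r i) \<le> r i - 1" if "i < n" for i using ln_le_minus_one[OF rpos[OF that]] .
  have gpos: "0 \<le> g i j" if "i < n" "j < n" "F i j > 0" for i j
    unfolding g using b that q upos ubpos by (simp add: ln_le_cancel_iff)
  have main: "s i - s j + g i j \<le> ln (r i)" if "i < n" "j < n" "F i j > 0" for i j
  proof -
    have pos: "q i > 0" "q j > 0" "q (b i) > 0" "p i > 0" "p j > 0" "p (b i) > 0"
      "real (u i j) > 0" "real (u i (b i)) > 0"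
      using that b q pp upos ubpos by auto
    have "ln (real (u i (b i)) * p j) \<le> ln (real (u i j) * p (b i))"
      using tight[of i j "b i"] that b pos by (subst ln_le_cancel_iff) auto
    then show ?thesis
      using pos by (simp add: s g r ln_mult ln_div)
  qed
  show "\<And>i j. i < n \<Longrightarrow> j < n \<Longrightarrow> F i j > 0 \<Longrightarrow> u i j > 0 \<and> 0 \<le> g i j \<and> s i - s j + g i j \<le> ln (r i)"
    using upos gpos main by blast
  show "0 \<le> real (F i j) * (r i - 1 - (s i - s j))" if "i < n" "j < n" for i j
    using lnr[OF that(1)] main[OF that] gpos[OF that] by (cases "F i j > 0") auto
  have "(\<Sum>i<n. \<Sum>j<n. real (F i j) * (r i - 1 - (s i - s j))) = (\<Sum>i<n. \<Sum>j<n. real (F i j) * (r i - 1))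
     - (\<Sum>i<n. \<Sum>j<n. real (F i j) * s i) + (\<Sum>i<n. \<Sum>j<n. real (F i j) * s j)"
    by (simp add: algebra_simps sum.distrib sum_subtractf)
  also have "(\<Sum>i<n. \<Sum>j<n. real (F i j) * s j) = (\<Sum>i<n. \<Sum>j<n. real (F i j) * s i)"
  proof -
    have "(\<Sum>i<n. \<Sum>j<n. real (F i j) * s j) = (\<Sum>j<n. p j * s j)"
      by (subst sum.swap) (simp add: sum_distrib_right[symmetric] col)
    then show ?thesis by (simp add: sum_distrib_right[symmetric] p)
  qed
  also have "(\<Sum>i<n. \<Sum>j<n. real (F i j) * (r i - 1)) = (\<Sum>i<n. p i * (r i - 1))"
    by (simp add: sum_distrib_right[symmetric] p)
  also have "\<dots> = (\<Sum>i<n. q i * p (b i) / q (b i)) - (\<Sum>i<n. p i)"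
    unfolding sum_subtractf[symmetric] using pp by (intro sum.cong) (auto simp: r field_simps less_imp_neq[symmetric])
  finally show "(\<Sum>i<n. q i * p (b i) / q (b i)) - (\<Sum>i<n. p i) = (\<Sum>i<n. \<Sum>j<n. real (F i j) * (r i - 1 - (s i - s j)))"
    by simp
qed

text \<open>Validity of the demand cuts: whatever best goods are chosen at \<open>q\<close>, the
  half-space of the cut contains the prices of the flow \<open>F\<close>.\<close>

lemma demand_excess_nonneg:
  fixes F :: "nat \<Rightarrow> nat \<Rightarrow> nat" and q :: "nat \<Rightarrow> real"
  assumes f: "eqflow n u (\<lambda>i j. real (F i j))" and p: "\<And>i. p i = (\<Sum>j<n. real (F i j))"
    and q: "\<And>i. i < n \<Longrightarrow> q i > 0"
    and b: "\<And>i. i < n \<Longrightarrow> b i < n" "\<And>i j. i < n \<Longrightarrow> j < n \<Longrightarrow> real (u i j) * q (b i) \<le> real (u i (b i)) * q j"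
    and m: "exchange_market n u"
  shows "(\<Sum>i<n. p i) \<le> (\<Sum>i<n. q i * p (b i) / q (b i))"
proof -
  note D = demand_excess[OF f p q b m refl refl refl]
  have "0 \<le> (\<Sum>i<n. q i * p (b i) / q (b i)) - (\<Sum>i<n. p i)"
    by (subst D(1); assumption?) (auto intro!: sum_nonneg D(5))
  then show ?thesis by simp
qed

text \<open>All terms of \<open>demand_excess\<close> are nonnegative, so each is at most
  \<open>e\<close>; since a positive \<open>F i j\<close> is at least 1, the same holds for
  \<open>r i - 1 - (s i - s j)\<close>. This splits into the nonnegative parts
  \<open>r i - 1 - ln (r i)\<close>, which makes \<open>ln (r i)\<close> of order
  \<open>sqrt e\<close>, and \<open>ln (r i) - (s i - s j)\<close>, which dominates the loss
  \<open>g i j\<close>.\<close>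

lemma near_equilibrium:
  fixes F :: "nat \<Rightarrow> nat \<Rightarrow> nat" and q :: "nat \<Rightarrow> real"
  assumes f: "eqflow n u (\<lambda>i j. real (F i j))" and p: "\<And>i. p i = (\<Sum>j<n. real (F i j))"
    and q: "\<And>i. i < n \<Longrightarrow> q i > 0"
    and b: "\<And>i. i < n \<Longrightarrow> b i < n" "\<And>i j. i < n \<Longrightarrow> j < n \<Longrightarrow> real (u i j) * q (b i) \<le> real (u i (b i)) * q j"
    and m: "exchange_market n u"
    and e: "(\<Sum>i<n. q i * p (b i) / q (b i)) \<le> (\<Sum>i<n. p i) + e" "0 \<le> e" "e \<le> 1 / 16"
    and ij: "i < n" "j < n" "F i j > 0"
  shows "\<bar>ln (q i / p i) - ln (q j / p j)\<bar> \<le> 5 * sqrt e"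
    and "ln (real (u i (b i)) * q j) - ln (real (u i j) * q (b i)) \<le> 5 * sqrt e"
    and "u i j > 0"
proof -
  define r where "r i = q i * p (b i) / (q (b i) * p i)" for i
  define s where "s i = ln (q i / p i)" for i
  define g where "g i j = ln (real (u i (b i)) * q j) - ln (real (u i j) * q (b i))" for i j
  define G where "G i j = real (F i j) * (r i - 1 - (s i - s j))" for i j
  have D: "(\<Sum>i<n. q i * p (b i) / q (b i)) - (\<Sum>i<n. p i) = (\<Sum>i<n. \<Sum>j<n. G i j)"
    "\<And>i. i < n \<Longrightarrow> r i > 0" "\<And>i. i < n \<Longrightarrow> ln (r i) \<le> r i - 1"
    "\<And>i j. i < n \<Longrightarrow> j < n \<Longrightarrow> F i j > 0 \<Longrightarrow> u i j > 0 \<and> 0 \<le> g i j \<and> s i - s j + g i j \<le> ln (r i)"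
    "\<And>i j. i < n \<Longrightarrow> j < n \<Longrightarrow> 0 \<le> G i j"
    unfolding G_def by (rule demand_excess[OF f p q b m r_def s_def g_def]; assumption)+
  note main = D(4)[OF ij]
  show "u i j > 0" using main by simp
  have tot: "(\<Sum>i<n. \<Sum>j<n. G i j) \<le> e" using e(1) D(1) by simp
  have "G i j \<le> (\<Sum>j<n. G i j)" using ij D(5) by (intro member_le_sum) auto
  also have "\<dots> \<le> (\<Sum>i<n. \<Sum>j<n. G i j)"
    using ij D(5) by (intro member_le_sum[of i _ "\<lambda>i. \<Sum>j<n. G i j"]) (auto intro: sum_nonneg)
  finally have Ge: "G i j \<le> e" using tot by simp
  have X0: "0 \<le> r i - 1 - (s i - s j)" using D(3)[OF ij(1)] main by linarith
  have "r i - 1 - (s i - s j) \<le> G i j"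
    unfolding G_def using mult_right_mono[OF _ X0, of 1 "real (F i j)"] ij(3) by simp
  then have X: "r i - 1 - (s i - s j) \<le> e" using Ge by simp
  have lr: "r i - 1 - ln (r i) \<le> e" "ln (r i) - (s i - s j) \<le> e" "0 \<le> ln (r i) - (s i - s j)"
    using X main D(3)[OF ij(1)] by linarith+
  have absr: "\<bar>ln (r i)\<bar> \<le> 4 * sqrt e" by (rule ln_le_minus_one_sq[OF D(2)[OF ij(1)] e(2,3) lr(1)])
  have "e = sqrt e * sqrt e" using e(2) by simp
  also have "\<dots> \<le> sqrt e * 1" using e by (intro mult_left_mono) (auto simp: real_le_lsqrt)
  finally have es: "e \<le> sqrt e" by simp
  show "\<bar>ln (q i / p i) - ln (q j / p j)\<bar> \<le> 5 * sqrt e"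
    using absr lr es by (simp add: s_def abs_le_iff)
  have "g i j \<le> e" using lr main by simp
  moreover have "0 \<le> sqrt e" using e(2) by simp
  ultimately show "ln (real (u i (b i)) * q j) - ln (real (u i j) * q (b i)) \<le> 5 * sqrt e"
    using es unfolding g_def by linarith
qed

text \<open>From \<open>ln (a / b) <= a / b - 1 <= - 1 / M\<close> for
  \<open>a < b <= M\<close>.\<close>

lemma ln_nat_gap:
  fixes X Y M :: nat
  assumes "0 < X" "0 < Y" "X \<le> M" "Y \<le> M" "\<bar>ln (real X) - ln (real Y)\<bar> < 1 / real M"
  shows "X = Y"
proof -
  have gap: "1 / real M \<le> ln (real b) - ln (real a)" if "0 < a" "a < b" "b \<le> M" for a b :: nat
  proof -
    have "1 / real M \<le> 1 / real b" using that by (intro divide_left_mono) auto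
    also have "\<dots> \<le> (real b - real a) / real b" using that by (intro divide_right_mono) linarith+
    also have "\<dots> = 1 - real a / real b" using that by (simp add: diff_divide_distrib)
    also have "\<dots> \<le> - ln (real a / real b)" using ln_le_minus_one[of "real a / real b"] that by simp
    also have "\<dots> = ln (real b) - ln (real a)" using that by (simp add: ln_div)
    finally show ?thesis .
  qed
  show ?thesis
    using gap[of X Y] gap[of Y X] assms by (cases X Y rule: linorder_cases) auto
qed

text \<open>Ratios of numbers of bounded size that hold approximately along a graph are consistent
  around its cycles, so they can be satisfied exactly by a small change of the prices.\<close>

lemma consistent_rounding:
  fixes C :: "(nat \<times> nat \<times> nat \<times> nat) set" and q :: "nat \<Rightarrow> real" and D :: nat
  assumes sym: "\<And>k j a b. (k, j, a, b) \<in> C \<Longrightarrow> (j, k, b, a) \<in> C"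
    and C: "\<And>k j a b. (k, j, a, b) \<in> C \<Longrightarrow> k < n \<and> j < n \<and> 1 \<le> a \<and> a \<le> D \<and> 1 \<le> b \<and> b \<le> D"
    and near: "\<And>k j a b. (k, j, a, b) \<in> C \<Longrightarrow> \<bar>ln (q k) - ln (q j) - (ln (real a) - ln (real b))\<bar> \<le> d"
    and q: "\<And>k. k < n \<Longrightarrow> q k > 0" and d: "0 \<le> d" and D: "1 \<le> D"
    and small: "real (2 * n\<^sup>2 + 1) * d * real D ^ (2 * n\<^sup>2 + 1) < 1"
  obtains p where "\<And>k. k < n \<Longrightarrow> p k > 0" "\<And>k. k < n \<Longrightarrow> \<bar>ln (p k) - ln (q k)\<bar> \<le> real (n\<^sup>2) * d"
    "\<And>k j a b. (k, j, a, b) \<in> C \<Longrightarrow> real b * p k = real a * p j"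
proof -
  define Rel where "Rel = {(k, j). \<exists>a b. (k, j, a, b) \<in> C}"
  have RelD: "Rel \<subseteq> {..<n} \<times> {..<n}" using C by (auto simp: Rel_def)
  have finR: "finite Rel" by (rule finite_subset[OF RelD]) auto
  have cardR: "card Rel \<le> n\<^sup>2" using card_mono[OF _ RelD] by (simp add: power2_eq_square)
  have symR: "sym (Rel\<^sup>*)" by (intro sym_rtrancl symI) (auto simp: Rel_def dest: sym)
  \<comment> \<open>Ratios multiply and errors add along a walk: length \<open>m\<close> gives
    numerator and denominator at most \<open>D ^ m\<close> and error at most
    \<open>m * d\<close>.\<close>
  have walk: "\<exists>A B :: nat. 1 \<le> A \<and> A \<le> D ^ m \<and> 1 \<le> B \<and> B \<le> D ^ m \<and>
      \<bar>ln (q k) - ln (q r) - (ln (real A) - ln (real B))\<bar> \<le> real m * d" if "(k, r) \<in> Rel ^^ m" for m k r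
    using that
  proof (induction m arbitrary: r)
    case 0
    then show ?case by (intro exI[of _ 1]) auto
  next
    case (Suc m)
    from Suc.prems obtain j where j: "(k, j) \<in> Rel ^^ m" "(j, r) \<in> Rel" by auto
    obtain A B where AB: "1 \<le> A" "A \<le> D ^ m" "1 \<le> B" "B \<le> D ^ m"
      "\<bar>ln (q k) - ln (q j) - (ln (real A) - ln (real B))\<bar> \<le> real m * d" using Suc.IH[OF j(1)] by blast
    obtain a b where ab: "(j, r, a, b) \<in> C" using j(2) by (auto simp: Rel_def)
    note c = C[OF ab] near[OF ab]
    have "\<bar>ln (q k) - ln (q r) - (ln (real (A * a)) - ln (real (B * b)))\<bar> \<le> real (Suc m) * d"
      using AB c by (simp add: ln_mult distrib_right)
    moreover have "A * a \<le> D ^ Suc m" "B * b \<le> D ^ Suc m"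
      using AB c by (auto simp: mult.commute[of D] intro: mult_le_mono)
    ultimately show ?case using AB c by (intro exI[of _ "A * a"] exI[of _ "B * b"]) auto
  qed
  have walk': "\<exists>A B :: nat. 1 \<le> A \<and> A \<le> D ^ n\<^sup>2 \<and> 1 \<le> B \<and> B \<le> D ^ n\<^sup>2 \<and>
      \<bar>ln (q k) - ln (q r) - (ln (real A) - ln (real B))\<bar> \<le> real (n\<^sup>2) * d" if "(k, r) \<in> Rel\<^sup>*" for k r
  proof -
    from that obtain m where m: "m \<le> card Rel" "(k, r) \<in> Rel ^^ m"
      unfolding rtrancl_finite_eq_relpow[OF finR] by auto
    obtain A B where AB: "1 \<le> A" "A \<le> D ^ m" "1 \<le> B" "B \<le> D ^ m"
      "\<bar>ln (q k) - ln (q r) - (ln (real A) - ln (real B))\<bar> \<le> real m * d" using walk[OF m(2)] by blast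
    have "D ^ m \<le> D ^ n\<^sup>2" "real m * d \<le> real (n\<^sup>2) * d"
      using m(1) cardR D d by (auto intro!: power_increasing mult_right_mono simp del: of_nat_power)
    then show ?thesis using AB by (intro exI[of _ A] exI[of _ B]) auto
  qed
  \<comment> \<open>The smallest vertex represents its component. Its price is taken over from
    \<open>q\<close>, and all other prices of the component follow by a walk to it.\<close>
  define root where "root k = (LEAST r. (k, r) \<in> Rel\<^sup>*)" for k
  have root: "(k, root k) \<in> Rel\<^sup>*" for k unfolding root_def by (rule LeastI[of _ k]) auto
  have root_eq: "root k = root j" if "(k, j) \<in> Rel" for k j
  proof -
    have "(k, r) \<in> Rel\<^sup>* \<longleftrightarrow> (j, r) \<in> Rel\<^sup>*" for r
      using that symR by (meson converse_rtrancl_into_rtrancl r_into_rtrancl rtrancl_trans symD)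
    then show ?thesis by (simp add: root_def)
  qed
  have rootn: "root k < n" if "k < n" for k
  proof -
    have "root k \<le> k" unfolding root_def by (rule Least_le) auto
    then show ?thesis using that by simp
  qed
  define W where "W k A B \<longleftrightarrow> 1 \<le> A \<and> A \<le> D ^ n\<^sup>2 \<and> 1 \<le> B \<and> B \<le> D ^ n\<^sup>2 \<and>
      \<bar>ln (q k) - ln (q (root k)) - (ln (real A) - ln (real B))\<bar> \<le> real (n\<^sup>2) * d" for k A B
  have "\<forall>k. \<exists>A B. W k A B" unfolding W_def using walk'[OF root] by blast
  then obtain A B where AB: "\<And>k. W k (A k) (B k)" by metis
  define p where "p k = real (A k) / real (B k) * q (root k)" for k
  have lnp: "ln (p k) = ln (real (A k)) - ln (real (B k)) + ln (q (root k))" if "k < n" for k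
    using AB[of k] q[OF rootn[OF that]] by (simp add: p_def W_def ln_mult ln_div)
  show thesis
  proof (rule that[of p])
    fix k assume k: "k < n"
    show "p k > 0" using AB[of k] q[OF rootn[OF k]] by (simp add: p_def W_def)
    show "\<bar>ln (p k) - ln (q k)\<bar> \<le> real (n\<^sup>2) * d" using AB[of k] lnp[OF k] unfolding W_def by linarith
  next
    fix k j a b assume c: "(k, j, a, b) \<in> C"
    have re: "root k = root j" by (rule root_eq) (use c in \<open>auto simp: Rel_def\<close>)
    define X where "X = b * A k * B j"
    define Y where "Y = a * A j * B k"
    have lX: "ln (real X) = ln (real b) + ln (real (A k)) + ln (real (B j))"
      using AB[of k] AB[of j] C[OF c] by (simp add: X_def W_def ln_mult)
    have lY: "ln (real Y) = ln (real a) + ln (real (A j)) + ln (real (B k))"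
      using AB[of k] AB[of j] C[OF c] by (simp add: Y_def W_def ln_mult)
    have M: "x * y * z \<le> D ^ (2 * n\<^sup>2 + 1)" if "x \<le> D" "y \<le> D ^ n\<^sup>2" "z \<le> D ^ n\<^sup>2" for x y z
    proof -
      have "x * y * z \<le> D * D ^ n\<^sup>2 * D ^ n\<^sup>2" using that by (intro mult_le_mono)
      also have "\<dots> = D ^ (2 * n\<^sup>2 + 1)" by (simp add: mult_2 power_add)
      finally show ?thesis .
    qed
    \<comment> \<open>From \<open>k\<close> to the common root, back to \<open>j\<close>, then over
      the edge to \<open>k\<close>: a closed walk of at most \<open>2 * n^2 + 1\<close> edges. The
      two sides of its product are integers at most \<open>D ^ (2 * n^2 + 1)\<close> whose
      logarithms differ by less than the gap between such integers.\<close>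
    have "X = Y"
    proof (rule ln_nat_gap)
      show "0 < X" "0 < Y" using AB[of k] AB[of j] C[OF c] by (auto simp: X_def Y_def W_def)
      show "X \<le> D ^ (2 * n\<^sup>2 + 1)"
        unfolding X_def by (rule M) (use AB[of k] AB[of j] C[OF c] in \<open>auto simp: W_def\<close>)
      show "Y \<le> D ^ (2 * n\<^sup>2 + 1)"
        unfolding Y_def by (rule M) (use AB[of k] AB[of j] C[OF c] in \<open>auto simp: W_def\<close>)
      have "\<bar>ln (real X) - ln (real Y)\<bar> \<le> real (2 * n\<^sup>2 + 1) * d"
        using near[OF c] AB[of k] AB[of j] re unfolding lX lY by (simp add: W_def algebra_simps abs_le_iff)
      also have "\<dots> < 1 / real (D ^ (2 * n\<^sup>2 + 1))"
        using small D by (simp add: pos_less_divide_eq)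
      finally show "\<bar>ln (real X) - ln (real Y)\<bar> < 1 / real (D ^ (2 * n\<^sup>2 + 1))" .
    qed
    then have "real b * real (A k) * real (B j) = real a * real (A j) * real (B k)"
      unfolding X_def Y_def by (simp flip: of_nat_mult)
    then show "real b * p k = real a * p j"
      using AB[of k] AB[of j] by (simp add: p_def re W_def field_simps)
  qed
qed

lemma equilibrium_prices_cong:
  assumes "equilibrium_prices n u p" "\<And>i. i < n \<Longrightarrow> p' i = p i"
  shows "equilibrium_prices n u p'"
proof -
  have "(\<lambda>l. real (u i l) / p' l) ` {..<n} = (\<lambda>l. real (u i l) / p l) ` {..<n}" for i
    using assms(2) by (intro image_cong) auto
  moreover have "(\<Sum>j<n. x i j * p' j) = (\<Sum>j<n. x i j * p j)" for x :: "nat \<Rightarrow> nat \<Rightarrow> real" and i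
    using assms(2) by (intro sum.cong) auto
  ultimately have "equilibrium n u p' x \<longleftrightarrow> equilibrium n u p x" for x
    unfolding equilibrium_def using assms(2) by simp
  then show ?thesis using assms(1) by (simp add: equilibrium_prices_def)
qed


text \<open>\<open>P\<close> is the chain in which agent \<open>i\<close> passes its money to the goods of the class of \<open>b i\<close>,
  in proportion to their prices \<open>pp\<close>; the relation \<open>E\<close> describes the edges that are nearly optimal at
  the prices \<open>q\<close>.\<close>

locale rounded_market =
  fixes n :: nat and u F :: "nat \<Rightarrow> nat \<Rightarrow> nat" and ps q pp :: "nat \<Rightarrow> real" and b :: "nat \<Rightarrow> nat"
    and E conn :: "nat \<Rightarrow> nat \<Rightarrow> bool" and d :: real and R P :: "nat \<Rightarrow> nat \<Rightarrow> real"
  assumes market: "exchange_market n u"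
    and f: "eqflow n u (\<lambda>i j. real (F i j))" and ps: "\<And>i. ps i = (\<Sum>j<n. real (F i j))"
    and q: "\<And>i. i < n \<Longrightarrow> q i > 0"
    and b: "\<And>i. i < n \<Longrightarrow> b i < n" "\<And>i. i < n \<Longrightarrow> u i (b i) > 0"
    and bE: "\<And>i. i < n \<Longrightarrow> E i (b i)" and supp: "\<And>i j. i < n \<Longrightarrow> j < n \<Longrightarrow> F i j > 0 \<Longrightarrow> E i j"
    and gap: "\<And>i j. i < n \<Longrightarrow> j < n \<Longrightarrow> \<not> E i j \<Longrightarrow>
        real (u i j) * q (b i) * (1 + 20 * real (n\<^sup>2) * d) \<le> real (u i (b i)) * q j"
    and d: "0 < d" "20 * real (n\<^sup>2) * d \<le> 1"
    and pp: "\<And>i. i < n \<Longrightarrow> pp i > 0" "\<And>i. i < n \<Longrightarrow> \<bar>ln (pp i) - ln (q i)\<bar> \<le> real (n\<^sup>2) * d"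
      "\<And>i j k. i < n \<Longrightarrow> j < n \<Longrightarrow> k < n \<Longrightarrow> E i j \<Longrightarrow> E i k \<Longrightarrow> real (u i k) * pp j = real (u i j) * pp k"
      "\<And>i j. i < n \<Longrightarrow> j < n \<Longrightarrow> F i j > 0 \<Longrightarrow> ps j * pp i = ps i * pp j"
    and R: "\<And>j k. j < n \<Longrightarrow> k < n \<Longrightarrow> R j k = (if conn j k then pp j / pp k else 0)"
      "\<And>i j. i < n \<Longrightarrow> j < n \<Longrightarrow> E i j \<Longrightarrow> conn j (b i)"
      "\<And>j k. j < n \<Longrightarrow> k < n \<Longrightarrow> conn j k \<Longrightarrow> conn k j"
      "\<And>j k l. j < n \<Longrightarrow> k < n \<Longrightarrow> l < n \<Longrightarrow> conn j k \<Longrightarrow> conn k l \<Longrightarrow> conn j l"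
    and P: "\<And>i j. i < n \<Longrightarrow> j < n \<Longrightarrow> P i j = R j (b i) / (\<Sum>k<n. R k (b i))"
begin

lemma ps_pos: "i < n \<Longrightarrow> ps i > 0"
  using f by (simp add: eqflow_def ps)

lemma ps_col: "j < n \<Longrightarrow> (\<Sum>i<n. real (F i j)) = ps j"
  using f by (simp add: eqflow_def ps)

lemma R_nonneg: "j < n \<Longrightarrow> k < n \<Longrightarrow> R j k \<ge> 0"
  using pp(1) by (simp add: R(1) less_imp_le)

lemma R_sum_pos:
  assumes i: "i < n"
  shows "(\<Sum>k<n. R k (b i)) > 0"
proof (rule sum_pos2[of _ "b i"])
  have bi: "b i < n" by (rule b(1)[OF i])
  then show "0 < R (b i) (b i)" using R(1)[OF bi bi] R(2)[OF i bi bE[OF i]] pp(1)[OF bi] by simp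
qed (use R_nonneg b(1)[OF i] in auto)

lemma P_nonneg: "i < n \<Longrightarrow> j < n \<Longrightarrow> P i j \<ge> 0"
  using R_nonneg b(1) R_sum_pos by (simp add: P less_imp_le)

lemma P_row: "i < n \<Longrightarrow> (\<Sum>j<n. P i j) = 1"
  using R_sum_pos[of i] by (simp add: P sum_divide_distrib[symmetric])

lemma P_pos: "i < n \<Longrightarrow> j < n \<Longrightarrow> conn j (b i) \<Longrightarrow> P i j > 0"
  using R_sum_pos pp(1) b(1) by (simp add: P R(1))

definition cls :: "nat \<Rightarrow> nat set" where "cls k = {j. j < n \<and> conn j k}"

text \<open>Normalising a column of price ratios cancels the reference price
  \<open>pp (b i)\<close>. So the chain depends only on the classes and the relative prices inside
  them, and agents with best goods in the same class have equal rows.\<close>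

lemma P_eq:
  assumes "i < n" "j < n"
  shows "P i j = (if conn j (b i) then pp j / (\<Sum>k\<in>cls j. pp k) else 0)"
proof (cases "conn j (b i)")
  case True
  have cl: "conn k (b i) \<longleftrightarrow> conn k j" if "k < n" for k
    using True R(3,4) that assms b(1)[OF assms(1)] by blast
  have "(\<Sum>k<n. R k (b i)) = (\<Sum>k<n. if conn k j then pp k / pp (b i) else 0)"
    using R(1) b(1) assms cl by (intro sum.cong) auto
  also have "\<dots> = (\<Sum>k\<in>cls j. pp k / pp (b i))"
    by (subst sum.inter_filter[symmetric]) (auto simp: cls_def intro!: sum.cong)
  also have "\<dots> = (\<Sum>k\<in>cls j. pp k) / pp (b i)" by (simp add: sum_divide_distrib)
  finally show ?thesis using True assms b(1) pp(1)[of "b i"] by (simp add: P R(1))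
next
  case False
  then show ?thesis using assms b(1) by (simp add: P R(1))
qed

text \<open>The rescaled flow \<open>F i j * pp i / ps i\<close> stays inside the classes.\<close>

lemma pp_stationary:
  assumes j: "j < n"
  shows "(\<Sum>i<n. pp i * P i j) = pp j"
proof -
  define g where "g i k = real (F i k) * pp i / ps i" for i k
  have gr: "(\<Sum>k<n. g i k) = pp i" if "i < n" for i
    using ps_pos[OF that] by (simp add: g_def sum_divide_distrib[symmetric] sum_distrib_right[symmetric] ps[symmetric])
  have ge: "g i k = real (F i k) * (pp k / ps k)" if "i < n" "k < n" for i k
    using pp(4)[OF that] ps_pos[OF that(1)] ps_pos[OF that(2)] by (cases "F i k > 0") (auto simp: g_def field_simps)
  have gc: "(\<Sum>i<n. g i k) = pp k" if "k < n" for k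
  proof -
    have "(\<Sum>i<n. g i k) = (\<Sum>i<n. real (F i k) * (pp k / ps k))" using ge that by (intro sum.cong) auto
    also have "\<dots> = ps k * (pp k / ps k)" unfolding sum_distrib_right[symmetric] ps_col[OF that] ..
    finally show ?thesis using ps_pos[OF that] by simp
  qed
  \<comment> \<open>The agents whose money goes to the class of \<open>j\<close>. The rescaled flow
    leads from \<open>A\<close> only into this class, and into the class only from \<open>A\<close>,
    so \<open>A\<close> owns exactly as much money as the class is worth.\<close>
  define A where "A = {i. i < n \<and> conn j (b i)}"
  have fin: "finite A" "finite (cls j)" by (auto simp: A_def cls_def)
  have cl: "i \<in> A \<longleftrightarrow> k \<in> cls j" if "i < n" "k < n" "g i k \<noteq> 0" for i k
  proof -
    have "F i k > 0" using that(3) by (cases "F i k") (auto simp: g_def)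
    then have "conn k (b i)" using R(2) supp that by blast
    then show ?thesis using R(3,4) j that b(1)[OF that(1)] unfolding A_def cls_def by blast
  qed
  have "(\<Sum>i\<in>A. pp i) = (\<Sum>i\<in>A. \<Sum>k<n. g i k)" using gr by (intro sum.cong) (auto simp: A_def)
  also have "\<dots> = (\<Sum>i\<in>A. \<Sum>k\<in>cls j. g i k)"
    using cl by (intro sum.cong refl sum.mono_neutral_right) (auto simp: A_def cls_def)
  also have "\<dots> = (\<Sum>k\<in>cls j. \<Sum>i\<in>A. g i k)" by (rule sum.swap)
  also have "\<dots> = (\<Sum>k\<in>cls j. \<Sum>i<n. g i k)"
    using cl by (intro sum.cong refl sum.mono_neutral_left) (auto simp: A_def cls_def)
  also have "\<dots> = (\<Sum>k\<in>cls j. pp k)" using gc by (intro sum.cong) (auto simp: cls_def)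
  finally have bal: "(\<Sum>i\<in>A. pp i) = (\<Sum>k\<in>cls j. pp k)" .
  have "A \<noteq> {}"
  proof -
    have "(\<Sum>i<n. real (F i j)) \<noteq> 0" using ps_col[OF j] ps_pos[OF j] by simp
    then obtain i where "i \<in> {..<n}" "real (F i j) \<noteq> 0" by (rule sum.not_neutral_contains_not_neutral)
    then have "i < n" "F i j > 0" by auto
    then show ?thesis using R(2)[OF _ j supp] j by (auto simp: A_def)
  qed
  then have "(\<Sum>i\<in>A. pp i) > 0" using pp(1) fin by (intro sum_pos) (auto simp: A_def)
  moreover have "(\<Sum>i<n. pp i * P i j) = (\<Sum>i<n. if i \<in> A then pp i * (pp j / (\<Sum>k\<in>cls j. pp k)) else 0)"
    using j by (intro sum.cong) (auto simp: P_eq A_def)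
  moreover have "\<dots> = (\<Sum>i\<in>A. pp i * (pp j / (\<Sum>k\<in>cls j. pp k)))"
    by (subst sum.inter_filter[symmetric]) (auto simp: A_def intro!: sum.cong)
  moreover have "\<dots> = (\<Sum>i\<in>A. pp i) * (pp j / (\<Sum>k\<in>cls j. pp k))" by (rule sum_distrib_right[symmetric])
  ultimately show ?thesis using bal by simp
qed

definition link :: "(nat \<times> nat) set" where
  "link = {(i, j). i < n \<and> j < n \<and> (P i j > 0 \<or> P j i > 0)}"

text \<open>A stationary vector \<open>p\<close> is a multiple of \<open>pp\<close> along \<open>P\<close>, because
  \<open>\<Sum>i j. pp i * P i j * (p i / pp i - p j / pp j)\<^sup>2\<close> vanishes.\<close>

lemma stationary_constant:
  assumes st: "\<And>j. j < n \<Longrightarrow> (\<Sum>i<n. p i * P i j) = p j" and ij: "i < n" "j < n" "P i j > 0"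
  shows "p i / pp i = p j / pp j"
proof -
  define c where "c i = p i / pp i" for i
  have pc: "p i = pp i * c i" if "i < n" for i using pp(1)[OF that] by (simp add: c_def)
  define G where "G i j = pp i * P i j * (c i - c j)\<^sup>2" for i j
  have G0: "G i j \<ge> 0" if "i < n" "j < n" for i j
    using pp(1)[OF that(1)] P_nonneg[OF that] by (simp add: G_def)
  have a: "(\<Sum>i<n. \<Sum>j<n. pp i * P i j * (c i)\<^sup>2) = (\<Sum>i<n. pp i * (c i)\<^sup>2)"
    using P_row by (simp add: sum_distrib_left[symmetric] sum_distrib_right[symmetric])
  have b: "(\<Sum>i<n. \<Sum>j<n. pp i * P i j * (c j)\<^sup>2) = (\<Sum>i<n. pp i * (c i)\<^sup>2)"
    by (subst sum.swap) (simp add: sum_distrib_right[symmetric] pp_stationary)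
  have "(\<Sum>i<n. \<Sum>j<n. pp i * P i j * (c i * c j)) = (\<Sum>j<n. (\<Sum>i<n. p i * P i j) * c j)"
    by (subst sum.swap) (auto simp: sum_distrib_right pc intro!: sum.cong)
  also have "\<dots> = (\<Sum>j<n. pp j * (c j)\<^sup>2)"
    using st by (intro sum.cong) (auto simp: pc power2_eq_square)
  finally have c: "(\<Sum>i<n. \<Sum>j<n. pp i * P i j * (c i * c j)) = (\<Sum>j<n. pp j * (c j)\<^sup>2)" .
  have "G i j = pp i * P i j * (c i)\<^sup>2 + pp i * P i j * (c j)\<^sup>2 - 2 * (pp i * P i j * (c i * c j))" for i j
    by (simp add: G_def power2_eq_square algebra_simps)
  then have "(\<Sum>i<n. \<Sum>j<n. G i j) = 0"
    by (simp only: sum_subtractf sum.distrib sum_distrib_left[symmetric] a b c)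
  moreover have "G i j \<le> (\<Sum>j<n. G i j)" using ij G0 by (intro member_le_sum) auto
  moreover have "\<dots> \<le> (\<Sum>i<n. \<Sum>j<n. G i j)"
    using ij G0 by (intro member_le_sum[of i _ "\<lambda>i. \<Sum>j<n. G i j"]) (auto intro: sum_nonneg)
  ultimately have "G i j = 0" using G0[OF ij(1,2)] by simp
  then show ?thesis using pp(1)[OF ij(1)] ij(3) by (simp add: G_def c_def)
qed

text \<open>A stationary vector is \<open>pp\<close> times a factor \<open>c\<close> that is
  constant on each component of \<open>link\<close>. The anchor in \<open>rt\<close>, a coordinate
  of the component where \<open>p\<close> equals \<open>q\<close>, keeps \<open>ln (c i)\<close>
  within the distance of \<open>pp\<close> and \<open>q\<close>. So the edges of \<open>E\<close>
  are exactly tied, and the others cannot overtake them because of the gap.\<close>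

lemma stationary_equilibrium:
  assumes p: "\<And>i. i < n \<Longrightarrow> p i > 0" and st: "\<And>j. j < n \<Longrightarrow> (\<Sum>i<n. p i * P i j) = p j"
    and rt: "\<And>i. i < n \<Longrightarrow> \<exists>r<n. (i, r) \<in> link\<^sup>* \<and> p r = q r"
  shows "equilibrium_prices n u p"
proof -
  define c where "c i = p i / pp i" for i
  have pc: "p i = pp i * c i" if "i < n" for i using pp(1)[OF that] by (simp add: c_def)
  have cpos: "c i > 0" if "i < n" for i using p pp(1) that by (simp add: c_def)
  have cl: "c i = c j" if "(i, j) \<in> link" for i j
    using that stationary_constant[OF st, of i j] stationary_constant[OF st, of j i] by (auto simp: link_def c_def)
  have crt: "c i = c j" if "(i, j) \<in> link\<^sup>*" for i j
    using that by (induction rule: rtrancl_induct) (auto dest: cl)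
  have cE: "c i = c j" if "i < n" "j < n" "E i j" for i j
    using stationary_constant[OF st, of i j] P_pos[of i j] R(2) that by (auto simp: c_def)
  have lnc: "\<bar>ln (c i)\<bar> \<le> real (n\<^sup>2) * d" if i: "i < n" for i
  proof -
    obtain r where r: "r < n" "(i, r) \<in> link\<^sup>*" "p r = q r" using rt[OF i] by blast
    have "ln (c i) = ln (q r) - ln (pp r)"
      using crt[OF r(2)] r pp(1)[OF r(1)] q[OF r(1)] by (simp add: c_def ln_div)
    then show ?thesis using pp(2)[OF r(1)] by linarith
  qed
  have lnp: "\<bar>ln (p i) - ln (q i)\<bar> \<le> 2 * (real (n\<^sup>2) * d)" if i: "i < n" for i
  proof -
    have "ln (p i) = ln (pp i) + ln (c i)" using pc[OF i] cpos[OF i] pp(1)[OF i] by (simp add: ln_mult)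
    then show ?thesis using pp(2)[OF i] lnc[OF i] by linarith
  qed
  \<comment> \<open>Each price moves by at most \<open>2 * n^2 * d\<close> in the logarithm, so a
    comparison of two goods changes by at most \<open>4 * n^2 * d\<close>. The gap provides
    \<open>ln (1 + x) >= x / 2 = 10 * n^2 * d\<close>.\<close>
  define x where "x = 20 * real (n\<^sup>2) * d"
  have n0: "n > 0" using market by (simp add: exchange_market_def)
  have x: "0 < x" "x \<le> 1" using d n0 by (auto simp: x_def)
  have lx: "x / 2 \<le> ln (1 + x)"
  proof -
    have "x - x\<^sup>2 \<le> ln (1 + x) \<or> x / 2 \<le> ln (1 + x)" using ln_one_plus_pos_lower_bound[of x] x by simp
    moreover have "- ln (1 + x) \<le> 1 / (1 + x) - 1"
      using ln_le_minus_one[of "1 / (1 + x)"] x by (simp add: ln_div)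
    moreover have "1 / (1 + x) - 1 \<le> - (x / 2)" using x by (simp add: field_simps)
    ultimately show ?thesis by linarith
  qed
  have opt: "real (u i k) * p (b i) \<le> real (u i (b i)) * p k" if i: "i < n" and k: "k < n" for i k
  proof (cases "E i k")
    case True
    have "real (u i k) * pp (b i) = real (u i (b i)) * pp k" using pp(3)[OF i b(1)[OF i] k bE[OF i] True] .
    moreover have "c (b i) = c k" using cE[OF i k True] cE[OF i b(1)[OF i] bE[OF i]] by simp
    ultimately show ?thesis using pc[OF k] pc[OF b(1)[OF i]] by (simp add: algebra_simps)
  next
    case False
    show ?thesis
    proof (cases "u i k = 0")
      case True
      then show ?thesis using p k b i by (simp add: less_imp_le)
    next
      case False
      have bi: "b i < n" using b i by simp
      have pos: "real (u i k) > 0" "real (u i (b i)) > 0" "q (b i) > 0" "q k > 0" "p (b i) > 0" "p k > 0"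
        using False b q p i k bi by auto
      have "ln (real (u i k) * q (b i) * (1 + x)) \<le> ln (real (u i (b i)) * q k)"
        using gap[OF i k \<open>\<not> E i k\<close>, folded x_def] pos x by (subst ln_le_cancel_iff) auto
      then have "ln (real (u i k)) + ln (q (b i)) + ln (1 + x) \<le> ln (real (u i (b i))) + ln (q k)"
        using pos x by (simp add: ln_mult)
      then have "ln (real (u i k)) + ln (p (b i)) \<le> ln (real (u i (b i))) + ln (p k)"
        using lnp[OF bi] lnp[OF k] lx x unfolding x_def by linarith
      then have "ln (real (u i k) * p (b i)) \<le> ln (real (u i (b i)) * p k)"
        using pos by (simp add: ln_mult)
      then show ?thesis using pos by (subst (asm) ln_le_cancel_iff) auto
    qed
  qed
  \<comment> \<open>The scaled \<open>F\<close> remains a circulation because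
    \<open>p i / ps i\<close> agrees at both ends of every edge used by \<open>F\<close>: the part
    from \<open>pp\<close> by construction, the factor \<open>c\<close> because \<open>F\<close>
    runs inside \<open>E\<close>.\<close>
  define g where "g i k = real (F i k) * p i / ps i" for i k
  have gr: "(\<Sum>k<n. g i k) = p i" if "i < n" for i
    using ps_pos[OF that] by (simp add: g_def sum_divide_distrib[symmetric] sum_distrib_right[symmetric] ps[symmetric])
  have ge: "g i k = real (F i k) * (p k / ps k)" if i: "i < n" and k: "k < n" for i k
  proof (cases "F i k > 0")
    case True
    have "pp i / ps i = pp k / ps k" using pp(4)[OF i k True] ps_pos[OF i] ps_pos[OF k] by (simp add: field_simps less_imp_neq[symmetric])
    moreover have "c i = c k" using cE supp i k True by blast
    ultimately show ?thesis using pc[OF i] pc[OF k] by (simp add: g_def) (metis mult.commute times_divide_eq_right)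
  qed (simp add: g_def)
  have gc: "(\<Sum>i<n. g i k) = p k" if "k < n" for k
  proof -
    have "(\<Sum>i<n. g i k) = (\<Sum>i<n. real (F i k) * (p k / ps k))" using ge that by (intro sum.cong) auto
    also have "\<dots> = ps k * (p k / ps k)" unfolding sum_distrib_right[symmetric] ps_col[OF that] ..
    finally show ?thesis using ps_pos[OF that] by simp
  qed
  have "eqflow n u g"
    unfolding eqflow_def
  proof (intro conjI allI impI)
    fix i j k assume ij: "i < n" "j < n" and g: "0 < g i j" and k: "k < n"
    have "F i j > 0" using g by (cases "F i j") (auto simp: g_def)
    then have Eij: "E i j" using supp ij by blast
    have bi: "b i < n" using b ij by simp
    have "real (u i j) * pp (b i) = real (u i (b i)) * pp j" using pp(3)[OF ij(1) bi ij(2) bE[OF ij(1)] Eij] .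
    moreover have "c (b i) = c j" using cE[OF ij Eij] cE[OF ij(1) bi bE[OF ij(1)]] by simp
    ultimately have eq: "real (u i j) * p (b i) = real (u i (b i)) * p j"
      using pc[OF ij(2)] pc[OF bi] by (simp add: algebra_simps)
    have "(real (u i k) * p j) * real (u i (b i)) = (real (u i k) * p (b i)) * real (u i j)" using eq by (simp add: algebra_simps)
    also have "\<dots> \<le> (real (u i (b i)) * p k) * real (u i j)" using opt[OF ij(1) k] by (intro mult_right_mono) auto
    finally have "real (u i k) * p j \<le> real (u i j) * p k"
      using b(2)[OF ij(1)] by (simp add: algebra_simps mult.commute[of "real (u i (b i))"])
    then show "real (u i k) * (\<Sum>l<n. g j l) \<le> real (u i j) * (\<Sum>l<n. g k l)" using gr ij k by simp
  qed (use gr gc p ps_pos in \<open>auto simp: g_def less_imp_le\<close>)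
  from equilibrium_prices_cong[OF eqflow_equilibrium[OF this], of p] gr show ?thesis by simp
qed

end

subsection \<open>State elimination\<close>

text \<open>Elimination of states of a Markov chain (Grassmann, Taksar, Heyman). Where a state has no
  exits left, the division by zero leaves the remaining rates unchanged, as it should.\<close>

definition eliminate :: "nat \<Rightarrow> (nat \<Rightarrow> nat \<Rightarrow> real) \<Rightarrow> nat \<Rightarrow> nat \<Rightarrow> real" where
  "eliminate k A i j = (if i < k \<and> j < k then A i j + A i k * A k j / (\<Sum>l<k. A k l) else A i j)"

text \<open>After \<open>d\<close> steps the states \<open>n - 1\<close> down to
  \<open>n - d\<close> are gone. Entries in the rows and columns of eliminated states are kept, as
  back substitution reads them.\<close>

primrec gth :: "nat \<Rightarrow> (nat \<Rightarrow> nat \<Rightarrow> real) \<Rightarrow> nat \<Rightarrow> nat \<Rightarrow> nat \<Rightarrow> real" where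
  "gth n P 0 = P"
| "gth n P (Suc d) = eliminate (n - Suc d) (gth n P d)"

text \<open>Stationarity in terms of rates: the outflow is written as a sum of exits, so diagonal
  entries cancel and rows need not sum to 1.\<close>

definition balanced :: "nat \<Rightarrow> (nat \<Rightarrow> nat \<Rightarrow> real) \<Rightarrow> (nat \<Rightarrow> real) \<Rightarrow> bool" where
  "balanced m A p \<longleftrightarrow> (\<forall>j<m. (\<Sum>i<m. p i * A i j) = p j * (\<Sum>i<m. A j i))"

lemma eliminate_nonneg:
  assumes "\<And>i j. i \<le> k \<Longrightarrow> j \<le> k \<Longrightarrow> A i j \<ge> 0" "i < k" "j < k"
  shows "eliminate k A i j \<ge> 0"
  using assms by (auto simp: eliminate_def intro!: add_nonneg_nonneg divide_nonneg_nonneg mult_nonneg_nonneg sum_nonneg)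

text \<open>Solve the balance of state \<open>k\<close> for \<open>p k\<close> and substitute it
  into the others. If \<open>k\<close> has no exits, division by zero makes the correction vanish,
  which is right because \<open>no\<close> then excludes entries into \<open>k\<close> too.\<close>

lemma balanced_eliminate:
  assumes A: "\<And>i j. i \<le> k \<Longrightarrow> j \<le> k \<Longrightarrow> A i j \<ge> 0"
    and k: "(\<Sum>i<k. p i * A i k) = p k * (\<Sum>l<k. A k l)"
    and no: "(\<Sum>l<k. A k l) = 0 \<Longrightarrow> \<forall>i<k. A i k = 0"
  shows "balanced (Suc k) A p \<longleftrightarrow> balanced k (eliminate k A) p"
proof -
  define S where "S = (\<Sum>l<k. A k l)"
  have *: "(\<Sum>i<Suc k. p i * A i j) = p j * (\<Sum>i<Suc k. A j i) \<longleftrightarrow>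
      (\<Sum>i<k. p i * eliminate k A i j) = p j * (\<Sum>i<k. eliminate k A j i)" if j: "j < k" for j
  proof -
    have l: "(\<Sum>i<k. p i * eliminate k A i j) = (\<Sum>i<k. p i * A i j) + (\<Sum>i<k. p i * A i k) * (A k j / S)"
      using j by (simp add: eliminate_def S_def[symmetric] distrib_left sum.distrib sum_distrib_right sum_divide_distrib mult.assoc)
    have r: "(\<Sum>i<k. eliminate k A j i) = (\<Sum>i<k. A j i) + A j k * (S / S)"
      using j by (simp add: eliminate_def S_def sum.distrib sum_distrib_left[symmetric] sum_divide_distrib[symmetric])
    show ?thesis
    proof (cases "S = 0")
      case True
      have "A k j = 0" using True A j sum_nonneg_eq_0_iff[of "{..<k}" "A k"] by (auto simp: S_def)
      then show ?thesis unfolding l r using True no j by (auto simp: S_def)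
    next
      case False
      then show ?thesis unfolding l r k by (simp add: S_def[symmetric] algebra_simps)
    qed
  qed
  have "(\<Sum>i<Suc k. p i * A i k) = p k * (\<Sum>i<Suc k. A k i)" using k by (simp add: algebra_simps)
  then show ?thesis unfolding balanced_def using * by (auto simp: less_Suc_eq)
qed

text \<open>The positive stationary \<open>pp\<close>, unknown to the program, rules out transient
  states: a state without exits to smaller states has no entries from them either. Thus
  \<open>S k = 0\<close> means that \<open>k\<close> starts a new recurrent class, whose scale is
  free and is set by \<open>q k\<close>; all other values follow from smaller states of the same
  component.\<close>

lemma gth_stationary:
  assumes P0: "\<And>i j. i < n \<Longrightarrow> j < n \<Longrightarrow> P i j \<ge> 0" and row: "\<And>i. i < n \<Longrightarrow> (\<Sum>j<n. P i j) = 1"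
    and pp: "\<And>i. i < n \<Longrightarrow> pp i > 0" and pst: "\<And>j. j < n \<Longrightarrow> (\<Sum>i<n. pp i * P i j) = pp j"
    and q: "\<And>i. i < n \<Longrightarrow> q i > (0::real)"
    and S: "\<And>k. k < n \<Longrightarrow> S k = (\<Sum>j<k. gth n P (n - Suc k) k j)"
    and p: "\<And>k. k < n \<Longrightarrow> p k = (if S k > 0 then (\<Sum>i<k. p i * gth n P (n - Suc k) i k / S k) else q k)"
    and link: "link = {(i, j). i < n \<and> j < n \<and> (P i j > 0 \<or> P j i > 0)}"
  shows "\<And>i. i < n \<Longrightarrow> p i > 0" "\<And>j. j < n \<Longrightarrow> (\<Sum>i<n. p i * P i j) = p j"
    "\<And>i. i < n \<Longrightarrow> \<exists>r<n. (i, r) \<in> link\<^sup>* \<and> p r = q r"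
proof -
  define G where "G m = gth n P (n - m)" for m
  have Gn: "G n = P" by (simp add: G_def)
  have Gs: "G k = eliminate k (G (Suc k))" if "k < n" for k
  proof -
    have "n - k = Suc (n - Suc k)" using that by simp
    then show ?thesis using that by (simp add: G_def)
  qed
  have G0: "\<forall>i<m. \<forall>j<m. G m i j \<ge> 0" if "m \<le> n" for m
    using that
  proof (induction rule: inc_induct)
    case base
    show ?case using P0 by (simp add: Gn)
  next
    case (step m)
    then show ?case using Gs[of m] eliminate_nonneg[of m "G (Suc m)"] by (auto simp: less_Suc_eq_le)
  qed
  have symL: "sym (link\<^sup>*)" unfolding link by (intro sym_rtrancl symI) auto
  have GL: "\<forall>i<m. \<forall>j<m. G m i j > 0 \<longrightarrow> (i, j) \<in> link\<^sup>*" if "m \<le> n" for m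
    using that
  proof (induction rule: inc_induct)
    case base
    show ?case by (auto simp: Gn link)
  next
    case (step m)
    show ?case
    proof (intro allI impI)
      fix i j assume ij: "i < m" "j < m" "0 < G m i j"
      have g: "G (Suc m) i m \<ge> 0" "G (Suc m) m j \<ge> 0" "G (Suc m) i j \<ge> 0" using G0[of "Suc m"] step.hyps ij by auto
      have "G (Suc m) i j > 0 \<or> (G (Suc m) i m > 0 \<and> G (Suc m) m j > 0)"
        using ij g Gs[of m] step.hyps by (auto simp: eliminate_def less_le)
      then show "(i, j) \<in> link\<^sup>*" using step.IH ij by (meson less_SucI lessI rtrancl_trans)
    qed
  qed
  have S': "S k = (\<Sum>l<k. G (Suc k) k l)" if "k < n" for k using S[OF that] by (simp add: G_def)
  have p': "p k = (if S k > 0 then (\<Sum>i<k. p i * G (Suc k) i k / S k) else q k)" if "k < n" for k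
    using p[OF that] by (simp add: G_def)
  have S0: "S k \<ge> 0" if "k < n" for k
    unfolding S'[OF that] using G0[of "Suc k"] that by (intro sum_nonneg) auto
  have last: "(\<Sum>i<k. x i * A i k) = x k * (\<Sum>l<k. A k l)" if "balanced (Suc k) A x" for k A x
    using that by (auto simp: balanced_def algebra_simps)
  have noin: "\<forall>i<k. G (Suc k) i k = 0" if "k < n" "balanced (Suc k) (G (Suc k)) pp" "S k = 0" for k
  proof -
    have "(\<Sum>i<k. pp i * G (Suc k) i k) = 0" using last[OF that(2)] S'[OF that(1)] that(3) by simp
    then have "\<forall>i\<in>{..<k}. pp i * G (Suc k) i k = 0"
      using G0[of "Suc k"] pp that(1) by (subst (asm) sum_nonneg_eq_0_iff) (auto simp: less_imp_le)
    then show ?thesis using pp less_trans[OF _ that(1)] by (metis lessThan_iff less_irrefl mult_eq_0_iff)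
  qed
  \<comment> \<open>The equation of state \<open>k\<close> alone allows passing between the chains
    with and without \<open>k\<close>: downwards for \<open>pp\<close>, upwards for
    \<open>p\<close>.\<close>
  have elim: "balanced (Suc k) (G (Suc k)) x \<longleftrightarrow> balanced k (G k) x"
    if "k < n" "balanced (Suc k) (G (Suc k)) pp" "(\<Sum>i<k. x i * G (Suc k) i k) = x k * S k" for k x
    unfolding Gs[OF that(1)] using that G0[of "Suc k"] noin[OF that(1,2)] S'[OF that(1)]
    by (intro balanced_eliminate) auto
  have bpp: "balanced m (G m) pp" if "m \<le> n" for m
    using that
  proof (induction rule: inc_induct)
    case base
    show ?case using pst row by (simp add: Gn balanced_def)
  next
    case (step m)
    then show ?case using elim[of m pp] last[OF step.IH] S'[of m] by simp
  qed
  have up: "balanced m (G m) p \<and> (\<forall>i<m. p i > 0 \<and> (\<exists>r<n. (i, r) \<in> link\<^sup>* \<and> p r = q r))" if "m \<le> n" for m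
    using that
  proof (induction m)
    case 0
    show ?case by (simp add: balanced_def)
  next
    case (Suc k)
    then have k: "k < n" and IH: "balanced k (G k) p" "\<And>i. i < k \<Longrightarrow> p i > 0 \<and> (\<exists>r<n. (i, r) \<in> link\<^sup>* \<and> p r = q r)" by auto
    have bk: "balanced (Suc k) (G (Suc k)) pp" using bpp k by simp
    have eq: "(\<Sum>i<k. p i * G (Suc k) i k) = p k * S k"
    proof (cases "S k > 0")
      case True
      then show ?thesis using p'[OF k] by (simp add: sum_divide_distrib[symmetric])
    next
      case False
      then have "S k = 0" using S0[OF k] by simp
      then show ?thesis using noin[OF k bk] by simp
    qed
    have b: "balanced (Suc k) (G (Suc k)) p" using elim[OF k bk eq] IH(1) by simp
    have "p k > 0 \<and> (\<exists>r<n. (k, r) \<in> link\<^sup>* \<and> p r = q r)"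
    proof (cases "S k > 0")
      case True
      have "(\<Sum>i<k. pp i * G (Suc k) i k) \<noteq> 0"
        using last[OF bk] S'[OF k] True pp[OF k] by simp
      then obtain i where i: "i \<in> {..<k}" "pp i * G (Suc k) i k \<noteq> 0" by (rule sum.not_neutral_contains_not_neutral)
      then have gi: "G (Suc k) i k > 0" using G0[of "Suc k"] k by (auto simp: less_le)
      have "0 < (\<Sum>i<k. p i * G (Suc k) i k / S k)"
      proof (rule sum_pos2[of _ i])
        show "0 < p i * G (Suc k) i k / S k" using IH(2)[of i] i(1) gi True by simp
        show "0 \<le> p j * G (Suc k) j k / S k" if "j \<in> {..<k}" for j
          using IH(2)[of j] that G0[of "Suc k"] k True by (simp add: less_imp_le)
      qed (use i in auto)
      then have pk: "p k > 0" using p'[OF k] True by simp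
      have "(i, k) \<in> link\<^sup>*" using GL[of "Suc k"] gi i k by auto
      then have ki: "(k, i) \<in> link\<^sup>*" using symL by (meson symD)
      obtain r where "r < n" "(i, r) \<in> link\<^sup>*" "p r = q r" using IH(2)[of i] i(1) by auto
      then show ?thesis using pk ki by (meson rtrancl_trans)
    next
      case False
      then show ?thesis using p'[OF k] q[OF k] k by auto
    qed
    then show ?case using b IH(2) by (auto simp: less_Suc_eq)
  qed
  show "p i > 0" if "i < n" for i using up[of n] that by simp
  show "\<exists>r<n. (i, r) \<in> link\<^sup>* \<and> p r = q r" if "i < n" for i using up[of n] that by simp
  show "(\<Sum>i<n. p i * P i j) = p j" if "j < n" for j
    using up[of n] that row by (simp add: Gn balanced_def)
qed

subsection \<open>Prices from a good query\<close>

text \<open>The choice \<open>b\<close> of best goods is existential, as the cut that found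
  \<open>q\<close> and the later rounding may break ties differently.\<close>

definition good_query :: "nat \<Rightarrow> (nat \<Rightarrow> nat \<Rightarrow> nat) \<Rightarrow> (nat \<Rightarrow> real) \<Rightarrow> (nat \<Rightarrow> real) \<Rightarrow> real \<Rightarrow> bool" where
  "good_query n u ps q e \<longleftrightarrow> (\<forall>j<n. q j > 0) \<and>
     (\<exists>b. (\<forall>i<n. b i < n \<and> (\<forall>j<n. real (u i j) * q (b i) \<le> real (u i (b i)) * q j)) \<and>
          (\<Sum>i<n. q i * ps (b i) / q (b i)) \<le> (\<Sum>i<n. ps i) + e)"

lemma good_query_mono: "good_query n u ps q e \<Longrightarrow> e \<le> e' \<Longrightarrow> good_query n u ps q e'"
  unfolding good_query_def by (meson add_left_mono order_trans)

text \<open>Two families of approximate ratios are rounded together: utilities of goods that are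
  nearly optimal for one agent, and the prices \<open>ps\<close> at the ends of an edge of
  \<open>F\<close>. The program sees only the first. Including the second makes the same
  \<open>pp\<close> compatible with a circulation.\<close>

lemma exact_prices:
  fixes F :: "nat \<Rightarrow> nat \<Rightarrow> nat" and q :: "nat \<Rightarrow> real" and D :: nat
  assumes m: "exchange_market n u" and f: "eqflow n u (\<lambda>i j. real (F i j))"
    and ps: "\<And>i. ps i = (\<Sum>j<n. real (F i j))"
    and good: "good_query n u ps q e"
    and B: "\<And>i. i < n \<Longrightarrow> B i < n" "\<And>i j. i < n \<Longrightarrow> j < n \<Longrightarrow> real (u i j) * q (B i) \<le> real (u i (B i)) * q j"
    and E: "\<And>i j. E i j \<longleftrightarrow> real (u i (B i)) * q j \<le> (1 + d) * (real (u i j) * q (B i))"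
    and d: "0 < d" "d \<le> 1" "0 \<le> e" "10 * sqrt e \<le> d"
    and D: "\<And>i j. i < n \<Longrightarrow> j < n \<Longrightarrow> u i j \<le> D" "\<And>i. i < n \<Longrightarrow> ps i \<le> real D"
    and small: "real (2 * n\<^sup>2 + 1) * d * real D ^ (2 * n\<^sup>2 + 1) < 1"
  obtains pp where "\<And>i. i < n \<Longrightarrow> pp i > 0" "\<And>i. i < n \<Longrightarrow> \<bar>ln (pp i) - ln (q i)\<bar> \<le> real (n\<^sup>2) * d"
      "\<And>i j k. i < n \<Longrightarrow> j < n \<Longrightarrow> k < n \<Longrightarrow> E i j \<Longrightarrow> E i k \<Longrightarrow> real (u i k) * pp j = real (u i j) * pp k"
      "\<And>i j. i < n \<Longrightarrow> j < n \<Longrightarrow> F i j > 0 \<Longrightarrow> ps j * pp i = ps i * pp j"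
      "\<And>i j. i < n \<Longrightarrow> j < n \<Longrightarrow> F i j > 0 \<Longrightarrow> E i j" "\<And>i. i < n \<Longrightarrow> E i (B i)" "\<And>i. i < n \<Longrightarrow> u i (B i) > 0"
proof -
  have n: "n > 0" using m by (simp add: exchange_market_def)
  have q: "q i > 0" if "i < n" for i using good that by (simp add: good_query_def)
  from good obtain b where b: "\<And>i. i < n \<Longrightarrow> b i < n"
    "\<And>i j. i < n \<Longrightarrow> j < n \<Longrightarrow> real (u i j) * q (b i) \<le> real (u i (b i)) * q j"
    and e: "(\<Sum>i<n. q i * ps (b i) / q (b i)) \<le> (\<Sum>i<n. ps i) + e"
    unfolding good_query_def by blast
  have se: "sqrt e \<le> 1 / 10" using d by simp
  have e16: "e \<le> 1 / 16"
  proof -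
    have "e = sqrt e * sqrt e" using d by simp
    also have "\<dots> \<le> (1 / 10) * (1 / 10)" using se d by (intro mult_mono) auto
    finally show ?thesis by simp
  qed
  have ubpos: "u i (a i) > 0" if "i < n" and a: "a i < n" "\<And>j. j < n \<Longrightarrow> real (u i j) * q (a i) \<le> real (u i (a i)) * q j" for i a
  proof -
    have "\<exists>k<n. u i k > 0" using m that by (simp add: exchange_market_def)
    then obtain k where k: "k < n" "u i k > 0" by blast
    have "0 < real (u i k) * q (a i)" using k q a by simp
    also have "\<dots> \<le> real (u i (a i)) * q k" using a k by simp
    finally show ?thesis by (simp add: zero_less_mult_iff)
  qed
  have uB: "u i (B i) > 0" if "i < n" for i using ubpos[of i B] that B by blast
  have ub: "u i (b i) > 0" if "i < n" for i using ubpos[of i b] that b by blast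
  \<comment> \<open>The best goods \<open>B\<close> need not be the goods \<open>b\<close> that
    witness the small excess, but both are optimal at \<open>q\<close>, so their bang per buck
    agrees.\<close>
  have bB: "ln (real (u i (b i))) - ln (q (b i)) = ln (real (u i (B i))) - ln (q (B i))" if i: "i < n" for i
  proof -
    have "real (u i (b i)) * q (B i) = real (u i (B i)) * q (b i)"
      using B(2)[OF i b(1)[OF i]] b(2)[OF i B(1)[OF i]] by (rule antisym)
    then have "ln (real (u i (b i)) * q (B i)) = ln (real (u i (B i)) * q (b i))" by simp
    then show ?thesis using uB[OF i] ub[OF i] q[OF b(1)[OF i]] q[OF B(1)[OF i]] by (simp add: ln_mult)
  qed
  have Epos: "u i j > 0" if "i < n" "j < n" "E i j" for i j
  proof -
    have "0 < real (u i (B i)) * q j" using uB q that by simp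
    also have "\<dots> \<le> (1 + d) * (real (u i j) * q (B i))" using that(3) E by simp
    finally show ?thesis by (cases "u i j") auto
  qed
  have BE: "E i (B i)" if "i < n" for i using d uB[OF that] q[OF B(1)[OF that]] by (simp add: E algebra_simps)
  have d2: "d / 2 \<le> ln (1 + d)"
  proof -
    have "- ln (1 + d) \<le> 1 / (1 + d) - 1"
      using ln_le_minus_one[of "1 / (1 + d)"] d by (simp add: ln_div)
    moreover have "1 / (1 + d) - 1 \<le> - (d / 2)" using d by (simp add: field_simps)
    ultimately show ?thesis by linarith
  qed
  have near: "\<bar>ln (q i / ps i) - ln (q j / ps j)\<bar> \<le> 5 * sqrt e"
    "ln (real (u i (b i)) * q j) - ln (real (u i j) * q (b i)) \<le> 5 * sqrt e" "u i j > 0"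
    if "i < n" "j < n" "F i j > 0" for i j
    by (rule near_equilibrium[OF f ps q b m e d(3) e16 that]; assumption)+
  have supp: "E i j" if ij: "i < n" "j < n" and F: "F i j > 0" for i j
  proof -
    have u: "u i j > 0" by (rule near(3)[OF ij F])
    have pos: "real (u i j) > 0" "real (u i (B i)) > 0" "real (u i (b i)) > 0" "q j > 0" "q (b i) > 0" "q (B i) > 0"
      using u uB ub q B b ij by auto
    have "ln (real (u i (b i)) * q j) - ln (real (u i j) * q (b i)) \<le> ln (1 + d)"
      using near(2)[OF ij F] d d2 by linarith
    then have "ln (real (u i (B i)) * q j) \<le> ln ((1 + d) * (real (u i j) * q (B i)))"
      using pos d bB[OF ij(1)] by (simp add: ln_mult)
    then show ?thesis unfolding E using pos d by (subst (asm) ln_le_cancel_iff) auto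
  qed
  define psn where "psn i = (\<Sum>j<n. F i j)" for i
  have psn: "ps i = real (psn i)" for i by (simp add: ps psn_def)
  have psp: "ps i > 0" if "i < n" for i using f that by (simp add: eqflow_def ps)
  define C where "C = {(j, k, a, c). \<exists>i<n. j < n \<and> k < n \<and> E i j \<and> E i k \<and> a = u i j \<and> c = u i k} \<union>
    {(i, j, a, c). i < n \<and> j < n \<and> (F i j > 0 \<or> F j i > 0) \<and> a = psn i \<and> c = psn j}"
  obtain pp where pp: "\<And>k. k < n \<Longrightarrow> pp k > 0" "\<And>k. k < n \<Longrightarrow> \<bar>ln (pp k) - ln (q k)\<bar> \<le> real (n\<^sup>2) * d"
    "\<And>k j a c. (k, j, a, c) \<in> C \<Longrightarrow> real c * pp k = real a * pp j"
  proof (rule consistent_rounding[of C n D q d])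
    fix k j a c assume c: "(k, j, a, c) \<in> C"
    then show "(j, k, c, a) \<in> C" by (auto simp: C_def)
    have psn1: "1 \<le> psn i \<and> psn i \<le> D" if "i < n" for i using psp[OF that] D(2)[OF that] psn[of i] by auto
    show "k < n \<and> j < n \<and> 1 \<le> a \<and> a \<le> D \<and> 1 \<le> c \<and> c \<le> D"
      using c psn1 D(1) Epos by (fastforce simp: C_def Suc_le_eq)
    from c consider i where "i < n" "k < n" "j < n" "E i k" "E i j" "a = u i k" "c = u i j"
      | "k < n" "j < n" "F k j > 0 \<or> F j k > 0" "a = psn k" "c = psn j" by (auto simp: C_def)
    then show "\<bar>ln (q k) - ln (q j) - (ln (real a) - ln (real c))\<bar> \<le> d"
    proof cases
      case 1
      have lE: "ln (real (u i l)) - ln (q l) \<le> ln (real (u i (B i))) - ln (q (B i)) \<and>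
          ln (real (u i (B i))) - ln (q (B i)) \<le> ln (real (u i l)) - ln (q l) + d" if "l < n" "E i l" for l
      proof -
        have pos: "real (u i l) > 0" "real (u i (B i)) > 0" "q l > 0" "q (B i) > 0"
          using Epos[OF 1(1) that] uB q B 1 that by auto
        have "ln (real (u i l) * q (B i)) \<le> ln (real (u i (B i)) * q l)"
          using B(2)[OF 1(1) that(1)] pos by (subst ln_le_cancel_iff) auto
        moreover have "ln (real (u i (B i)) * q l) \<le> ln ((1 + d) * (real (u i l) * q (B i)))"
          using that(2) pos d unfolding E by (subst ln_le_cancel_iff) auto
        moreover have "ln (1 + d) \<le> d" using ln_add_one_self_le_self[of d] d by simp
        ultimately show ?thesis using pos d by (simp add: ln_mult)
      qed
      show ?thesis using lE[OF 1(2,4)] lE[OF 1(3,5)] unfolding 1(6,7) by linarith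
    next
      case 2
      have pos: "ps k > 0" "ps j > 0" "q k > 0" "q j > 0" using psp q 2 by auto
      have "\<bar>ln (q k / ps k) - ln (q j / ps j)\<bar> \<le> d"
        using near(1)[of k j] near(1)[of j k] 2 d by (auto simp: abs_minus_commute)
      then show ?thesis using pos unfolding 2(4,5) by (simp add: psn[symmetric] ln_div)
    qed
  qed (use q d small D(1)[of 0 "B 0"] uB[of 0] B(1)[of 0] n in auto)
  show thesis
  proof (rule that[OF pp(1,2) _ _ supp BE uB])
    show "real (u i k) * pp j = real (u i j) * pp k" if "i < n" "j < n" "k < n" "E i j" "E i k" for i j k
      using pp(3)[of j k "u i j" "u i k"] that by (auto simp: C_def)
    show "ps j * pp i = ps i * pp j" if "i < n" "j < n" "F i j > 0" for i j
      using pp(3)[of i j "psn i" "psn j"] that by (auto simp: C_def psn)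
  qed
qed

section \<open>Size bounds and the constants of the algorithm\<close>

text \<open>Replaces \<open>U\<close>, which is not part of the input, and stays polynomial in
  \<open>n * U\<close>. The summand 2 makes it at least 4 in every market.\<close>

definition market_base :: "nat \<Rightarrow> (nat \<Rightarrow> nat \<Rightarrow> nat) \<Rightarrow> nat" where
  "market_base n u = n + 2 + (\<Sum>i<n. \<Sum>j<n. u i j)"

text \<open>Origin of the exponent: the cycle test compares products of \<open>2 * n^2 + 1\<close>
  integers, each up to \<open>market_base n u ^ (8 * n)\<close>.\<close>

definition market_big :: "nat \<Rightarrow> (nat \<Rightarrow> nat \<Rightarrow> nat) \<Rightarrow> nat" where
  "market_big n u = market_base n u ^ (n ^ 3)"

lemma market_base_facts:
  assumes "exchange_market n u"
  shows "4 \<le> market_base n u" "n \<le> market_base n u" "(\<Sum>i<n. \<Sum>j<n. u i j) \<le> market_base n u"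
    "i < n \<Longrightarrow> j < n \<Longrightarrow> u i j \<le> (\<Sum>i<n. \<Sum>j<n. u i j)" "n > 0"
proof -
  show n: "n > 0" using assms by (simp add: exchange_market_def)
  have le: "u i j \<le> (\<Sum>i<n. \<Sum>j<n. u i j)" if "i < n" "j < n" for i j
  proof -
    have "u i j \<le> (\<Sum>j<n. u i j)" using that by (intro member_le_sum) auto
    also have "\<dots> \<le> (\<Sum>i<n. \<Sum>j<n. u i j)" using that by (intro member_le_sum[of i _ "\<lambda>i. \<Sum>j<n. u i j"]) auto
    finally show ?thesis .
  qed
  then show "i < n \<Longrightarrow> j < n \<Longrightarrow> u i j \<le> (\<Sum>i<n. \<Sum>j<n. u i j)" .
  have "\<exists>j<n. u 0 j > 0" using assms n by (simp add: exchange_market_def)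
  then have "(\<Sum>i<n. \<Sum>j<n. u i j) \<ge> 1" using le[OF n] by fastforce
  then show "4 \<le> market_base n u" using n by (simp add: market_base_def)
qed (simp_all add: market_base_def)

lemma market_flow_bounds:
  assumes m: "exchange_market n u"
  obtains F :: "nat \<Rightarrow> nat \<Rightarrow> nat" where "eqflow n u (\<lambda>i j. real (F i j))"
    "\<And>i. i < n \<Longrightarrow> (\<Sum>j<n. F i j) \<le> market_base n u ^ (8 * n)"
    "(\<Sum>i<n. \<Sum>j<n. F i j) \<le> market_base n u ^ (8 * n)"
proof -
  define U where "U = (\<Sum>i<n. \<Sum>j<n. u i j)"
  define b where "b = market_base n u"
  note facts = market_base_facts[OF m, folded U_def b_def]
  obtain F :: "nat \<Rightarrow> nat \<Rightarrow> nat" where F: "eqflow n u (\<lambda>i j. real (F i j))"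
    "\<And>i j. i < n \<Longrightarrow> j < n \<Longrightarrow> F i j \<le> (4 * n * U) ^ (2 * n)"
    using eqflow_integral[OF m, of U] facts(4) by blast
  \<comment> \<open>Each factor is at most \<open>b\<close>, so a flow entry is at most
    \<open>b ^ (6 * n)\<close>. Two more factors \<open>n <= b\<close> pay for row sums and for the
    total, within \<open>b ^ (8 * n)\<close>.\<close>
  have "4 * n * U \<le> b * b * b" using facts by (intro mult_le_mono) auto
  then have "(4 * n * U) ^ (2 * n) \<le> (b ^ 3) ^ (2 * n)" by (intro power_mono) (auto simp: power3_eq_cube)
  also have "\<dots> = b ^ (6 * n)" by (simp add: power_mult[symmetric])
  finally have Fb: "F i j \<le> b ^ (6 * n)" if "i < n" "j < n" for i j using F(2)[OF that] by simp
  have row: "(\<Sum>j<n. F i j) \<le> b * b ^ (6 * n)" if "i < n" for i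
  proof -
    have "(\<Sum>j<n. F i j) \<le> n * b ^ (6 * n)" using sum_bounded_above[of "{..<n}" "F i" "b ^ (6 * n)"] Fb that by simp
    also have "\<dots> \<le> b * b ^ (6 * n)" using facts by (intro mult_right_mono) auto
    finally show ?thesis .
  qed
  have up: "b * (b * b ^ (6 * n)) \<le> b ^ (8 * n)"
  proof -
    have "b * (b * b ^ (6 * n)) = b ^ (6 * n + 2)" by (simp add: power_add power2_eq_square)
    also have "\<dots> \<le> b ^ (8 * n)" using facts by (intro power_increasing) auto
    finally show ?thesis .
  qed
  have "(\<Sum>i<n. \<Sum>j<n. F i j) \<le> n * (b * b ^ (6 * n))"
    using sum_bounded_above[of "{..<n}" "\<lambda>i. \<Sum>j<n. F i j" "b * b ^ (6 * n)"] row by simp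
  also have "\<dots> \<le> b * (b * b ^ (6 * n))" using facts by (intro mult_right_mono) auto
  finally have tot: "(\<Sum>i<n. \<Sum>j<n. F i j) \<le> b ^ (8 * n)" using up by simp
  have "(\<Sum>j<n. F i j) \<le> b ^ (8 * n)" if "i < n" for i
  proof -
    have "b * b ^ (6 * n) \<le> b * (b * b ^ (6 * n))" using facts by simp
    then show ?thesis using row[OF that] up by linarith
  qed
  with F(1) tot show thesis by (intro that[of F]) (auto simp: b_def)
qed

text \<open>The constants of the algorithm: precision \<open>H ^ 40\<close>, of which at most \<open>H ^ 5\<close> is lost in the
  search for a gap, and \<open>H ^ 100\<close> for the weight of the query to be found.\<close>

lemma market_constants:
  assumes m: "exchange_market n u" and H: "H = real (market_big n u)"
    and d: "1 / H ^ 40 \<le> d" "d \<le> (20 * real (n\<^sup>2)) ^ (n\<^sup>2) / H ^ 40"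
    and P: "0 \<le> P" "P \<le> real (market_base n u) ^ (8 * n)"
  shows "0 < d" "d \<le> 1" "20 * real (n\<^sup>2) * d \<le> 1" "10 * sqrt (P / H ^ 100) \<le> d"
    "real (2 * n\<^sup>2 + 1) * d * real (market_base n u ^ (8 * n)) ^ (2 * n\<^sup>2 + 1) < 1"
proof -
  define b where "b = real (market_base n u)"
  note facts = market_base_facts[OF m]
  have n: "n > 0" by (rule facts(5))
  have b4: "b \<ge> 4" "real n \<le> b" using facts(1,2) by (auto simp: b_def)
  have Hb: "H = b ^ (n ^ 3)" by (simp add: H market_big_def b_def)
  have bH: "b ^ (c * k) \<le> H ^ c" if "k \<le> n ^ 3" for c k
  proof -
    have "b ^ (c * k) \<le> b ^ (n ^ 3 * c)" using that b4 by (intro power_increasing) auto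
    then show ?thesis by (simp add: Hb power_mult)
  qed
  have n3: "1 \<le> n ^ 3" "n \<le> n ^ 3" "n\<^sup>2 \<le> n ^ 3" using n by (auto intro: self_le_power power_increasing)
  have Hge: "H \<ge> 4" using bH[OF n3(1), of 1] b4 by simp
  have H0: "H > 0" using Hge by simp
  have n2: "real (n\<^sup>2) \<le> b\<^sup>2" using b4 by (simp add: power_mono)
  have M: "20 * real (n\<^sup>2) \<le> b ^ 5"
  proof -
    have "20 * real (n\<^sup>2) \<le> b ^ 3 * b\<^sup>2"
      using n2 power_mono[of 4 b 3] b4 by (intro mult_mono) auto
    then show ?thesis by (simp flip: power_add)
  qed
  have M1: "20 * real (n\<^sup>2) \<le> H ^ 5" using M bH[OF n3(1), of 5] by simp
  \<comment> \<open>The exponent \<open>n^2\<close> bounds the number of widenings in the search for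
    a gap. They cost a factor \<open>H ^ 5\<close> of the precision \<open>H ^ 40\<close>, leaving
    \<open>1 / H ^ 35\<close>.\<close>
  have "(20 * real (n\<^sup>2)) ^ (n\<^sup>2) \<le> (b ^ 5) ^ (n\<^sup>2)" using M by (intro power_mono) auto
  also have "\<dots> \<le> H ^ 5" using bH[OF n3(3), of 5] by (simp add: power_mult)
  finally have "d \<le> H ^ 5 / H ^ 40" using d(2) H0 by (meson divide_right_mono order_trans zero_le_power less_imp_le)
  also have "\<dots> = 1 / H ^ 35" using H0 by (simp add: power_diff[symmetric] field_simps flip: power_add)
  finally have d35: "d \<le> 1 / H ^ 35" .
  show d0: "0 < d" using d(1) H0 by (meson less_le_trans zero_less_divide_1_iff zero_less_power)
  have H1: "H ^ a \<le> H ^ c" if "a \<le> c" for a c using that Hge by (intro power_increasing) auto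
  have "1 \<le> H ^ 35" using H1[of 0 35] by simp
  then have "1 / H ^ 35 \<le> 1" using H0 by (simp add: field_simps)
  then show "d \<le> 1" using d35 by simp
  have "20 * real (n\<^sup>2) * d \<le> H ^ 5 * (1 / H ^ 35)" using M1 d35 d0 H0 by (intro mult_mono) auto
  also have "\<dots> = 1 / H ^ 30" using H0 by (simp add: field_simps flip: power_add)
  also have "\<dots> \<le> 1" using H1[of 0 30] H0 by (simp add: field_simps)
  finally show "20 * real (n\<^sup>2) * d \<le> 1" .
  have "P \<le> H ^ 8" using P(2) bH[OF n3(2), of 8] by (simp add: b_def)
  then have "P / H ^ 100 \<le> H ^ 8 / H ^ 100" using H0 by (intro divide_right_mono) auto
  \<comment> \<open>Near equilibrium only the square root of the excess is controlled, so the weight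
    must exceed the square of the precision: \<open>H ^ 100\<close> against \<open>H ^ 40\<close>,
    with \<open>H ^ 8\<close> lost to the total money.\<close>
  also have "\<dots> = (1 / H ^ 46)\<^sup>2" using H0 by (simp add: field_simps power2_eq_square flip: power_add)
  finally have "sqrt (P / H ^ 100) \<le> 1 / H ^ 46" using H0 by (intro real_le_lsqrt) auto
  then have "10 * sqrt (P / H ^ 100) \<le> H ^ 2 * (1 / H ^ 46)"
    using power_mono[of 4 H 2] Hge P(1) by (intro mult_mono) auto
  also have "\<dots> = 1 / H ^ 44" using H0 by (simp add: field_simps flip: power_add)
  also have "\<dots> \<le> 1 / H ^ 40" using H0 H1[of 40 44] by (simp add: field_simps)
  finally show "10 * sqrt (P / H ^ 100) \<le> d" using d(1) by simp
  have a: "real (2 * n\<^sup>2 + 1) \<le> H ^ 3"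
  proof -
    have "real (2 * n\<^sup>2 + 1) \<le> 4 * b\<^sup>2"
    proof -
      have "1 \<le> b\<^sup>2" using b4 by simp
      then show ?thesis using n2 by simp
    qed
    also have "\<dots> \<le> b * b\<^sup>2" using b4 by (intro mult_right_mono) auto
    also have "\<dots> \<le> H ^ 3" using bH[OF n3(1), of 3] by (simp add: power2_eq_square power3_eq_cube)
    finally show ?thesis .
  qed
  have c: "(b ^ (8 * n)) ^ (2 * n\<^sup>2 + 1) \<le> H ^ 24"
  proof -
    have "(8 * n) * (2 * n\<^sup>2 + 1) \<le> 24 * n ^ 3"
      using n3 by (simp add: power2_eq_square power3_eq_cube algebra_simps)
    then have "b ^ ((8 * n) * (2 * n\<^sup>2 + 1)) \<le> b ^ (24 * n ^ 3)" using b4 by (intro power_increasing) auto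
    also have "\<dots> \<le> H ^ 24" using bH[of "n ^ 3" 24] by simp
    finally show ?thesis by (simp only: power_mult)
  qed
  \<comment> \<open>Budget of the cycle test: error \<open>1 / H ^ 35\<close> per edge, length at
    most \<open>H ^ 3\<close>, integers at most \<open>H ^ 24\<close>.\<close>
  have "real (2 * n\<^sup>2 + 1) * d * (b ^ (8 * n)) ^ (2 * n\<^sup>2 + 1) \<le> H ^ 3 * (1 / H ^ 35) * H ^ 24"
    using a c d35 d0 b4 H0 by (intro mult_mono) auto
  also have "\<dots> = 1 / H ^ 8" using H0 by (simp add: field_simps flip: power_add)
  also have "\<dots> < 1" using power_strict_increasing[of 0 8 H] Hge by simp
  finally show "real (2 * n\<^sup>2 + 1) * d * real (market_base n u ^ (8 * n)) ^ (2 * n\<^sup>2 + 1) < 1"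
    by (simp add: b_def)
qed

subsection \<open>The cutting-plane method\<close>

lemma prod_ge_one_plus_sum:
  fixes x :: "'a \<Rightarrow> real"
  assumes "finite K" "\<And>k. k \<in> K \<Longrightarrow> 0 \<le> x k"
  shows "1 + (\<Sum>k\<in>K. x k) \<le> (\<Prod>k\<in>K. 1 + x k)"
  using assms
proof (induction K rule: finite_induct)
  case (insert a K)
  have s: "0 \<le> (\<Sum>k\<in>K. x k)" using insert.prems by (intro sum_nonneg) auto
  have "1 + (x a + (\<Sum>k\<in>K. x k)) \<le> (1 + x a) * (1 + (\<Sum>k\<in>K. x k))"
    using s insert.prems[of a] by (simp add: algebra_simps)
  also have "\<dots> \<le> (1 + x a) * (\<Prod>k\<in>K. 1 + x k)"
    using insert by (intro mult_left_mono) auto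
  finally show ?case using insert.hyps by simp
qed simp

lemma prod_ge_one_minus_sum:
  fixes x :: "'a \<Rightarrow> real"
  assumes "finite K" "\<And>k. k \<in> K \<Longrightarrow> 0 \<le> x k \<and> x k \<le> 1"
  shows "1 - (\<Sum>k\<in>K. x k) \<le> (\<Prod>k\<in>K. 1 - x k)"
  using assms
proof (induction K rule: finite_induct)
  case (insert a K)
  have p: "(\<Prod>k\<in>K. 1 - x k) \<le> 1" using insert.prems by (intro prod_le_1) auto
  have "x a * (\<Prod>k\<in>K. 1 - x k) \<le> x a * 1" using p insert.prems[of a] by (intro mult_left_mono) auto
  then show ?case using insert by (simp add: algebra_simps)
qed simp

text \<open>Separate the gains \<open>p\<close> from the losses \<open>m\<close> and apply the
  Weierstrass product inequalities to both. With the step \<open>1 / (4 n^2)\<close> the total loss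
  is at most \<open>n * \<eta> = 1 / (4 n)\<close>; then \<open>m * m\<close> and
  \<open>\<eta> * m\<close> are at most \<open>\<eta> / 4\<close> each, and half of the gain
  remains.\<close>

lemma prod_gain:
  fixes x :: "'a \<Rightarrow> real"
  assumes K: "finite K" "card K \<le> n" "n > 0" and eta: "\<eta> = 1 / (4 * (real n)\<^sup>2)"
    and x: "\<And>k. k \<in> K \<Longrightarrow> - \<eta> \<le> x k" and s: "\<eta> \<le> (\<Sum>k\<in>K. x k)"
  shows "1 + \<eta> / 2 \<le> (\<Prod>k\<in>K. 1 + x k)"
proof -
  have eta0: "0 < \<eta>" "\<eta> \<le> 1 / 4" using K(3) by (auto simp: eta divide_simps)
  define A where "A = {k \<in> K. 0 \<le> x k}"
  define B where "B = {k \<in> K. x k < 0}"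
  have AB: "K = A \<union> B" "A \<inter> B = {}" "finite A" "finite B" using K(1) by (auto simp: A_def B_def)
  define p where "p = (\<Sum>k\<in>A. x k)"
  define m where "m = (\<Sum>k\<in>B. - x k)"
  have "(\<Sum>k\<in>K. x k) = p - m" unfolding AB(1) p_def m_def using AB by (simp add: sum.union_disjoint sum_negf)
  then have pm: "\<eta> + m \<le> p" using s by simp
  have m0: "0 \<le> m" unfolding m_def by (intro sum_nonneg) (auto simp: B_def)
  have "card B \<le> n" using card_mono[OF K(1), of B] K(2) by (auto simp: B_def)
  then have "m \<le> real n * \<eta>"
    unfolding m_def using sum_bounded_above[of B "\<lambda>k. - x k" \<eta>] x eta0
    by (smt (verit) B_def mem_Collect_eq mult_right_mono of_nat_le_iff)
  then have nm: "real n * m \<le> 1 / 4"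
    using mult_left_mono[of m "real n * \<eta>" "real n"] K(3) by (simp add: eta power2_eq_square)
  have m1: "m \<le> 1 / 4" using nm m0 K(3) mult_right_mono[of 1 "real n" m] by simp
  have mm: "m * m \<le> \<eta> / 4"
  proof -
    have "m * m \<le> (real n * \<eta>) * m" using \<open>m \<le> real n * \<eta>\<close> m0 by (rule mult_right_mono)
    also have "\<dots> = \<eta> * (real n * m)" by simp
    also have "\<dots> \<le> \<eta> * (1 / 4)" using nm eta0 by (intro mult_left_mono) auto
    finally show ?thesis by simp
  qed
  have "\<eta> * m \<le> \<eta> * (1 / 4)" using m1 eta0 by (intro mult_left_mono) auto
  moreover have "(1 + (\<eta> + m)) * (1 - m) = 1 + \<eta> - \<eta> * m - m * m" by (simp add: algebra_simps)
  ultimately have "1 + \<eta> / 2 \<le> (1 + (\<eta> + m)) * (1 - m)" using mm by linarith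
  also have "\<dots> \<le> (1 + p) * (1 - m)" using pm m1 by (intro mult_right_mono) auto
  also have "\<dots> \<le> (\<Prod>k\<in>A. 1 + x k) * (\<Prod>k\<in>B. 1 + x k)"
  proof (intro mult_mono)
    show "1 + p \<le> (\<Prod>k\<in>A. 1 + x k)" unfolding p_def using AB by (intro prod_ge_one_plus_sum) (auto simp: A_def)
    have "0 \<le> - x k \<and> - x k \<le> 1" if "k \<in> B" for k
      using x[of k] that eta0 by (auto simp: B_def)
    then have "1 - m \<le> (\<Prod>k\<in>B. 1 - (- x k))"
      unfolding m_def using AB(4) by (intro prod_ge_one_minus_sum) auto
    then show "1 - m \<le> (\<Prod>k\<in>B. 1 + x k)" by simp
    show "0 \<le> (\<Prod>k\<in>A. 1 + x k)" by (intro prod_nonneg) (auto simp: A_def)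
  qed (use m1 in auto)
  also have "\<dots> = (\<Prod>k\<in>K. 1 + x k)" unfolding AB(1) using AB by (simp add: prod.union_disjoint)
  finally show ?thesis .
qed

lemma good_query_cong:
  assumes "good_query n u ps q e" "\<And>j. j < n \<Longrightarrow> q' j = q j"
  shows "good_query n u ps q' e"
proof -
  from assms(1) obtain b where b: "\<forall>i<n. b i < n \<and> (\<forall>j<n. real (u i j) * q (b i) \<le> real (u i (b i)) * q j)"
    "(\<Sum>i<n. q i * ps (b i) / q (b i)) \<le> (\<Sum>i<n. ps i) + e" and q: "\<forall>j<n. q j > 0"
    unfolding good_query_def by blast
  have "(\<Sum>i<n. q' i * ps (b i) / q' (b i)) = (\<Sum>i<n. q i * ps (b i) / q (b i))"
    using b(1) assms(2) by (intro sum.cong) auto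
  then show ?thesis using b q assms(2) unfolding good_query_def by (intro conjI exI[of _ b]) auto
qed

section \<open>The determinant as a measure of progress\<close>

definition dt :: "nat \<Rightarrow> (nat \<Rightarrow> nat \<Rightarrow> real) \<Rightarrow> real" where
  "dt n N = Determinant.det (Matrix.mat n n (\<lambda>(i, j). N i j))"

text \<open>Leibniz formula. The factor \<open>fact n\<close> is harmless: it adds at most
  \<open>n * ln n\<close> to the logarithm that limits the number of iterations.\<close>

lemma dt_bound:
  assumes "\<And>i j. i < n \<Longrightarrow> j < n \<Longrightarrow> \<bar>N i j\<bar> \<le> X"
  shows "\<bar>dt n N\<bar> \<le> fact n * X ^ n"
proof -
  have "dt n N = (\<Sum>p | p permutes {0..<n}. signof p * (\<Prod>i = 0..<n. N i (p i)))"
    unfolding dt_def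
    by (subst Determinant.det_def') (auto intro!: sum.cong prod.cong arg_cong2[of _ _ _ _ "(*)"] simp: permutes_in_image)
  also have "\<bar>\<dots>\<bar> \<le> (\<Sum>p | p permutes {0..<n}. X ^ n)"
  proof (rule order_trans[OF sum_abs sum_mono])
    fix p assume "p \<in> {p. p permutes {0..<n}}"
    then have p: "p permutes {0..<n}" by simp
    have "\<bar>signof p * (\<Prod>i = 0..<n. N i (p i))\<bar> = (\<Prod>i = 0..<n. \<bar>N i (p i)\<bar>)"
      by (simp add: abs_mult abs_prod sign_def)
    also have "\<dots> \<le> (\<Prod>i = 0..<n. X)"
      using assms permutes_in_image[OF p] by (intro prod_mono) auto
    finally show "\<bar>signof p * (\<Prod>i = 0..<n. N i (p i))\<bar> \<le> X ^ n" by simp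
  qed
  also have "\<dots> = fact n * X ^ n" by (simp add: card_permutations[of "{0..<n}" n])
  finally show ?thesis .
qed

text \<open>\<open>N'\<close> is \<open>N\<close> multiplied by a matrix that is diagonal except for
  row \<open>m\<close>. A permutation contributing to the determinant of that matrix fixes every
  index other than \<open>m\<close>, hence \<open>m\<close> too.\<close>

lemma dt_row_operation:
  assumes m: "m < n" and N': "\<And>k i. k < n \<Longrightarrow> i < n \<Longrightarrow>
      N' k i = (if k = m then N m i - (\<Sum>l\<in>{..<n} - {m}. (f l - 1) * N l i) else f k * N k i)"
  shows "dt n N' = (\<Prod>k\<in>{..<n} - {m}. f k) * dt n N"
proof -
  define M where "M k l = (if k = m then (if l = m then 1 else - (f l - 1)) else if k = l then f k else 0)" for k l
  have "Matrix.mat n n (\<lambda>(i, j). N' i j) = Matrix.mat n n (\<lambda>(i, j). M i j) * Matrix.mat n n (\<lambda>(i, j). N i j)"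
  proof (rule eq_matI)
    fix k i assume "k < dim_row (Matrix.mat n n (\<lambda>(i, j). M i j) * Matrix.mat n n (\<lambda>(i, j). N i j))"
      "i < dim_col (Matrix.mat n n (\<lambda>(i, j). M i j) * Matrix.mat n n (\<lambda>(i, j). N i j))"
    then have ki: "k < n" "i < n" by auto
    have "(\<Sum>l\<in>{0..<n}. M k l * N l i) = N' k i"
    proof (cases "k = m")
      case True
      have "(\<Sum>l\<in>{0..<n}. M k l * N l i) = M k m * N m i + (\<Sum>l\<in>{0..<n} - {m}. M k l * N l i)"
        using m by (intro sum.remove) auto
      also have "(\<Sum>l\<in>{0..<n} - {m}. M k l * N l i) = - (\<Sum>l\<in>{..<n} - {m}. (f l - 1) * N l i)"
        unfolding sum_negf[symmetric] using True by (intro sum.cong) (auto simp: M_def algebra_simps)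
      finally show ?thesis using True N'[OF ki] by (simp add: M_def)
    next
      case False
      have "(\<Sum>l\<in>{0..<n}. M k l * N l i) = (\<Sum>l\<in>{0..<n}. if l = k then f k * N k i else 0)"
        using False by (intro sum.cong) (auto simp: M_def)
      then show ?thesis using False N'[OF ki] ki by simp
    qed
    then show "Matrix.mat n n (\<lambda>(i, j). N' i j) $$ (k, i) =
        (Matrix.mat n n (\<lambda>(i, j). M i j) * Matrix.mat n n (\<lambda>(i, j). N i j)) $$ (k, i)"
      using ki by (simp add: scalar_prod_def)
  qed auto
  then have "dt n N' = dt n M * dt n N"
    unfolding dt_def by (simp add: Determinant.det_mult[of _ n])
  moreover have "dt n M = (\<Prod>k\<in>{..<n} - {m}. f k)"
  proof -
    have "dt n M = (\<Sum>p | p permutes {0..<n}. signof p * (\<Prod>i = 0..<n. M i (p i)))"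
      unfolding dt_def
      by (subst Determinant.det_def') (auto intro!: sum.cong prod.cong arg_cong2[of _ _ _ _ "(*)"] simp: permutes_in_image)
    also have "\<dots> = (\<Sum>p | p permutes {0..<n}. if p = id then \<Prod>i = 0..<n. M i i else 0)"
    proof (intro sum.cong refl)
      fix p assume "p \<in> {p. p permutes {0..<n}}"
      then have p: "p permutes {0..<n}" by simp
      show "signof p * (\<Prod>i = 0..<n. M i (p i)) = (if p = id then \<Prod>i = 0..<n. M i i else 0)"
      proof (cases "p = id")
        case False
        have "\<exists>i\<in>{0..<n}. i \<noteq> m \<and> p i \<noteq> i"
        proof (rule ccontr)
          assume "\<not> ?thesis"
          then have "p i = i" if "i \<noteq> m" for i using p that by (cases "i < n") (auto simp: permutes_def)
          moreover from this have "p m = m" using permutes_inj[OF p] by (metis injD)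
          ultimately have "p = id" by (metis eq_id_iff)
          with False show False by simp
        qed
        then obtain i where i: "i \<in> {0..<n}" "i \<noteq> m" "p i \<noteq> i" by blast
        then have "M i (p i) = 0" by (simp add: M_def)
        then have "(\<Prod>i = 0..<n. M i (p i)) = 0" using i(1) by (intro prod_zero) auto
        then show ?thesis using False by simp
      qed simp
    qed
    also have "\<dots> = (\<Prod>i = 0..<n. M i i)"
      by (subst sum.delta) (auto simp: permutes_id finite_permutations)
    also have "\<dots> = M m m * (\<Prod>i\<in>{0..<n} - {m}. M i i)" using m by (intro prod.remove) auto
    also have "\<dots> = (\<Prod>k\<in>{..<n} - {m}. f k)" by (simp add: M_def atLeast0LessThan)
    finally show ?thesis .
  qed
  ultimately show ?thesis by simp
qed

text \<open>\<open>V k\<close> are the generators of the cone and \<open>N k\<close> the corresponding coordinate functionals. Each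
  functional is a nonnegative combination of coordinates and of the cuts made so far; \<open>bv k\<close> is
  the largest weight of a demand cut in it and \<open>bp k\<close> the query that produced this cut.\<close>

definition cone_functionals where
  "cone_functionals n u ps t V bv bp N \<longleftrightarrow>
     (\<forall>i<n. \<forall>j<n. (\<Sum>k<n. N k i * V k j) = (if i = j then 1 else 0)) \<and>
     (\<forall>j<n. (\<Sum>k<n. N k j) = 1) \<and>
     (\<forall>k<n. 0 \<le> (\<Sum>j<n. N k j * ps j)) \<and>
     (1 + 1 / (8 * (real n)\<^sup>2)) ^ t \<le> dt n N \<and>
     (\<forall>k<n. 0 \<le> bv k \<and> (\<forall>j<n. - (real t * bv k) \<le> N k j) \<and>
        (bv k > 0 \<longrightarrow> good_query n u ps (bp k) ((\<Sum>j<n. N k j * ps j) / bv k)))"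

text \<open>The functionals are existential because the program stores only their dual basis
  \<open>V\<close>.\<close>

definition cone_inv where
  "cone_inv n u ps t V bv bp \<longleftrightarrow> (\<exists>N. cone_functionals n u ps t V bv bp N)"

lemma cone_inv_init:
  assumes "\<And>k j. k < n \<Longrightarrow> j < n \<Longrightarrow> V k j = (if k = j then 1 else 0)" "\<And>k. k < n \<Longrightarrow> bv k = 0"
    and ps: "\<And>j. j < n \<Longrightarrow> ps j > 0"
  shows "cone_inv n u ps 0 V bv bp"
proof -
  define N where "N k j = (if k = j then 1 else (0::real))" for k j :: nat
  have "dt n N = Determinant.det (1\<^sub>m n)"
    unfolding dt_def by (intro arg_cong[of _ _ Determinant.det] eq_matI) (auto simp: N_def)
  then have "dt n N = 1" by simp
  moreover have "(\<Sum>k<n. N k i * V k j) = (if i = j then 1 else 0)" if "i < n" "j < n" for i j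
  proof -
    have "(\<Sum>k<n. N k i * V k j) = (\<Sum>k<n. if k = i then V i j else 0)" by (intro sum.cong) (auto simp: N_def)
    then show ?thesis using assms(1)[OF that] that by simp
  qed
  moreover have "(\<Sum>j<n. N k j * ps j) = ps k" if "k < n" for k
  proof -
    have "(\<Sum>j<n. N k j * ps j) = (\<Sum>j<n. if j = k then ps k else 0)" by (intro sum.cong) (auto simp: N_def)
    then show ?thesis using that by simp
  qed
  ultimately show ?thesis unfolding cone_inv_def cone_functionals_def using assms(2) ps
    by (intro exI[of _ N]) (auto simp: N_def less_imp_le)
qed

text \<open>The functional of the generator at which the cut is largest becomes
  \<open>(1 - \<eta>) * N m + \<eta> / ak m * a\<close>, and the others are scaled by
  \<open>f k\<close>, in such a way that the sum of all functionals is unchanged. The cut is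
  nonpositive at the centre, so its values \<open>ak k\<close> have nonpositive sum. Hence the
  factors \<open>f k\<close> with \<open>k \<noteq> m\<close> exceed 1 by at least
  \<open>\<eta>\<close> in total, and \<open>prod_gain\<close> bounds the growth of the
  determinant.\<close>

lemma cone_step:
  assumes inv: "cone_inv n u ps t V bv bp" and n: "n > 0"
    and eta: "\<eta> = 1 / (4 * (real n)\<^sup>2)"
    and ak: "\<And>k. k < n \<Longrightarrow> ak k = (\<Sum>j<n. a j * V k j)"
    and m: "m < n" "\<And>k. k < n \<Longrightarrow> ak k \<le> ak m" "ak m > 0"
    and c: "\<And>j. j < n \<Longrightarrow> c j = (\<Sum>k<n. V k j)"
    and ac: "(\<Sum>j<n. a j * c j) \<le> 0" and aps: "0 \<le> (\<Sum>j<n. a j * ps j)" and a1: "\<And>j. j < n \<Longrightarrow> - 1 \<le> a j"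
    and f: "\<And>k. k < n \<Longrightarrow> f k = 1 - \<eta> * ak k / ak m"
    and V': "\<And>k j. k < n \<Longrightarrow> j < n \<Longrightarrow> V' k j = (V k j + (f k - 1) * V m j) / f k"
    and bv': "\<And>k. k < n \<Longrightarrow> bv' k = (if upd \<and> k = m then \<eta> / ak m else bv k * f k)"
    and bp': "\<And>k j. k < n \<Longrightarrow> j < n \<Longrightarrow> bp' k j = (if upd \<and> k = m then c j else bp k j)"
    and upd: "upd \<Longrightarrow> bv m * f m \<le> \<eta> / ak m" "upd \<Longrightarrow> good_query n u ps c (\<Sum>j<n. a j * ps j)"
    and nupd: "\<not> upd \<Longrightarrow> (\<forall>j<n. 0 \<le> a j) \<or> \<eta> / ak m \<le> bv m * f m"
  shows "cone_inv n u ps (Suc t) V' bv' bp'"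
proof -
  from inv obtain N where N: "cone_functionals n u ps t V bv bp N" unfolding cone_inv_def by blast
  then have
    id: "\<And>i j. i < n \<Longrightarrow> j < n \<Longrightarrow> (\<Sum>k<n. N k i * V k j) = (if i = j then 1 else 0)"
    and N1: "\<And>j. j < n \<Longrightarrow> (\<Sum>k<n. N k j) = 1" and Nps: "\<And>k. k < n \<Longrightarrow> 0 \<le> (\<Sum>j<n. N k j * ps j)"
    and det: "(1 + 1 / (8 * (real n)\<^sup>2)) ^ t \<le> dt n N"
    and bv0: "\<And>k. k < n \<Longrightarrow> 0 \<le> bv k" and Nb: "\<And>k j. k < n \<Longrightarrow> j < n \<Longrightarrow> - (real t * bv k) \<le> N k j"
    and gq: "\<And>k. k < n \<Longrightarrow> bv k > 0 \<Longrightarrow> good_query n u ps (bp k) ((\<Sum>j<n. N k j * ps j) / bv k)"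
    unfolding cone_functionals_def by simp_all
  have eta0: "0 < \<eta>" "\<eta> \<le> 1 / 4" using n by (auto simp: eta divide_simps)
  have fm: "f m = 1 - \<eta>" using f[OF m(1)] m(3) by simp
  have fge: "- \<eta> \<le> f k - 1" if "k < n" for k
  proof -
    have "\<eta> * ak k / ak m \<le> \<eta> * ak m / ak m" using m(2)[OF that] m(3) eta0 by (intro divide_right_mono mult_left_mono) auto
    then show ?thesis using f[OF that] m(3) by simp
  qed
  have fpos: "f k > 0" if "k < n" for k using fge[OF that] eta0 by simp
  define K where "K = {..<n} - {m}"
  have split: "(\<Sum>k<n. g k) = g m + (\<Sum>k\<in>K. g k)" for g :: "nat \<Rightarrow> real"
    unfolding K_def using m(1) by (intro sum.remove) auto
  define N' where "N' k i = (if k = m then N m i - (\<Sum>l\<in>K. (f l - 1) * N l i) else f k * N k i)" for k i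
  \<comment> \<open>As \<open>V\<close> and \<open>N\<close> are dual bases, the coordinates of the
    cut with respect to the functionals are its values at the generators.\<close>
  have aN: "(\<Sum>k<n. ak k * N k i) = a i" if i: "i < n" for i
  proof -
    have "(\<Sum>k<n. ak k * N k i) = (\<Sum>k<n. \<Sum>j<n. a j * (N k i * V k j))"
      using ak by (auto simp: sum_distrib_right sum_distrib_left mult_ac intro!: sum.cong)
    also have "\<dots> = (\<Sum>j<n. a j * (\<Sum>k<n. N k i * V k j))"
      by (subst sum.swap) (simp add: sum_distrib_left)
    also have "\<dots> = (\<Sum>j<n. if j = i then a i else 0)" using id[OF i] by (intro sum.cong) auto
    finally show ?thesis using i by simp
  qed
  have N'm: "N' m i = (1 - \<eta>) * N m i + \<eta> / ak m * a i" if i: "i < n" for i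
  proof -
    have "(\<Sum>l\<in>K. (f l - 1) * N l i) = - (\<eta> / ak m) * (\<Sum>l\<in>K. ak l * N l i)"
      unfolding sum_distrib_left using f by (intro sum.cong) (auto simp: K_def)
    also have "(\<Sum>l\<in>K. ak l * N l i) = a i - ak m * N m i" using split[of "\<lambda>l. ak l * N l i"] aN[OF i] by simp
    finally show ?thesis using m(3) by (simp add: N'_def field_simps)
  qed
  have V'm: "V' m j = V m j" if "j < n" for j
    using V'[OF m(1) that] fpos[OF m(1)] by (simp add: field_simps)
  have id': "(\<Sum>k<n. N' k i * V' k j) = (if i = j then 1 else 0)" if ij: "i < n" "j < n" for i j
  proof -
    have "(\<Sum>k\<in>K. N' k i * V' k j) = (\<Sum>k\<in>K. N k i * V k j + ((f k - 1) * N k i) * V m j)"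
    proof (intro sum.cong refl)
      fix k assume "k \<in> K"
      then have k: "k < n" "k \<noteq> m" by (auto simp: K_def)
      show "N' k i * V' k j = N k i * V k j + (f k - 1) * N k i * V m j"
      proof -
        have "f k * V' k j = V k j + (f k - 1) * V m j" using fpos[OF k(1)] V'[OF k(1) ij(2)] by simp
        then have "N k i * (f k * V' k j) = N k i * (V k j + (f k - 1) * V m j)" by simp
        then show ?thesis using k by (simp add: N'_def algebra_simps)
      qed
    qed
    also have "\<dots> = (\<Sum>k\<in>K. N k i * V k j) + (\<Sum>k\<in>K. (f k - 1) * N k i) * V m j"
      by (simp only: sum.distrib sum_distrib_right)
    finally have "(\<Sum>k\<in>K. N' k i * V' k j) = (\<Sum>k\<in>K. N k i * V k j) + (\<Sum>k\<in>K. (f k - 1) * N k i) * V m j" .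
    moreover have "N' m i * V' m j = N m i * V m j - (\<Sum>k\<in>K. (f k - 1) * N k i) * V m j"
      unfolding V'm[OF ij(2)] by (simp add: N'_def left_diff_distrib)
    ultimately have "(\<Sum>k<n. N' k i * V' k j) = (\<Sum>k<n. N k i * V k j)"
      using split[of "\<lambda>k. N' k i * V' k j"] split[of "\<lambda>k. N k i * V k j"] by linarith
    then show ?thesis using id[OF ij] by simp
  qed
  have N1': "(\<Sum>k<n. N' k j) = 1" if "j < n" for j
  proof -
    have "(\<Sum>k\<in>K. N' k j) = (\<Sum>k\<in>K. N k j) + (\<Sum>k\<in>K. (f k - 1) * N k j)"
      unfolding sum.distrib[symmetric] by (intro sum.cong) (auto simp: N'_def K_def algebra_simps)
    then show ?thesis using split[of "\<lambda>k. N' k j"] split[of "\<lambda>k. N k j"] N1[OF that] by (simp add: N'_def)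
  qed
  define lam where "lam k = (\<Sum>j<n. N k j * ps j)" for k
  have lamk: "(\<Sum>j<n. N' k j * ps j) = f k * lam k" if "k < n" "k \<noteq> m" for k
    using that by (simp add: N'_def lam_def sum_distrib_left mult.assoc)
  have lamm: "(\<Sum>j<n. N' m j * ps j) = (1 - \<eta>) * lam m + \<eta> / ak m * (\<Sum>j<n. a j * ps j)"
    unfolding lam_def sum_distrib_left sum.distrib[symmetric] by (intro sum.cong) (auto simp: N'm algebra_simps)
  have lam0: "lam k \<ge> 0" if "k < n" for k using Nps[OF that] by (simp add: lam_def)
  have em: "0 < \<eta> / ak m" using eta0 m(3) by simp
  have Nps': "0 \<le> (\<Sum>j<n. N' k j * ps j)" if "k < n" for k
  proof (cases "k = m")
    case True
    have "0 \<le> (1 - \<eta>) * lam m" using lam0[OF m(1)] eta0 by simp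
    moreover have "0 \<le> \<eta> / ak m * (\<Sum>j<n. a j * ps j)"
      by (rule mult_nonneg_nonneg) (use aps em in auto)
    ultimately show ?thesis unfolding True lamm by (rule add_nonneg_nonneg)
  next
    case False
    then show ?thesis using that lam0[OF that] lamk[OF that] fpos[OF that] by simp
  qed
  have gain: "1 + 1 / (8 * (real n)\<^sup>2) \<le> (\<Prod>k\<in>K. f k)"
  proof -
    have "(\<Sum>k\<in>K. f k - 1) = - (\<eta> / ak m) * (\<Sum>k\<in>K. ak k)"
      unfolding sum_distrib_left using f by (intro sum.cong) (auto simp: K_def)
    also have "(\<Sum>k\<in>K. ak k) = (\<Sum>k<n. ak k) - ak m" using split[of ak] by simp
    also have "(\<Sum>k<n. ak k) = (\<Sum>j<n. a j * c j)"
    proof -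
      have "(\<Sum>k<n. ak k) = (\<Sum>k<n. \<Sum>j<n. a j * V k j)" using ak by (intro sum.cong) auto
      also have "\<dots> = (\<Sum>j<n. a j * c j)" by (subst sum.swap) (simp add: c sum_distrib_left)
      finally show ?thesis .
    qed
    also have "- (\<eta> / ak m) * ((\<Sum>j<n. a j * c j) - ak m) = \<eta> - \<eta> / ak m * (\<Sum>j<n. a j * c j)"
      using m(3) by (simp add: field_simps)
    finally have "(\<Sum>k\<in>K. f k - 1) = \<eta> - \<eta> / ak m * (\<Sum>j<n. a j * c j)" .
    moreover have "\<eta> / ak m * (\<Sum>j<n. a j * c j) \<le> 0" by (rule mult_nonneg_nonpos) (use em ac in auto)
    ultimately have "\<eta> \<le> (\<Sum>k\<in>K. f k - 1)" by simp
    moreover have "card K \<le> n" using card_mono[of "{..<n}" K] by (auto simp: K_def)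
    ultimately have "1 + \<eta> / 2 \<le> (\<Prod>k\<in>K. 1 + (f k - 1))"
      using n eta fge by (intro prod_gain) (auto simp: K_def)
    then show ?thesis by (simp add: eta)
  qed
  have "dt n N' = (\<Prod>k\<in>K. f k) * dt n N"
    unfolding K_def using m(1) by (intro dt_row_operation) (auto simp: N'_def K_def)
  also have "\<dots> \<ge> (1 + 1 / (8 * (real n)\<^sup>2)) * (1 + 1 / (8 * (real n)\<^sup>2)) ^ t"
  proof (rule mult_mono[OF gain det])
    have "0 \<le> 1 + 1 / (8 * (real n)\<^sup>2)" by simp
    then show "0 \<le> (\<Prod>k\<in>K. f k)" using gain by linarith
  qed simp
  finally have det': "(1 + 1 / (8 * (real n)\<^sup>2)) ^ Suc t \<le> dt n N'" by simp
  \<comment> \<open>A functional gets negative entries only from demand cuts, whose entries are at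
    least -1. With \<open>Suc t\<close> cuts of weight at most \<open>bv' k\<close> each, no entry
    falls below \<open>- (real (Suc t) * bv' k)\<close>.\<close>
  have rest: "0 \<le> bv' k \<and> (\<forall>j<n. - (real (Suc t) * bv' k) \<le> N' k j) \<and>
      (bv' k > 0 \<longrightarrow> good_query n u ps (bp' k) ((\<Sum>j<n. N' k j * ps j) / bv' k))" if k: "k < n" for k
  proof (cases "k = m")
    case False
    then have bk: "bv' k = bv k * f k" using bv'[OF k] by simp
    have "- (real (Suc t) * bv' k) \<le> N' k j" if j: "j < n" for j
    proof -
      have "f k * (- (real t * bv k)) \<le> f k * N k j" using Nb[OF k j] fpos[OF k] by (intro mult_left_mono) auto
      moreover have "0 \<le> bv k * f k" using bv0[OF k] fpos[OF k] by simp
      ultimately show ?thesis using False by (simp add: N'_def bk algebra_simps)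
    qed
    moreover have "good_query n u ps (bp' k) ((\<Sum>j<n. N' k j * ps j) / bv' k)" if "bv' k > 0"
    proof -
      have "bv k > 0" using that fpos[OF k] by (simp add: bk zero_less_mult_iff)
      from good_query_cong[OF gq[OF k this], of "bp' k"] have "good_query n u ps (bp' k) (lam k / bv k)"
        using bp' k False by (simp add: lam_def)
      then show ?thesis using fpos[OF k] by (simp add: lamk[OF k False] bk)
    qed
    ultimately show ?thesis using bk bv0[OF k] fpos[OF k] by simp
  next
    case True
    define x where "x = bv m * f m"
    have x0: "0 \<le> x" using bv0[OF m(1)] fpos[OF m(1)] by (simp add: x_def)
    have Nlow: "- (real t * x) \<le> (1 - \<eta>) * N m j" if "j < n" for j
    proof -
      have "(1 - \<eta>) * (- (real t * bv m)) \<le> (1 - \<eta>) * N m j" using Nb[OF m(1) that] eta0 by (intro mult_left_mono) auto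
      then show ?thesis by (simp add: x_def fm algebra_simps)
    qed
    show ?thesis
    proof (cases upd)
      case upd': True
      have bm: "bv' m = \<eta> / ak m" using bv'[OF m(1)] upd' by simp
      have "- (real (Suc t) * bv' m) \<le> N' m j" if j: "j < n" for j
      proof -
        have "real t * x \<le> real t * bv' m" using upd(1)[OF upd'] by (intro mult_left_mono) (auto simp: bm x_def)
        moreover have "bv' m * (- 1) \<le> bv' m * a j" using a1[OF j] em by (intro mult_left_mono) (auto simp: bm)
        moreover have "real (Suc t) * bv' m = real t * bv' m + bv' m" by (simp add: distrib_right)
        moreover have "N' m j = (1 - \<eta>) * N m j + bv' m * a j" using N'm[OF j] by (simp add: bm)
        ultimately show ?thesis using Nlow[OF j] by linarith
      qed
      moreover have "good_query n u ps (bp' m) ((\<Sum>j<n. N' m j * ps j) / bv' m)"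
      proof -
        \<comment> \<open>The rest of the functional is nonnegative at \<open>ps\<close>, so the
          excess of the recorded query is at most the value of the whole functional divided by the
          weight of the cut.\<close>
        have "(\<Sum>j<n. a j * ps j) \<le> (\<Sum>j<n. N' m j * ps j) / bv' m"
          unfolding lamm bm using mult_right_mono[OF _ lam0[OF m(1)], of \<eta> 1] eta0 m(3) by (simp add: field_simps)
        from good_query_cong[OF good_query_mono[OF upd(2)[OF upd'] this], of "bp' m"] show ?thesis
          using bp'[OF m(1)] upd' by simp
      qed
      ultimately show ?thesis using True em bm by simp
    next
      case nu: False
      have bm: "bv' m = x" using bv'[OF m(1)] nu by (simp add: x_def)
      have "- (real (Suc t) * bv' m) \<le> N' m j" if j: "j < n" for j
      proof -
        have "- x \<le> \<eta> / ak m * a j"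
        proof (cases "0 \<le> a j")
          case True
          then have "0 \<le> \<eta> / ak m * a j" using em by (intro mult_nonneg_nonneg[of "\<eta> / ak m"]) auto
          then show ?thesis using x0 by linarith
        next
          case False
          then have "\<eta> / ak m \<le> x" using nupd[OF nu] j by (auto simp: x_def)
          moreover have "\<eta> / ak m * (- 1) \<le> \<eta> / ak m * a j" using a1[OF j] em by (intro mult_left_mono) auto
          ultimately show ?thesis by linarith
        qed
        moreover have "real (Suc t) * bv' m = real t * x + x" by (simp add: bm distrib_right)
        ultimately show ?thesis using Nlow[OF j] N'm[OF j] by linarith
      qed
      moreover have "good_query n u ps (bp' m) ((\<Sum>j<n. N' m j * ps j) / bv' m)" if "bv' m > 0"
      proof -
        have b: "bv m > 0" using that fpos[OF m(1)] by (simp add: bm x_def zero_less_mult_iff)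
        have eq: "lam m / bv m = (1 - \<eta>) * lam m / bv' m" using fpos[OF m(1)] by (simp add: bm x_def fm)
        have "0 \<le> \<eta> / ak m * (\<Sum>j<n. a j * ps j)"
          by (rule mult_nonneg_nonneg) (use em aps in auto)
        then have "(1 - \<eta>) * lam m / bv' m \<le> (\<Sum>j<n. N' m j * ps j) / bv' m"
          unfolding lamm using that by (intro divide_right_mono) auto
        then have "lam m / bv m \<le> (\<Sum>j<n. N' m j * ps j) / bv' m" unfolding eq .
        from good_query_cong[OF good_query_mono[OF gq[OF m(1) b, folded lam_def] this], of "bp' m"] show ?thesis
          using bp'[OF m(1)] nu by simp
      qed
      ultimately show ?thesis using True x0 bm by simp
    qed
  qed
  show ?thesis unfolding cone_inv_def cone_functionals_def
    by (intro exI[of _ N'] conjI allI impI) (use id' N1' Nps' det' rest in auto)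
qed

text \<open>With all weights below \<open>W\<close> the functionals are bounded: from below through
  their cuts, from above because every coordinate sums to 1 over the functionals. So the determinant
  cannot grow for long.\<close>

lemma cone_inv_bound:
  assumes inv: "cone_inv n u ps t V bv bp" and W: "\<And>k. k < n \<Longrightarrow> bv k < W" and n: "n > 0"
  shows "(1 + 1 / (8 * (real n)\<^sup>2)) ^ t \<le> fact n * (1 + real n * real t * W) ^ n"
proof -
  from inv obtain N where N: "cone_functionals n u ps t V bv bp N" unfolding cone_inv_def by blast
  then have
    N1: "\<And>j. j < n \<Longrightarrow> (\<Sum>k<n. N k j) = 1" 
    and det: "(1 + 1 / (8 * (real n)\<^sup>2)) ^ t \<le> dt n N"
    and bv0: "\<And>k. k < n \<Longrightarrow> 0 \<le> bv k" and Nb: "\<And>k j. k < n \<Longrightarrow> j < n \<Longrightarrow> - (real t * bv k) \<le> N k j"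
    unfolding cone_functionals_def by simp_all
  have W0: "0 < W" using W[OF n] bv0[OF n] by simp
  have low: "- (real t * W) \<le> N k j" if "k < n" "j < n" for k j
    using Nb[OF that] mult_left_mono[of "bv k" W "real t"] W[OF that(1)] by simp
  have tW: "0 \<le> real t * W" using W0 by simp
  have "\<bar>N k j\<bar> \<le> 1 + real n * real t * W" if kj: "k < n" "j < n" for k j
  proof -
    have "1 = N k j + (\<Sum>l\<in>{..<n} - {k}. N l j)"
      using N1[OF kj(2)] kj(1) sum.remove[of "{..<n}" k "\<lambda>l. N l j"] by simp
    moreover have "(\<Sum>l\<in>{..<n} - {k}. - (real t * W)) \<le> (\<Sum>l\<in>{..<n} - {k}. N l j)"
      using low kj by (intro sum_mono) auto
    moreover have "(\<Sum>l\<in>{..<n} - {k}. - (real t * W)) = - (real (card ({..<n} - {k})) * (real t * W))"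
      by simp
    moreover have "real (card ({..<n} - {k})) * (real t * W) \<le> real n * (real t * W)"
      using tW kj by (intro mult_right_mono) auto
    ultimately have up: "N k j \<le> 1 + real n * real t * W" unfolding mult.assoc by linarith
    have "1 * (real t * W) \<le> real n * (real t * W)" using n tW by (intro mult_right_mono) auto
    then have "- N k j \<le> 1 + real n * real t * W" unfolding mult.assoc using low[OF kj] by linarith
    with up show ?thesis by (rule abs_leI)
  qed
  from dt_bound[of n N, OF this] det show ?thesis by linarith
qed

text \<open>\<open>ps\<close> is a combination of the generators with the nonnegative coefficients
  \<open>lam\<close>. For a demand cut that separates no generator this leaves excess at most 0,
  which makes the centre an acceptable query.\<close>

lemma cone_inv_cut_nonpos:
  assumes inv: "cone_inv n u ps t V bv bp" and cut: "\<And>k. k < n \<Longrightarrow> (\<Sum>j<n. a j * V k j) \<le> 0"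
  shows "(\<Sum>j<n. a j * ps j) \<le> 0"
proof -
  from inv obtain N where N: "cone_functionals n u ps t V bv bp N" unfolding cone_inv_def by blast
  then have id: "\<And>i j. i < n \<Longrightarrow> j < n \<Longrightarrow> (\<Sum>k<n. N k i * V k j) = (if i = j then 1 else 0)"
    and Nps: "\<And>k. k < n \<Longrightarrow> 0 \<le> (\<Sum>j<n. N k j * ps j)"
    unfolding cone_functionals_def by simp_all
  define lam where "lam k = (\<Sum>i<n. N k i * ps i)" for k
  have ps: "ps j = (\<Sum>k<n. lam k * V k j)" if j: "j < n" for j
  proof -
    have "(\<Sum>k<n. lam k * V k j) = (\<Sum>k<n. \<Sum>i<n. ps i * (N k i * V k j))"
      unfolding lam_def sum_distrib_right by (intro sum.cong refl) (simp add: mult_ac)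
    also have "\<dots> = (\<Sum>i<n. ps i * (\<Sum>k<n. N k i * V k j))"
      by (subst sum.swap) (simp add: sum_distrib_left)
    also have "\<dots> = (\<Sum>i<n. if i = j then ps j else 0)" using id[OF _ j] by (intro sum.cong) auto
    finally show ?thesis using j by simp
  qed
  have "(\<Sum>j<n. a j * ps j) = (\<Sum>j<n. \<Sum>k<n. lam k * (a j * V k j))"
    by (intro sum.cong) (auto simp: ps sum_distrib_left mult_ac)
  also have "\<dots> = (\<Sum>k<n. lam k * (\<Sum>j<n. a j * V k j))"
    by (subst sum.swap) (simp add: sum_distrib_left)
  also have "\<dots> \<le> 0"
    using cut Nps unfolding lam_def by (intro sum_nonpos) (simp add: mult_nonneg_nonpos)
  finally show ?thesis .
qed


lemma demand_cut:
  fixes c ps :: "nat \<Rightarrow> real"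
  assumes c: "\<And>j. j < n \<Longrightarrow> c j > 0" and b: "\<And>i. i < n \<Longrightarrow> b i < n"
    and a: "\<And>j. j < n \<Longrightarrow> a j = - 1 + (\<Sum>i<n. if b i = j then c i / c j else 0)"
  shows "(\<Sum>j<n. a j * c j) = 0" "\<And>j. j < n \<Longrightarrow> - 1 \<le> a j"
    "(\<Sum>j<n. a j * ps j) = (\<Sum>i<n. c i * ps (b i) / c (b i)) - (\<Sum>i<n. ps i)"
proof -
  have val: "(\<Sum>j<n. a j * x j) = (\<Sum>i<n. c i * x (b i) / c (b i)) - (\<Sum>i<n. x i)" for x :: "nat \<Rightarrow> real"
  proof -
    have "(\<Sum>j<n. a j * x j) = (\<Sum>j<n. \<Sum>i<n. if b i = j then c i / c j * x j else 0) - (\<Sum>i<n. x i)"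
      by (simp add: a algebra_simps sum_distrib_left sum_subtractf if_distrib cong: if_cong)
    also have "(\<Sum>j<n. \<Sum>i<n. if b i = j then c i / c j * x j else 0) = (\<Sum>i<n. \<Sum>j<n. if j = b i then c i / c (b i) * x (b i) else 0)"
      by (subst sum.swap) (intro sum.cong refl, auto)
    also have "\<dots> = (\<Sum>i<n. c i * x (b i) / c (b i))" using b by (intro sum.cong) auto
    finally show ?thesis .
  qed
  show "(\<Sum>j<n. a j * c j) = 0"
    using c b less_imp_neq[OF c[OF b]] by (simp add: val) 
  show "(\<Sum>j<n. a j * ps j) = (\<Sum>i<n. c i * ps (b i) / c (b i)) - (\<Sum>i<n. ps i)" by (rule val)
  show "- 1 \<le> a j" if "j < n" for j
    using c that by (auto simp: a less_imp_le intro!: sum_nonneg)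
qed

text \<open>The values of the functionals at \<open>ps\<close> are nonnegative and add up to the
  total money, so none exceeds it.\<close>

lemma cone_inv_found:
  assumes inv: "cone_inv n u ps t V bv bp" and k: "k < n" "W \<le> bv k" "0 < W" and q: "\<And>j. j < n \<Longrightarrow> q j = bp k j"
  shows "good_query n u ps q ((\<Sum>j<n. ps j) / W)"
proof -
  from inv obtain N where N: "cone_functionals n u ps t V bv bp N" unfolding cone_inv_def by blast
  then have
    N1: "\<And>j. j < n \<Longrightarrow> (\<Sum>k<n. N k j) = 1" and Nps: "\<And>k. k < n \<Longrightarrow> 0 \<le> (\<Sum>j<n. N k j * ps j)"
    and gq: "\<And>k. k < n \<Longrightarrow> bv k > 0 \<Longrightarrow> good_query n u ps (bp k) ((\<Sum>j<n. N k j * ps j) / bv k)"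
    unfolding cone_functionals_def by simp_all
  have "(\<Sum>j<n. N k j * ps j) \<le> (\<Sum>k<n. \<Sum>j<n. N k j * ps j)"
    using k Nps by (intro member_le_sum[of k _ "\<lambda>k. \<Sum>j<n. N k j * ps j"]) auto
  also have "\<dots> = (\<Sum>j<n. ps j)" by (subst sum.swap) (simp add: sum_distrib_right[symmetric] N1)
  finally have le: "(\<Sum>j<n. N k j * ps j) \<le> (\<Sum>j<n. ps j)" .
  have "0 \<le> (\<Sum>j<n. ps j)" using le Nps[OF k(1)] by linarith
  then have "(\<Sum>j<n. N k j * ps j) / bv k \<le> (\<Sum>j<n. ps j) / W"
    using le k Nps[OF k(1)] by (intro frac_le) auto
  from good_query_mono[OF gq[OF k(1)] this] k have "good_query n u ps (bp k) ((\<Sum>j<n. ps j) / W)" by auto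
  then show ?thesis using q by (rule good_query_cong)
qed

subsection \<open>Cost and correctness of programs\<close>

lemma qmuls_le: "qmuls e \<le> qops e"
  by (induction e) auto

lemma bmuls_le: "bmuls b \<le> bops b"
  by (induction b) (auto intro: add_mono qmuls_le le_SucI)

lemma exec_muls_le: "exec c s k m t \<Longrightarrow> m \<le> k"
proof (induction rule: exec.induct)
  case QSet
  then show ?case using qmuls_le by (simp add: trans_le_add2)
next
  case (CondTrue b s c k m t d)
  then show ?case using bmuls_le[of b] by simp
next
  case (CondFalse b s d k m t c)
  then show ?case using bmuls_le[of b] by simp
next
  case (WhileFalse b s c)
  then show ?case using bmuls_le[of b] by simp
next
  case (WhileTrue b s c k m s' k' m' t)
  then show ?case using bmuls_le[of b] by simp
qed auto

section \<open>Frames, static cost and total correctness\<close>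

primrec iwrites :: "com \<Rightarrow> nat set" where
  "iwrites Skip = {}"
| "iwrites (ISet a e f g) = {a}"
| "iwrites (QSet a e f g) = {}"
| "iwrites (Seq c d) = iwrites c \<union> iwrites d"
| "iwrites (Cond b c d) = iwrites c \<union> iwrites d"
| "iwrites (While b c) = iwrites c"

primrec qwrites :: "com \<Rightarrow> nat set" where
  "qwrites Skip = {}"
| "qwrites (ISet a e f g) = {}"
| "qwrites (QSet a e f g) = {a}"
| "qwrites (Seq c d) = qwrites c \<union> qwrites d"
| "qwrites (Cond b c d) = qwrites c \<union> qwrites d"
| "qwrites (While b c) = qwrites c"

definition framed :: "com \<Rightarrow> state \<Rightarrow> state \<Rightarrow> bool" where
  "framed c s t \<longleftrightarrow> (\<forall>a. a \<notin> iwrites c \<longrightarrow> imem t a = imem s a) \<and> (\<forall>a. a \<notin> qwrites c \<longrightarrow> qmem t a = qmem s a)"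

lemma framed_imem: "framed c s t \<Longrightarrow> a \<notin> iwrites c \<Longrightarrow> imem t a = imem s a"
  by (auto simp: framed_def)

lemma mem_set [simp]:
  "imem (iset a i j v s) = (imem s)(a := (imem s a)(i := (imem s a i)(j := v)))"
  "qmem (iset a i j v s) = qmem s" "imem (qset a i j x s) = imem s"
  "qmem (qset a i j x s) = (qmem s)(a := (qmem s a)(i := (qmem s a i)(j := x)))"
  by (auto simp: iset_def qset_def)

lemma exec_framed: "exec c s k m t \<Longrightarrow> framed c s t"
  by (induction rule: exec.induct) (auto simp: framed_def)


text \<open>Charges both branches of a conditional, and at most \<open>n\<close> rounds plus a final
  test for every loop. It is meant for \<open>For\<close> loops; the outer search loop is counted
  separately.\<close>

primrec cost :: "nat \<Rightarrow> com \<Rightarrow> nat" where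
  "cost n Skip = 0"
| "cost n (ISet a e f g) = iops e + iops f + iops g"
| "cost n (QSet a e f g) = iops e + iops f + qops g"
| "cost n (Seq c d) = cost n c + cost n d"
| "cost n (Cond b c d) = bops b + cost n c + cost n d"
| "cost n (While b c) = Suc n * (bops b + cost n c)"

text \<open>Only the total is bounded: it already meets the bound for multiplications, which are at
  most as many.\<close>

definition runs :: "nat \<Rightarrow> com \<Rightarrow> state \<Rightarrow> (state \<Rightarrow> bool) \<Rightarrow> bool" where
  "runs n c s Q \<longleftrightarrow> (\<exists>k m t. exec c s k m t \<and> k \<le> cost n c \<and> Q t)"

lemma runs_Skip: "Q s \<Longrightarrow> runs n Skip s Q"
  unfolding runs_def by (intro exI conjI, rule exec.Skip) auto

lemma runs_ISet: "Q (iset a (ival e s) (ival f s) (ival g s) s) \<Longrightarrow> runs n (ISet a e f g) s Q"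
  unfolding runs_def by (intro exI conjI, rule exec.ISet) auto

lemma runs_QSet: "Q (qset a (ival e s) (ival f s) (qval g s) s) \<Longrightarrow> runs n (QSet a e f g) s Q"
  unfolding runs_def by (intro exI conjI, rule exec.QSet) auto

lemma runs_Seq: "runs n c s (\<lambda>t. runs n d t Q) \<Longrightarrow> runs n (Seq c d) s Q"
  unfolding runs_def by (fastforce intro: exec.Seq add_mono)

lemma runs_Cond:
  assumes "bval b s \<Longrightarrow> runs n c s Q" "\<not> bval b s \<Longrightarrow> runs n d s Q"
  shows "runs n (Cond b c d) s Q"
proof (cases "bval b s")
  case True
  then obtain k m t where "exec c s k m t" "k \<le> cost n c" "Q t" using assms(1) by (auto simp: runs_def)
  then show ?thesis unfolding runs_def
    using True by (intro exI[of _ "bops b + k"] exI[of _ "bmuls b + m"] exI[of _ t]) (auto intro: exec.CondTrue)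
next
  case False
  then obtain k m t where "exec d s k m t" "k \<le> cost n d" "Q t" using assms(2) by (auto simp: runs_def)
  then show ?thesis unfolding runs_def
    using False by (intro exI[of _ "bops b + k"] exI[of _ "bmuls b + m"] exI[of _ t]) (auto intro: exec.CondFalse)
qed

lemma runs_weaken:
  assumes "runs n c s P" "\<And>t. P t \<Longrightarrow> framed c s t \<Longrightarrow> Q t"
  shows "runs n c s Q"
  using assms exec_framed unfolding runs_def by blast

lemma runs_SeqI:
  assumes "runs n c s P" "\<And>t. P t \<Longrightarrow> framed c s t \<Longrightarrow> runs n d t Q"
  shows "runs n (Seq c d) s Q"
  by (rule runs_Seq, rule runs_weaken[OF assms])

abbreviation "Z \<equiv> IConst 0"
abbreviation "IS v \<equiv> IGet v Z Z"
abbreviation "Q0 a \<equiv> QGet a Z Z"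
abbreviation "Q1 a v \<equiv> QGet a (IS v) Z"
abbreviation "Q2 a v w \<equiv> QGet a (IS v) (IS w)"

definition For :: "nat \<Rightarrow> com \<Rightarrow> com" where
  "For v c = Seq (ISet v Z Z Z) (While (ILess (IS v) (IS 0)) (Seq c (ISet v Z Z (IAdd (IS v) (IConst 1)))))"

lemma iwrites_For [simp]: "iwrites (For v c) = insert v (iwrites c)"
  and qwrites_For [simp]: "qwrites (For v c) = qwrites c"
  and cost_For [simp]: "cost n (For v c) = Suc n * (cost n c + 2)"
  by (auto simp: For_def)

text \<open>The counter is incremented after the body, so \<open>Inv (Suc i)\<close> is demanded of
  the state with the counter already advanced. The frame condition supplies all arrays that the loop
  leaves alone, which keeps invariants short.\<close>

lemma runs_For:
  assumes n: "imem s 0 0 0 = n" and v: "v \<noteq> 0" "v \<notin> iwrites c" "0 \<notin> iwrites c"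
    and init: "Inv 0 (iset v 0 0 0 s)"
    and step: "\<And>i t. i < n \<Longrightarrow> Inv i t \<Longrightarrow> imem t v 0 0 = i \<Longrightarrow> imem t 0 0 0 = n \<Longrightarrow> framed (For v c) s t \<Longrightarrow>
        runs n c t (\<lambda>t'. Inv (Suc i) (iset v 0 0 (Suc i) t'))"
    and fin: "\<And>t. Inv n t \<Longrightarrow> framed (For v c) s t \<Longrightarrow> Q t"
  shows "runs n (For v c) s Q"
proof -
  define b where "b = ILess (IS v) (IS 0)"
  define d where "d = Seq c (ISet v Z Z (IAdd (IS v) (IConst 1)))"
  have loop: "\<exists>k m t'. exec (While b d) t k m t' \<and> k \<le> Suc (n - i) * (bops b + cost n d) \<and> Inv n t' \<and> framed (For v c) s t'"
    if "i \<le> n" "Inv i t" "imem t v 0 0 = i" "framed (For v c) s t" for i t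
    using that
  proof (induction "n - i" arbitrary: i t)
    case 0
    have n0: "imem t 0 0 0 = n" using framed_imem[OF 0(5), of 0] v n by simp
    have "\<not> bval b t" using 0 n0 by (simp add: b_def)
    from exec.WhileFalse[OF this, of d] 0 show ?case by force
  next
    case (Suc x)
    have n0: "imem t 0 0 0 = n" using framed_imem[OF Suc(6), of 0] v n by simp
    have i: "i < n" using Suc by simp
    have b: "bval b t" using i Suc.prems n0 by (simp add: b_def)
    obtain k m t1 where t1: "exec c t k m t1" "k \<le> cost n c" "Inv (Suc i) (iset v 0 0 (Suc i) t1)"
      using step[OF i Suc.prems(2,3) n0 Suc.prems(4)] unfolding runs_def by blast
    define t2 where "t2 = iset v 0 0 (Suc i) t1"
    have fr1: "framed c t t1" using exec_framed[OF t1(1)] .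
    have vi: "imem t1 v 0 0 = i" using framed_imem[OF fr1 v(2)] Suc.prems(3) by simp
    have "exec (ISet v Z Z (IAdd (IS v) (IConst 1))) t1 1 0 t2"
      using exec.ISet[of v Z Z "IAdd (IS v) (IConst 1)" t1] vi by (simp add: t2_def)
    from exec.Seq[OF t1(1) this] have d: "exec d t (k + 1) m t2" by (simp add: d_def)
    have fr2: "framed (For v c) s t2"
      using Suc.prems(4) fr1 by (auto simp: framed_def t2_def)
    have "x = n - Suc i" using Suc.hyps(2) by simp
    from Suc.hyps(1)[OF this _ t1(3)[folded t2_def] _ fr2] i
    obtain k' m' t' where t': "exec (While b d) t2 k' m' t'" "k' \<le> Suc (n - Suc i) * (bops b + cost n d)"
      "Inv n t'" "framed (For v c) s t'" by (auto simp: t2_def)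
    have "exec (While b d) t (bops b + (k + 1) + k') (bmuls b + m + m') t'"
      by (rule exec.WhileTrue[OF b d t'(1)])
    moreover have "bops b + (k + 1) + k' \<le> Suc (n - i) * (bops b + cost n d)"
    proof -
      have "n - i = Suc (n - Suc i)" using i by simp
      moreover have "k + 1 \<le> cost n d" using t1(2) by (simp add: d_def)
      ultimately show ?thesis using t'(2) by simp
    qed
    ultimately show ?case using t'(3,4) by blast
  qed
  have e0: "exec (ISet v Z Z Z) s 0 0 (iset v 0 0 0 s)" using exec.ISet[of v Z Z Z s] by simp
  have "framed (For v c) s (iset v 0 0 0 s)" by (auto simp: framed_def)
  from loop[OF _ init _ this] obtain k m t where t: "exec (While b d) (iset v 0 0 0 s) k m t"
    "k \<le> Suc n * (bops b + cost n d)" "Inv n t" "framed (For v c) s t" by auto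
  have "exec (For v c) s k m t" using exec.Seq[OF e0 t(1)] by (simp add: For_def b_def d_def)
  moreover have "k \<le> cost n (For v c)" using t(2) by (simp add: b_def d_def)
  ultimately show ?thesis using fin[OF t(3,4)] unfolding runs_def by blast
qed

primrec depth :: "com \<Rightarrow> nat" where
  "depth Skip = 0" | "depth (ISet a e f g) = 0" | "depth (QSet a e f g) = 0"
| "depth (Seq c d) = max (depth c) (depth d)" | "depth (Cond b c d) = max (depth c) (depth d)"
| "depth (While b c) = Suc (depth c)"

text \<open>The nesting depth of loops is the degree of the cost polynomial.\<close>

lemma cost_depth: "\<exists>C. \<forall>n. cost n c \<le> C * Suc n ^ depth c"
proof (induction c)
  case (Seq c d)
  then obtain C D where CD: "\<And>n. cost n c \<le> C * Suc n ^ depth c" "\<And>n. cost n d \<le> D * Suc n ^ depth d" by auto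
  have "cost n (Seq c d) \<le> (C + D) * Suc n ^ max (depth c) (depth d)" for n
  proof -
    have "C * Suc n ^ depth c \<le> C * Suc n ^ max (depth c) (depth d)" "D * Suc n ^ depth d \<le> D * Suc n ^ max (depth c) (depth d)"
      by (intro mult_le_mono2 power_increasing; simp)+
    then show ?thesis using CD[of n] unfolding cost.simps distrib_right by linarith
  qed
  then show ?case unfolding depth.simps by blast
next
  case (Cond b c d)
  then obtain C D where CD: "\<And>n. cost n c \<le> C * Suc n ^ depth c" "\<And>n. cost n d \<le> D * Suc n ^ depth d" by auto
  have "cost n (Cond b c d) \<le> (bops b + C + D) * Suc n ^ max (depth c) (depth d)" for n
  proof -
    have "C * Suc n ^ depth c \<le> C * Suc n ^ max (depth c) (depth d)" "D * Suc n ^ depth d \<le> D * Suc n ^ max (depth c) (depth d)"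
      by (intro mult_le_mono2 power_increasing; simp)+
    moreover have "bops b * 1 \<le> bops b * Suc n ^ max (depth c) (depth d)" by (intro mult_le_mono2) simp
    ultimately show ?thesis using CD[of n] unfolding cost.simps distrib_right by linarith
  qed
  then show ?case unfolding depth.simps by blast
next
  case (While b c)
  then obtain C where C: "\<And>n. cost n c \<le> C * Suc n ^ depth c" by auto
  have "cost n (While b c) \<le> (bops b + C) * Suc n ^ Suc (depth c)" for n
  proof -
    have "bops b * 1 \<le> bops b * Suc n ^ depth c" by (intro mult_le_mono2) simp
    then have "bops b + cost n c \<le> (bops b + C) * Suc n ^ depth c" using C[of n] unfolding distrib_right by linarith
    then have "Suc n * (bops b + cost n c) \<le> Suc n * ((bops b + C) * Suc n ^ depth c)" by (rule mult_le_mono2)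
    then show ?thesis unfolding cost.simps power_Suc by (simp only: mult.left_commute)
  qed
  then show ?case unfolding depth.simps by blast
qed (auto intro: exI[of _ "_ + _"])

lemma depth_For [simp]: "depth (For v c) = Suc (depth c)"
  by (simp add: For_def)

subsection \<open>The search program\<close>

abbreviation rq :: "state \<Rightarrow> nat \<Rightarrow> nat \<Rightarrow> nat \<Rightarrow> real" where
  "rq s a i j \<equiv> real_of_rat (qmem s a i j)"

lemmas of_rat_simps = of_rat_add of_rat_diff of_rat_mult of_rat_divide

lemma framed_unfold:
  assumes "framed c s t"
  shows "\<forall>a. a \<notin> iwrites c \<longrightarrow> imem t a = imem s a" "\<forall>a. a \<notin> qwrites c \<longrightarrow> qmem t a = qmem s a"
  using assms by (auto simp: framed_def)

definition SumLoop :: "nat \<Rightarrow> nat \<Rightarrow> iexp \<Rightarrow> qexp \<Rightarrow> com" where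
  "SumLoop v a r e = Seq (QSet a r Z (QConst 0)) (For v (QSet a r Z (QAdd (QGet a r Z) e)))"

lemma SumLoop_writes [simp]: "iwrites (SumLoop v a r e) = {v}" "qwrites (SumLoop v a r e) = {a}"
  by (auto simp: SumLoop_def)

lemma runs_SumLoop:
  assumes n: "imem s 0 0 0 = n" and v: "v \<noteq> 0" and r0: "ival r s = r0"
    and r: "\<And>t. (\<forall>a. a \<noteq> v \<longrightarrow> imem t a = imem s a) \<Longrightarrow> ival r t = r0"
    and e: "\<And>i t. i < n \<Longrightarrow> (\<forall>a. a \<noteq> v \<longrightarrow> imem t a = imem s a) \<Longrightarrow> (\<forall>b. b \<noteq> a \<longrightarrow> qmem t b = qmem s b) \<Longrightarrow>
        (\<forall>x. x \<noteq> r0 \<longrightarrow> qmem t a x = qmem s a x) \<Longrightarrow> imem t v 0 0 = i \<Longrightarrow> real_of_rat (qval e t) = g i"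
  shows "runs n (SumLoop v a r e) s (\<lambda>t. rq t a r0 0 = (\<Sum>i<n. g i) \<and> (\<forall>x. x \<noteq> r0 \<longrightarrow> qmem t a x = qmem s a x))"
proof -
  define s1 where "s1 = qset a r0 0 0 s"
  have "runs n (For v (QSet a r Z (QAdd (QGet a r Z) e))) s1
    (\<lambda>t. rq t a r0 0 = (\<Sum>i<n. g i) \<and> (\<forall>x. x \<noteq> r0 \<longrightarrow> qmem t a x = qmem s a x))"
  proof (rule runs_For[where Inv = "\<lambda>k t. rq t a r0 0 = (\<Sum>i<k. g i) \<and> (\<forall>x. x \<noteq> r0 \<longrightarrow> qmem t a x = qmem s a x)"])
    fix i t
    assume i: "i < n" and I: "rq t a r0 0 = (\<Sum>i<i. g i) \<and> (\<forall>x. x \<noteq> r0 \<longrightarrow> qmem t a x = qmem s a x)"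
      and vi: "imem t v 0 0 = i" and fr: "framed (For v (QSet a r Z (QAdd (QGet a r Z) e))) s1 t"
    have im: "\<forall>b. b \<noteq> v \<longrightarrow> imem t b = imem s b" and qm: "\<forall>b. b \<noteq> a \<longrightarrow> qmem t b = qmem s b"
      using framed_unfold[OF fr] by (auto simp: s1_def)
    show "runs n (QSet a r Z (QAdd (QGet a r Z) e)) t (\<lambda>t'. rq (iset v 0 0 (Suc i) t') a r0 0 = (\<Sum>i<Suc i. g i) \<and>
        (\<forall>x. x \<noteq> r0 \<longrightarrow> qmem (iset v 0 0 (Suc i) t') a x = qmem s a x))"
      by (rule runs_QSet) (use r[OF im] e[OF i im qm _ vi] I in \<open>auto simp: of_rat_simps\<close>)
  qed (use n v in \<open>auto simp: s1_def\<close>)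
  then show ?thesis unfolding SumLoop_def by (intro runs_Seq runs_QSet) (simp add: r0 s1_def)
qed

definition BestLoop :: "nat \<Rightarrow> iexp \<Rightarrow> nat \<Rightarrow> com" where
  "BestLoop a w pr = Seq (ISet a w Z Z) (For 2 (Cond
     (QLess (QMul (QGet 0 (IS 6) (IGet a w Z)) (Q1 pr 2)) (QMul (Q2 0 6 2) (QGet pr (IGet a w Z) Z)))
     (ISet a w Z (IS 2)) Skip))"

lemma BestLoop_writes [simp]: "iwrites (BestLoop a w pr) = {2, a}" "qwrites (BestLoop a w pr) = {}"
  by (auto simp: BestLoop_def)

definition best_at :: "nat \<Rightarrow> (nat \<Rightarrow> nat \<Rightarrow> nat) \<Rightarrow> (nat \<Rightarrow> real) \<Rightarrow> nat \<Rightarrow> nat \<Rightarrow> bool" where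
  "best_at n u q i b \<longleftrightarrow> b < n \<and> (\<forall>j<n. real (u i j) * q b \<le> real (u i b) * q j)"

lemma runs_BestLoop:
  assumes n: "imem s 0 0 0 = n" "0 < n" and a: "a \<notin> {0, 2, 6}" and i: "imem s 6 0 0 = i" "i < n"
    and w0: "\<And>t. (\<forall>b. b \<noteq> 2 \<and> b \<noteq> a \<longrightarrow> imem t b = imem s b) \<Longrightarrow> ival w t = w0"
    and u: "\<And>i j. i < n \<Longrightarrow> j < n \<Longrightarrow> rq s 0 i j = real (u i j)"
    and q: "\<And>j. j < n \<Longrightarrow> rq s pr j 0 = q j" "\<And>j. j < n \<Longrightarrow> q j > 0"
  shows "runs n (BestLoop a w pr) s (\<lambda>t. best_at n u q i (imem t a w0 0) \<and> (\<forall>x. x \<noteq> w0 \<longrightarrow> imem t a x = imem s a x))"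
proof -
  define c where "c = Cond
     (QLess (QMul (QGet 0 (IS 6) (IGet a w Z)) (Q1 pr 2)) (QMul (Q2 0 6 2) (QGet pr (IGet a w Z) Z)))
     (ISet a w Z (IS 2)) Skip"
  define s1 where "s1 = iset a w0 0 0 s"
  define Inv where "Inv k t \<longleftrightarrow> imem t a w0 0 < n \<and> (\<forall>j<k. real (u i j) * q (imem t a w0 0) \<le> real (u i (imem t a w0 0)) * q j) \<and>
       (\<forall>x. x \<noteq> w0 \<longrightarrow> imem t a x = imem s a x)" for k and t :: state
  have ws: "ival w s = w0" by (rule w0) simp
  have "runs n (For 2 c) s1 (\<lambda>t. best_at n u q i (imem t a w0 0) \<and> (\<forall>x. x \<noteq> w0 \<longrightarrow> imem t a x = imem s a x))"
  proof (rule runs_For[where Inv = Inv])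
    fix k t
    assume k: "k < n" and I: "Inv k t" and vk: "imem t 2 0 0 = k" and n0: "imem t 0 0 0 = n" and fr: "framed (For 2 c) s1 t"
    have im: "\<forall>b. b \<noteq> 2 \<and> b \<noteq> a \<longrightarrow> imem t b = imem s b" and qm: "qmem t = qmem s"
      using framed_unfold[OF fr] by (auto simp: s1_def c_def)
    have w: "ival w t = w0" by (rule w0) (use im in auto)
    define b where "b = imem t a w0 0"
    have b: "b < n" "\<And>j. j < k \<Longrightarrow> real (u i j) * q b \<le> real (u i b) * q j" using I by (auto simp: Inv_def b_def)
    have i1: "imem t 6 0 0 = i" using im i a by auto
    have cond: "bval (QLess (QMul (QGet 0 (IS 6) (IGet a w Z)) (Q1 pr 2)) (QMul (Q2 0 6 2) (QGet pr (IGet a w Z) Z))) t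
        \<longleftrightarrow> real (u i b) * q k < real (u i k) * q b"
    proof -
      have "bval (QLess (QMul (QGet 0 (IS 6) (IGet a w Z)) (Q1 pr 2)) (QMul (Q2 0 6 2) (QGet pr (IGet a w Z) Z))) t
        \<longleftrightarrow> real_of_rat (qmem s 0 i b * qmem s pr k 0) < real_of_rat (qmem s 0 i k * qmem s pr b 0)"
        unfolding of_rat_less by (simp add: w i1 vk qm b_def)
      then show ?thesis using u[OF i(2) b(1)] u[OF i(2) k] q(1)[OF k] q(1)[OF b(1)] by (simp add: of_rat_mult)
    qed
    show "runs n c t (\<lambda>t'. Inv (Suc k) (iset 2 0 0 (Suc k) t'))"
      unfolding c_def
    proof (rule runs_Cond, goal_cases)
      case 1
      then have lt: "real (u i b) * q k < real (u i k) * q b" using cond by simp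
      have "real (u i j) * q k \<le> real (u i k) * q j" if "j < Suc k" for j
      proof (cases "j = k")
        case False
        then have j: "j < k" "j < n" using that k by auto
        \<comment> \<open>Transitivity of comparisons in cross-multiplied form: multiply by the
          positive price \<open>q b\<close> and cancel it at the end.\<close>
        have "(real (u i j) * q k) * q b = (real (u i j) * q b) * q k" by simp
        also have "\<dots> \<le> (real (u i b) * q j) * q k" using b(2)[OF j(1)] q(2)[OF k] by (intro mult_right_mono) auto
        also have "\<dots> = (real (u i b) * q k) * q j" by simp
        also have "\<dots> \<le> (real (u i k) * q b) * q j" using lt q(2)[OF j(2)] by (intro mult_right_mono) auto
        also have "\<dots> = (real (u i k) * q j) * q b" by simp
        finally show ?thesis using q(2)[OF b(1)] by simp
      qed simp
      then show ?case using I k a by (intro runs_ISet) (simp add: w vk Inv_def)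
    next
      case 2
      then have "real (u i k) * q b \<le> real (u i b) * q k" using cond by simp
      then show ?case using I a by (intro runs_Skip) (auto simp: Inv_def b_def less_Suc_eq)
    qed
  qed (use n a in \<open>auto simp: s1_def c_def Inv_def best_at_def\<close>)
  then show ?thesis unfolding BestLoop_def c_def[symmetric] by (intro runs_Seq runs_ISet) (simp add: ws s1_def)
qed

primrec qpow :: "qexp \<Rightarrow> nat \<Rightarrow> qexp" where
  "qpow e 0 = QConst 1" | "qpow e (Suc k) = QMul e (qpow e k)"

lemma qval_qpow [simp]: "qval (qpow e k) s = qval e s ^ k"
  by (induction k) auto

text \<open>Use of the index arrays: 0 size \<open>n\<close>; 2-6 loop counters (3 also the state to be eliminated);
  10 best good of each agent at the query that is found; 11 maximiser of a loop; 12 flag that ends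
  the search; 13 index of a nonpositive coordinate of the centre (\<open>n\<close> if there is none); 14 flag of
  the search for a gap.

  Use of the rational arrays: 0 utilities; 1 output; 2 generators of the cone; 3 centre; 4 cut and
  5 its values at the generators; 6 scaling factors; 7 weights and 8 queries of the demand cuts;
  9 query that is found; 10 base, 11 \<open>n\<close>, 12 \<open>H = base ^ n ^ 3\<close>, 13 \<open>H ^ 100\<close>, 14 step
  \<open>1 / (4 n\<^sup>2)\<close>; 15 gap; 16 price ratios; 17 row sum; 18 chain and 19 exit rates of its states;
  20 width \<open>20 n\<^sup>2\<close> of the gap; 21 prices.\<close>

definition init_base :: com where
  "init_base = Seq (QSet 10 Z Z (QConst 2)) (Seq (QSet 11 Z Z (QConst 0)) (For 6
     (Seq (QSet 11 Z Z (QAdd (Q0 11) (QConst 1))) (Seq (QSet 10 Z Z (QAdd (Q0 10) (QConst 1)))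
       (For 2 (QSet 10 Z Z (QAdd (Q0 10) (Q2 0 6 2))))))))"

text \<open>No instruction carries an index into the rational memory, so \<open>n\<close> is counted
  up there anew, in the loop that computes the base.\<close>

lemma runs_init_base:
  assumes n: "imem s 0 0 0 = n" and u: "\<And>i j. i < n \<Longrightarrow> j < n \<Longrightarrow> rq s 0 i j = real (u i j)"
  shows "runs n init_base s (\<lambda>t. rq t 10 0 0 = real (market_base n u) \<and> rq t 11 0 0 = real n)"
  unfolding init_base_def
proof (intro runs_Seq runs_QSet, rule runs_For[where Inv = "\<lambda>i t. rq t 10 0 0 = 2 + real i + (\<Sum>a<i. \<Sum>j<n. real (u a j)) \<and> rq t 11 0 0 = real i"], goal_cases)
  case (6 i t)
  note F = framed_unfold[OF 6(5), simplified]
  show ?case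
  proof (intro runs_Seq runs_QSet, rule runs_For[where Inv = "\<lambda>j t. rq t 10 0 0 = 3 + real i + (\<Sum>a<i. \<Sum>j<n. real (u a j)) + (\<Sum>b<j. real (u i b)) \<and> rq t 11 0 0 = real (Suc i)"], goal_cases)
    case (6 j t')
    note G = framed_unfold[OF 6(5), simplified]
    show ?case
      by (rule runs_QSet) (use 6 G F \<open>i < n\<close> \<open>imem t 6 0 0 = i\<close> u in \<open>simp add: of_rat_simps\<close>)
  qed (use 6 n F in \<open>auto simp: of_rat_simps\<close>)
qed (use n in \<open>auto simp: market_base_def\<close>)

text \<open>Multiplying \<open>n ^ 3\<close> times is cheap enough for the overall bound, so no
  repeated squaring is used.\<close>

definition init_big :: com where
  "init_big = Seq (QSet 12 Z Z (QConst 1)) (For 6 (For 2 (For 3 (QSet 12 Z Z (QMul (Q0 12) (Q0 10))))))"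

lemma runs_init_big:
  assumes n: "imem s 0 0 0 = n" and b: "rq s 10 0 0 = real b"
  shows "runs n init_big s (\<lambda>t. rq t 12 0 0 = real b ^ n ^ 3)"
  unfolding init_big_def
proof (intro runs_Seq runs_QSet, rule runs_For[where Inv = "\<lambda>i t. rq t 12 0 0 = real b ^ (i * n\<^sup>2)"], goal_cases)
  case (6 i t)
  note F = framed_unfold[OF 6(5), simplified]
  show ?case
  proof (rule runs_For[where Inv = "\<lambda>j t. rq t 12 0 0 = real b ^ (i * n\<^sup>2 + j * n)"], goal_cases)
    case (6 j t')
    note G = framed_unfold[OF 6(5), simplified]
    show ?case
    proof (rule runs_For[where Inv = "\<lambda>k t. rq t 12 0 0 = real b ^ (i * n\<^sup>2 + j * n + k)"], goal_cases)
      case (6 k t'')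
      note H = framed_unfold[OF 6(5), simplified]
      show ?case by (rule runs_QSet) (use 6 F G H b in \<open>simp add: of_rat_simps\<close>)
    qed (use 6 n F G in \<open>auto simp: algebra_simps\<close>)
  qed (use 6 n F in \<open>auto simp: algebra_simps power2_eq_square\<close>)
qed (use n in \<open>auto simp: power2_eq_square power3_eq_cube algebra_simps\<close>)

definition initialise :: com where
  "initialise = Seq init_base (Seq init_big (Seq (QSet 13 Z Z (qpow (Q0 12) 100))
     (Seq (QSet 14 Z Z (QDiv (QConst 1) (QMul (QConst 4) (QMul (Q0 11) (Q0 11)))))
     (Seq (QSet 20 Z Z (QMul (QConst 20) (QMul (Q0 11) (Q0 11))))
     (For 6 (QSet 2 (IS 6) (IS 6) (QConst 1)))))))"

definition constants_ok :: "nat \<Rightarrow> (nat \<Rightarrow> nat \<Rightarrow> nat) \<Rightarrow> state \<Rightarrow> bool" where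
  "constants_ok n u s \<longleftrightarrow> imem s 0 0 0 = n \<and> (\<forall>i<n. \<forall>j<n. rq s 0 i j = real (u i j)) \<and>
     rq s 12 0 0 = real (market_big n u) \<and> rq s 13 0 0 = real (market_big n u) ^ 100 \<and>
     rq s 14 0 0 = 1 / (4 * (real n)\<^sup>2) \<and> rq s 20 0 0 = 20 * real (n\<^sup>2)"

lemma runs_initialise:
  assumes n: "imem s 0 0 0 = n" and u: "\<And>i j. i < n \<Longrightarrow> j < n \<Longrightarrow> rq s 0 i j = real (u i j)"
    and V: "\<And>k j. rq s 2 k j = 0"
  shows "runs n initialise s (\<lambda>t. constants_ok n u t \<and> (\<forall>k<n. \<forall>j<n. rq t 2 k j = (if k = j then 1 else 0)))"
  unfolding initialise_def
proof (rule runs_SeqI[OF runs_init_base[OF n u]], goal_cases)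
  case (3 t)
  note F = framed_unfold[OF 3(2), unfolded init_base_def, simplified]
  have n1: "imem t 0 0 0 = n" using F n by simp
  from 3(1) have b: "rq t 10 0 0 = real (market_base n u)" "rq t 11 0 0 = real n" by auto
  show ?case
  proof (rule runs_SeqI[OF runs_init_big[OF n1 b(1)]], goal_cases)
    case (1 t1)
    note G = framed_unfold[OF 1(2), unfolded init_big_def, simplified]
    show ?case
    proof (intro runs_Seq runs_QSet, rule runs_For[where Inv = "\<lambda>i t. \<forall>k j. rq t 2 k j = (if k = j \<and> k < i then 1 else 0)"], goal_cases)
      case (6 i t2)
      then show ?case by (intro runs_QSet) auto
    next
      case (7 t2)
      note H = framed_unfold[OF 7(2), simplified]
      show ?case using 7(1) H G F n u b 1(1)
        by (auto simp: constants_ok_def of_rat_simps of_rat_power market_big_def power2_eq_square)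
    qed (use n1 G F V in auto)
  qed
qed auto

section \<open>One iteration of the search\<close>

definition center :: com where
  "center = For 2 (SumLoop 3 3 (IS 2) (Q2 2 3 2))"

lemma runs_center:
  assumes n: "imem s 0 0 0 = n"
  shows "runs n center s (\<lambda>t. \<forall>j<n. rq t 3 j 0 = (\<Sum>k<n. rq s 2 k j))"
  unfolding center_def
proof (rule runs_For[where Inv = "\<lambda>i t. \<forall>j<i. rq t 3 j 0 = (\<Sum>k<n. rq s 2 k j)"], goal_cases)
  case (6 i t)
  note F = framed_unfold[OF 6(5), simplified]
  show ?case
    by (rule runs_weaken[OF runs_SumLoop[where n = n and g = "\<lambda>k. rq s 2 k i" and ?r0.0 = i]])
      (use 6 F in \<open>auto simp: less_Suc_eq\<close>)
qed (use n in auto)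

definition find_nonpos :: com where
  "find_nonpos = Seq (ISet 13 Z Z (IS 0)) (For 2 (Cond (BNot (QLess (QConst 0) (Q1 3 2))) (ISet 13 Z Z (IS 2)) Skip))"

lemma runs_find_nonpos:
  assumes n: "imem s 0 0 0 = n"
  shows "runs n find_nonpos s (\<lambda>t. (imem t 13 0 0 < n \<and> rq s 3 (imem t 13 0 0) 0 \<le> 0) \<or>
    (imem t 13 0 0 = n \<and> (\<forall>j<n. 0 < rq s 3 j 0)))"
  unfolding find_nonpos_def
proof (intro runs_Seq runs_ISet, rule runs_For[where Inv = "\<lambda>i t. (imem t 13 0 0 < n \<and> rq s 3 (imem t 13 0 0) 0 \<le> 0) \<or>
    (imem t 13 0 0 = n \<and> (\<forall>j<i. 0 < rq s 3 j 0))"], goal_cases)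
  case (6 i t)
  note F = framed_unfold[OF 6(5), simplified]
  show ?case
    by (intro runs_Cond runs_ISet runs_Skip) (use 6 F in \<open>auto simp: less_Suc_eq not_less\<close>)
qed (use n in auto)

definition demand :: com where
  "demand = Seq (For 2 (QSet 4 (IS 2) Z (QConst (- 1)))) (For 6 (Seq (BestLoop 11 Z 3)
     (QSet 4 (IS 11) Z (QAdd (QGet 4 (IS 11) Z) (QDiv (Q1 3 6) (QGet 3 (IS 11) Z))))))"

lemma runs_demand:
  assumes n: "imem s 0 0 0 = n" "0 < n" and u: "\<And>i j. i < n \<Longrightarrow> j < n \<Longrightarrow> rq s 0 i j = real (u i j)"
    and c: "\<And>j. j < n \<Longrightarrow> rq s 3 j 0 = c j" "\<And>j. j < n \<Longrightarrow> c j > 0"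
  shows "runs n demand s (\<lambda>t. \<exists>b. (\<forall>i<n. best_at n u c i (b i)) \<and>
    (\<forall>j<n. rq t 4 j 0 = - 1 + (\<Sum>i<n. if b i = j then c i / c j else 0)))"
  unfolding demand_def
proof (rule runs_SeqI[where P = "\<lambda>t. \<forall>j<n. rq t 4 j 0 = - 1"], goal_cases)
  case 1
  show ?case
  proof (rule runs_For[where Inv = "\<lambda>i t. \<forall>j<i. rq t 4 j 0 = - 1"], goal_cases)
    case (6 i t)
    then show ?case by (intro runs_QSet) (auto simp: less_Suc_eq of_rat_minus)
  qed (use n in auto)
next
  case (2 s1)
  note F1 = framed_unfold[OF 2(2), simplified]
  show ?case
  proof (rule runs_For[where Inv = "\<lambda>k t. \<exists>b. (\<forall>i<k. best_at n u c i (b i)) \<and>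
    (\<forall>j<n. rq t 4 j 0 = - 1 + (\<Sum>i<k. if b i = j then c i / c j else 0))"], goal_cases)
    case (6 i t)
    note F = framed_unfold[OF 6(5), simplified]
    from 6(2) obtain b where b: "\<forall>i'<i. best_at n u c i' (b i')"
      "\<forall>j<n. rq t 4 j 0 = - 1 + (\<Sum>i'<i. if b i' = j then c i' / c j else 0)" by blast
    show ?case
    proof (rule runs_SeqI[OF runs_BestLoop[where n = n and u = u and q = c and i = i and ?w0.0 = 0]], goal_cases)
      case (10 t1)
      note G = framed_unfold[OF 10(2), simplified]
      define x where "x = imem t1 11 0 0"
      have x: "best_at n u c i x" "x < n" using 10(1) by (auto simp: x_def best_at_def)
      have i6: "imem t1 6 0 0 = i" using G 6 by simp
      have qm: "qmem t1 = qmem t" using G by auto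
      have c3: "rq t 3 i 0 = c i" "rq t 3 x 0 = c x" using F F1 c(1) 6(1) x(2) by auto
      have sm: "(\<Sum>i'<i. if (b(i := x)) i' = j then c i' / c j else 0) = (\<Sum>i'<i. if b i' = j then c i' / c j else 0)" for j
        by (intro sum.cong) auto
      show ?case
      proof (rule runs_QSet, rule exI[of _ "b(i := x)"], intro conjI allI impI, goal_cases)
        case (1 i')
        then show ?case using b(1) x(1) by (auto simp: less_Suc_eq)
      next
        case (2 j)
        have "rq t 4 j 0 = - 1 + (\<Sum>i'<i. if b i' = j then c i' / c j else 0)" using b(2) 2 by simp
        then show ?case using c3 by (auto simp: x_def[symmetric] i6 qm sm of_rat_simps)
      qed
    qed (use 6 F F1 n u c in \<open>auto\<close>)
  qed (use n F1 2(1) in auto)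
qed

definition cut :: com where
  "cut = Seq find_nonpos (Cond (ILess (IS 13) (IS 0))
     (Seq (For 2 (QSet 4 (IS 2) Z (QConst 0))) (QSet 4 (IS 13) Z (QConst 1))) demand)"

text \<open>The cones may stick out of the positive orthant, and demand is defined only inside it. A
  nonpositive coordinate of the centre then serves as the cut, which is valid as equilibrium prices
  are positive; \<open>g\<close> is this coordinate, or \<open>n\<close> for a demand cut.\<close>

definition cut_spec :: "nat \<Rightarrow> (nat \<Rightarrow> nat \<Rightarrow> nat) \<Rightarrow> (nat \<Rightarrow> real) \<Rightarrow> nat \<Rightarrow> (nat \<Rightarrow> real) \<Rightarrow> bool" where
  "cut_spec n u c g a \<longleftrightarrow> (if g < n then c g \<le> 0 \<and> (\<forall>j<n. a j = (if j = g then 1 else 0))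
     else (\<forall>j<n. c j > 0) \<and> (\<exists>b. (\<forall>i<n. best_at n u c i (b i)) \<and>
       (\<forall>j<n. a j = - 1 + (\<Sum>i<n. if b i = j then c i / c j else 0))))"

lemma cut_writes [simp]: "iwrites cut = {2, 6, 11, 13}" "qwrites cut = {4}"
  by (auto simp: cut_def find_nonpos_def demand_def)

lemma runs_cut:
  assumes n: "imem s 0 0 0 = n" "0 < n" and u: "\<And>i j. i < n \<Longrightarrow> j < n \<Longrightarrow> rq s 0 i j = real (u i j)"
    and c: "\<And>j. j < n \<Longrightarrow> rq s 3 j 0 = c j"
  shows "runs n cut s (\<lambda>t. cut_spec n u c (imem t 13 0 0) (\<lambda>j. rq t 4 j 0))"
  unfolding cut_def
proof (rule runs_SeqI[OF runs_find_nonpos[OF n(1)]], goal_cases)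
  case (1 t)
  note F = framed_unfold[OF 1(2), unfolded find_nonpos_def, simplified]
  show ?case
  proof (rule runs_Cond, goal_cases)
    case 1
    then have g: "imem t 13 0 0 < n" using F n by simp
    show ?case
    proof (intro runs_Seq, rule runs_For[where Inv = "\<lambda>i t. \<forall>j<i. rq t 4 j 0 = 0"], goal_cases)
      case (6 i t')
      then show ?case by (intro runs_QSet) (auto simp: less_Suc_eq)
    next
      case (7 t')
      note G = framed_unfold[OF 7(2), simplified]
      show ?case
        by (rule runs_QSet) (use 7(1) G g \<open>_ \<or> _\<close> c in \<open>auto simp: cut_spec_def\<close>)
    qed (use F n in auto)
  next
    case 2
    then have g: "\<not> imem t 13 0 0 < n" using F n by simp
    with 1(1) have pos: "\<And>j. j < n \<Longrightarrow> 0 < c j" using c by auto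
    have "runs n demand t (\<lambda>t. \<exists>b. (\<forall>i<n. best_at n u c i (b i)) \<and>
      (\<forall>j<n. rq t 4 j 0 = - 1 + (\<Sum>i<n. if b i = j then c i / c j else 0)))"
      by (rule runs_demand) (use F n u c pos in auto)
    then show ?case
    proof (rule runs_weaken, goal_cases)
      case (1 t')
      have "imem t' 13 = imem t 13" using framed_unfold[OF 1(2), unfolded demand_def, simplified] by simp
      then show ?case using 1(1) g pos by (simp add: cut_spec_def)
    qed
  qed
qed

definition cut_values :: com where
  "cut_values = Seq (For 3 (SumLoop 2 5 (IS 3) (QMul (Q1 4 2) (Q2 2 3 2))))
     (Seq (ISet 11 Z Z Z) (For 3 (Cond (QLess (QGet 5 (IS 11) Z) (Q1 5 3)) (ISet 11 Z Z (IS 3)) Skip)))"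

lemma cut_values_writes [simp]: "iwrites cut_values = {2, 3, 11}" "qwrites cut_values = {5}"
  by (auto simp: cut_values_def)

lemma runs_cut_values:
  assumes n: "imem s 0 0 0 = n" "0 < n"
  shows "runs n cut_values s (\<lambda>t. (\<forall>k<n. rq t 5 k 0 = (\<Sum>j<n. rq s 4 j 0 * rq s 2 k j)) \<and>
     imem t 11 0 0 < n \<and> (\<forall>k<n. rq t 5 k 0 \<le> rq t 5 (imem t 11 0 0) 0))"
  unfolding cut_values_def
proof (rule runs_SeqI[where P = "\<lambda>t. \<forall>k<n. rq t 5 k 0 = (\<Sum>j<n. rq s 4 j 0 * rq s 2 k j)"], goal_cases)
  case 1
  show ?case
  proof (rule runs_For[where Inv = "\<lambda>i t. \<forall>k<i. rq t 5 k 0 = (\<Sum>j<n. rq s 4 j 0 * rq s 2 k j)"], goal_cases)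
    case (6 i t)
    note F = framed_unfold[OF 6(5), simplified]
    show ?case
      by (rule runs_weaken[OF runs_SumLoop[where n = n and g = "\<lambda>j. rq s 4 j 0 * rq s 2 i j" and ?r0.0 = i]])
        (use 6 F in \<open>auto simp: less_Suc_eq of_rat_simps\<close>)
  qed (use n in auto)
next
  case (2 t)
  note F = framed_unfold[OF 2(2), simplified]
  show ?case
  proof (intro runs_Seq runs_ISet, rule runs_For[where Inv = "\<lambda>i t'. imem t' 11 0 0 < n \<and> (\<forall>k<i. rq t 5 k 0 \<le> rq t 5 (imem t' 11 0 0) 0)"], goal_cases)
    case (6 i t')
    note G = framed_unfold[OF 6(5), simplified]
    have qm: "qmem t' = qmem t" using G by auto
    show ?case
    proof (rule runs_Cond, goal_cases)
      case 1
      then have "rq t 5 (imem t' 11 0 0) 0 < rq t 5 i 0" using 6 by (simp add: qm of_rat_less)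
      then show ?case using 6 by (intro runs_ISet) (force simp: less_Suc_eq)
    next
      case 2
      then have "rq t 5 i 0 \<le> rq t 5 (imem t' 11 0 0) 0" using 6 by (simp add: qm of_rat_less_eq)
      then show ?case using 6 by (intro runs_Skip) (auto simp: less_Suc_eq)
    qed
  next
    case (7 t')
    note G = framed_unfold[OF 7(2), simplified]
    have qm: "qmem t' = qmem t" using G by auto
    show ?case unfolding qm using 7(1) 2(1) by blast
  qed (use F n in auto)
qed

definition rescale :: com where
  "rescale = Seq (For 3 (QSet 6 (IS 3) Z (QSub (QConst 1) (QDiv (QMul (Q0 14) (Q1 5 3)) (QGet 5 (IS 11) Z)))))
     (Seq (For 3 (For 2 (QSet 2 (IS 3) (IS 2) (QDiv (QAdd (Q2 2 3 2) (QMul (QSub (Q1 6 3) (QConst 1)) (QGet 2 (IS 11) (IS 2)))) (Q1 6 3)))))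
     (For 3 (QSet 7 (IS 3) Z (QMul (Q1 7 3) (Q1 6 3)))))"

lemma rescale_writes [simp]: "iwrites rescale = {2, 3}" "qwrites rescale = {2, 6, 7}"
  by (auto simp: rescale_def)

lemma runs_rescale:
  assumes n: "imem s 0 0 0 = n" and m: "imem s 11 0 0 = m" "m < n"
    and f: "\<And>k. k < n \<Longrightarrow> f k = 1 - rq s 14 0 0 * rq s 5 k 0 / rq s 5 m 0" and fm: "f m \<noteq> 0"
  shows "runs n rescale s (\<lambda>t. (\<forall>k<n. \<forall>j<n. rq t 2 k j = (rq s 2 k j + (f k - 1) * rq s 2 m j) / f k) \<and>
      (\<forall>k<n. rq t 7 k 0 = rq s 7 k 0 * f k))"
  unfolding rescale_def
proof (rule runs_SeqI[where P = "\<lambda>t. \<forall>k<n. rq t 6 k 0 = f k"], goal_cases)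
  case 1
  show ?case
  proof (rule runs_For[where Inv = "\<lambda>i t. \<forall>k<i. rq t 6 k 0 = f k"], goal_cases)
    case (6 i t)
    note F = framed_unfold[OF 6(5), simplified]
    show ?case by (rule runs_QSet) (use 6 F m f[of i] in \<open>auto simp: less_Suc_eq of_rat_simps\<close>)
  qed (use n in auto)
next
  case (2 t)
  note F = framed_unfold[OF 2(2), simplified]
  define V' where "V' k j = (rq s 2 k j + (f k - 1) * rq s 2 m j) / f k" for k j
  \<comment> \<open>Row \<open>m\<close> is a fixed point of the update, so the generators can be
    updated in place although every row reads row \<open>m\<close>.\<close>
  have Vm: "V' m j = rq s 2 m j" for j using fm by (simp add: V'_def field_simps)
  show ?case
  proof (rule runs_SeqI[where P = "\<lambda>t. \<forall>k<n. \<forall>j<n. rq t 2 k j = V' k j"], goal_cases)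
    case 1
    show ?case
    proof (rule runs_For[where Inv = "\<lambda>i t. \<forall>k<n. \<forall>j<n. rq t 2 k j = (if k < i then V' k j else rq s 2 k j)"], goal_cases)
      case (6 i t')
      note G = framed_unfold[OF 6(5), simplified]
      show ?case
      proof (rule runs_For[where Inv = "\<lambda>l t. \<forall>k<n. \<forall>j<n. rq t 2 k j = (if k < i \<or> (k = i \<and> j < l) then V' k j else rq s 2 k j)"], goal_cases)
        case (6 l t'')
        note H = framed_unfold[OF 6(5), simplified]
        have i3: "imem t'' 3 0 0 = i" "imem t'' 11 0 0 = m" using H G F m \<open>imem t' 3 0 0 = i\<close> by auto
        have f6: "rq t'' 6 i 0 = f i" using H G 2(1) \<open>i < n\<close> by simp
        have vm: "rq t'' 2 m l = rq s 2 m l" using 6(1,2) m(2) Vm by simp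
        have vi: "rq t'' 2 i l = rq s 2 i l" using 6(1,2) \<open>i < n\<close> by simp
        show ?case
          by (rule runs_QSet) (use 6(2,3) i3 f6 vm vi in \<open>auto simp: V'_def of_rat_simps less_Suc_eq\<close>)
      qed (use 6 G n F in \<open>auto simp: less_Suc_eq\<close>)
    qed (use n F in auto)
  next
    case (2 t1)
    note G = framed_unfold[OF 2(2), simplified]
    show ?case
    proof (rule runs_For[where Inv = "\<lambda>i t. \<forall>k<n. rq t 7 k 0 = (if k < i then rq s 7 k 0 * f k else rq s 7 k 0)"], goal_cases)
      case (6 i t')
      note H = framed_unfold[OF 6(5), simplified]
      have "rq t' 6 i 0 = f i" using H G 6(1) \<open>\<forall>k<n. rq t 6 k 0 = f k\<close> by simp
      then show ?case by (intro runs_QSet) (use 6 in \<open>auto simp: of_rat_simps less_Suc_eq\<close>)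
    next
      case (7 t')
      note H = framed_unfold[OF 7(2), simplified]
      show ?case using 7(1) 2(1) H by (simp add: V'_def)
    qed (use n F G in auto)
  qed
qed

definition record_query :: com where
  "record_query = Cond (BAnd (BNot (ILess (IS 13) (IS 0))) (QLess (QGet 7 (IS 11) Z) (QDiv (Q0 14) (QGet 5 (IS 11) Z))))
     (Seq (QSet 7 (IS 11) Z (QDiv (Q0 14) (QGet 5 (IS 11) Z))) (For 2 (QSet 8 (IS 11) (IS 2) (Q1 3 2)))) Skip"

lemma record_query_writes [simp]: "iwrites record_query = {2}" "qwrites record_query = {7, 8}"
  by (auto simp: record_query_def)

lemma runs_record_query:
  assumes n: "imem s 0 0 0 = n" and m: "imem s 11 0 0 = m" "m < n"
    and upd: "upd \<longleftrightarrow> \<not> imem s 13 0 0 < n \<and> rq s 7 m 0 < rq s 14 0 0 / rq s 5 m 0"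
  shows "runs n record_query s (\<lambda>t. (\<forall>k<n. rq t 7 k 0 = (if upd \<and> k = m then rq s 14 0 0 / rq s 5 m 0 else rq s 7 k 0)) \<and>
      (\<forall>k<n. \<forall>j<n. rq t 8 k j = (if upd \<and> k = m then rq s 3 j 0 else rq s 8 k j)))"
proof -
  have c: "bval (BAnd (BNot (ILess (IS 13) (IS 0))) (QLess (QGet 7 (IS 11) Z) (QDiv (Q0 14) (QGet 5 (IS 11) Z)))) s \<longleftrightarrow> upd"
    unfolding upd of_rat_divide[symmetric] of_rat_less using n m by simp
  show ?thesis
    unfolding record_query_def
  proof (rule runs_Cond, goal_cases)
    case 1
    then have upd unfolding c .
    show ?case
    proof (intro runs_Seq runs_QSet, rule runs_For[where Inv = "\<lambda>i t. (\<forall>k<n. rq t 7 k 0 = (if k = m then rq s 14 0 0 / rq s 5 m 0 else rq s 7 k 0)) \<and>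
      (\<forall>k<n. \<forall>j<n. rq t 8 k j = (if k = m \<and> j < i then rq s 3 j 0 else rq s 8 k j))"], goal_cases)
      case (6 i t)
      note F = framed_unfold[OF 6(5), simplified]
      have "qmem t 8 m j = qmem s 3 j 0" if "j < i" for j
      proof -
        have "rq t 8 m j = rq s 3 j 0" using 6(1,2) m(2) that by simp
        then show ?thesis by simp
      qed
      then show ?case by (intro runs_QSet) (use 6 F m in \<open>auto simp: less_Suc_eq\<close>)
    qed (use n m \<open>upd\<close> in \<open>auto simp: of_rat_simps\<close>)
  next
    case 2
    then have "\<not> upd" unfolding c .
    then show ?case by (intro runs_Skip) simp
  qed
qed

definition check_found :: com where
  "check_found = For 3 (Cond (BNot (QLess (Q1 7 3) (Q0 13)))
     (Seq (ISet 12 Z Z (IConst 1)) (For 2 (QSet 9 (IS 2) Z (Q2 8 3 2)))) Skip)"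

lemma check_found_writes [simp]: "iwrites check_found = {2, 3, 12}" "qwrites check_found = {9}"
  by (auto simp: check_found_def)

lemma runs_check_found:
  assumes n: "imem s 0 0 0 = n" and z: "imem s 12 0 0 = 0"
  shows "runs n check_found s (\<lambda>t. (imem t 12 0 0 = 0 \<and> (\<forall>k<n. rq s 7 k 0 < rq s 13 0 0)) \<or>
    (imem t 12 0 0 \<noteq> 0 \<and> (\<exists>k<n. rq s 13 0 0 \<le> rq s 7 k 0 \<and> (\<forall>j<n. rq t 9 j 0 = rq s 8 k j))))"
  unfolding check_found_def
proof (rule runs_For[where Inv = "\<lambda>i t. (imem t 12 0 0 = 0 \<and> (\<forall>k<i. rq s 7 k 0 < rq s 13 0 0)) \<or>
    (imem t 12 0 0 \<noteq> 0 \<and> (\<exists>k<n. rq s 13 0 0 \<le> rq s 7 k 0 \<and> (\<forall>j<n. rq t 9 j 0 = rq s 8 k j)))"], goal_cases)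
  case (6 i t)
  note F = framed_unfold[OF 6(5), simplified]
  show ?case
  proof (rule runs_Cond, goal_cases)
    case 1
    then have W: "rq s 13 0 0 \<le> rq s 7 i 0" using 6 F by (simp add: of_rat_less_eq)
    show ?case
    proof (intro runs_Seq runs_ISet, rule runs_For[where Inv = "\<lambda>l t. \<forall>j<l. rq t 9 j 0 = rq s 8 i j"], goal_cases)
      case (6 l t')
      note G = framed_unfold[OF 6(5), simplified]
      show ?case by (rule runs_QSet) (use 6 F G \<open>imem t 3 0 0 = i\<close> in \<open>auto simp: less_Suc_eq\<close>)
    next
      case (7 t')
      note G = framed_unfold[OF 7(2), simplified]
      show ?case using 7(1) G W \<open>i < n\<close> by auto
    qed (use n F in auto)
  next
    case 2
    then have W: "rq s 7 i 0 < rq s 13 0 0" using 6 F by (simp add: of_rat_less)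
    then show ?case using 6 by (intro runs_Skip) (auto simp: less_Suc_eq)
  qed
qed (use n z in auto)

definition update :: com where
  "update = Seq rescale (Seq record_query check_found)"

definition accept_center :: com where
  "accept_center = Seq (ISet 12 Z Z (IConst 1)) (For 2 (QSet 9 (IS 2) Z (Q1 3 2)))"

definition iterate :: com where
  "iterate = Seq center (Seq cut (Seq cut_values (Cond (QLess (QConst 0) (QGet 5 (IS 11) Z)) update accept_center)))"

lemma iterate_writes [simp]: "iwrites iterate = {2, 3, 6, 11, 12, 13}" "qwrites iterate = {2, 3, 4, 5, 6, 7, 8, 9}"
  by (auto simp: iterate_def center_def update_def accept_center_def)

lemma runs_accept_center:
  assumes n: "imem s 0 0 0 = n"
  shows "runs n accept_center s (\<lambda>t. imem t 12 0 0 \<noteq> 0 \<and> (\<forall>j<n. rq t 9 j 0 = rq s 3 j 0))"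
  unfolding accept_center_def
proof (intro runs_Seq runs_ISet, rule runs_For[where Inv = "\<lambda>i t. \<forall>j<i. rq t 9 j 0 = rq s 3 j 0"], goal_cases)
  case (6 i t)
  note F = framed_unfold[OF 6(5), simplified]
  show ?case by (rule runs_QSet) (use 6 F in \<open>auto simp: less_Suc_eq\<close>)
next
  case (7 t)
  then show ?case using framed_unfold[OF 7(2), simplified] by simp
qed (use n in auto)

definition search :: com where
  "search = While (ILess (IS 12) (IConst 1)) iterate"

lemma cone_inv_cong:
  assumes "cone_inv n u ps t V bv bp" and "\<And>k j. k < n \<Longrightarrow> j < n \<Longrightarrow> V' k j = V k j"
    "\<And>k. k < n \<Longrightarrow> bv' k = bv k" "\<And>k j. k < n \<Longrightarrow> j < n \<Longrightarrow> bp' k j = bp k j"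
  shows "cone_inv n u ps t V' bv' bp'"
proof -
  from assms(1) obtain N where N: "cone_functionals n u ps t V bv bp N" unfolding cone_inv_def by blast
  have "(\<Sum>k<n. N k i * V' k j) = (\<Sum>k<n. N k i * V k j)" if "j < n" for i j
    using assms(2) that by (intro sum.cong) auto
  moreover have "good_query n u ps (bp' k) e" if "good_query n u ps (bp k) e" "k < n" for k e
    by (rule good_query_cong[OF that(1)]) (use assms(4) that in auto)
  ultimately have "cone_functionals n u ps t V' bv' bp' N"
    using N assms(3) unfolding cone_functionals_def by simp
  then show ?thesis unfolding cone_inv_def by blast
qed

section \<open>Correctness and length of the search\<close>

locale market_flow =
  fixes n :: nat and u F :: "nat \<Rightarrow> nat \<Rightarrow> nat" and ps :: "nat \<Rightarrow> real"
  assumes market: "exchange_market n u" and flow: "eqflow n u (\<lambda>i j. real (F i j))"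
    and ps: "\<And>i. ps i = (\<Sum>j<n. real (F i j))"
begin

lemma n_pos: "n > 0"
  using market by (simp add: exchange_market_def)

lemma ps_pos: "i < n \<Longrightarrow> ps i > 0"
  using flow by (simp add: eqflow_def ps)

lemma cut_spec_facts:
  assumes "cut_spec n u c g a"
  shows "(\<Sum>j<n. a j * c j) \<le> 0" "0 \<le> (\<Sum>j<n. a j * ps j)" "\<And>j. j < n \<Longrightarrow> - 1 \<le> a j"
    "g < n \<Longrightarrow> (\<forall>j<n. 0 \<le> a j) \<and> 0 < (\<Sum>j<n. a j * ps j)"
    "\<not> g < n \<Longrightarrow> good_query n u ps c (\<Sum>j<n. a j * ps j)"
proof -
  have *: "(\<Sum>j<n. a j * c j) \<le> 0 \<and> 0 \<le> (\<Sum>j<n. a j * ps j) \<and> (\<forall>j<n. - 1 \<le> a j) \<and>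
    (g < n \<longrightarrow> (\<forall>j<n. 0 \<le> a j) \<and> 0 < (\<Sum>j<n. a j * ps j)) \<and>
    (\<not> g < n \<longrightarrow> good_query n u ps c (\<Sum>j<n. a j * ps j))"
  proof (cases "g < n")
    case True
    have a: "a j = (if j = g then 1 else 0)" if "j < n" for j using assms(1) True that by (simp add: cut_spec_def)
    have v: "(\<Sum>j<n. a j * x j) = x g" for x :: "nat \<Rightarrow> real"
    proof -
      have "(\<Sum>j<n. a j * x j) = (\<Sum>j<n. if j = g then x g else 0)" by (intro sum.cong) (auto simp: a)
      then show ?thesis using True by simp
    qed
    show ?thesis using v[of c] v[of ps] a assms(1) ps_pos[OF True] True by (simp add: cut_spec_def)
  next
    case False
    then obtain b where c: "\<And>j. j < n \<Longrightarrow> c j > 0" and b: "\<And>i. i < n \<Longrightarrow> best_at n u c i (b i)"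
      and a: "\<And>j. j < n \<Longrightarrow> a j = - 1 + (\<Sum>i<n. if b i = j then c i / c j else 0)"
      using assms(1) by (auto simp: cut_spec_def)
    have b1: "b i < n" if "i < n" for i using b[OF that] by (simp add: best_at_def)
    have b2: "real (u i j) * c (b i) \<le> real (u i (b i)) * c j" if "i < n" "j < n" for i j
      using b[OF that(1)] that by (simp add: best_at_def)
    note d = demand_cut[of n c b a, OF c b1 a]
    have ex: "(\<Sum>i<n. ps i) \<le> (\<Sum>i<n. c i * ps (b i) / c (b i))"
      by (rule demand_excess_nonneg[OF flow ps c b1 b2 market])
    have "good_query n u ps c (\<Sum>j<n. a j * ps j)"
      unfolding good_query_def using c b1 b2 d(3)[of ps] by (intro conjI allI impI exI[of _ b]) auto
    then show ?thesis using d(1,2) d(3)[of ps] ex False by simp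
  qed
  show "(\<Sum>j<n. a j * c j) \<le> 0" "0 \<le> (\<Sum>j<n. a j * ps j)" "\<And>j. j < n \<Longrightarrow> - 1 \<le> a j"
    "g < n \<Longrightarrow> (\<forall>j<n. 0 \<le> a j) \<and> 0 < (\<Sum>j<n. a j * ps j)"
    "\<not> g < n \<Longrightarrow> good_query n u ps c (\<Sum>j<n. a j * ps j)"
    using * by blast+
qed

definition weight :: real where
  "weight = real (market_big n u) ^ 100"

lemma weight_pos: "weight > 0"
  using market_base_facts(1)[OF market] by (simp add: weight_def market_big_def)

definition loop_inv :: "nat \<Rightarrow> state \<Rightarrow> bool" where
  "loop_inv t s \<longleftrightarrow> constants_ok n u s \<and> imem s 12 0 0 = 0 \<and>
     cone_inv n u ps t (\<lambda>k j. rq s 2 k j) (\<lambda>k. rq s 7 k 0) (\<lambda>k j. rq s 8 k j) \<and> (\<forall>k<n. rq s 7 k 0 < weight)"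

definition found :: "state \<Rightarrow> bool" where
  "found s \<longleftrightarrow> constants_ok n u s \<and> imem s 12 0 0 \<noteq> 0 \<and> good_query n u ps (\<lambda>j. rq s 9 j 0) ((\<Sum>j<n. ps j) / weight)"

lemma constants_framed:
  assumes "constants_ok n u s" "framed c s t" "0 \<notin> iwrites c" "{0, 12, 13, 14, 20} \<inter> qwrites c = {}"
  shows "constants_ok n u t"
  using assms by (auto simp: constants_ok_def framed_def)

lemma runs_update:
  assumes inv: "cone_inv n u ps t V bv bp" and C: "constants_ok n u s" and z: "imem s 12 0 0 = 0"
    and V: "V = (\<lambda>k j. rq s 2 k j)" and bv: "bv = (\<lambda>k. rq s 7 k 0)" and bp: "bp = (\<lambda>k j. rq s 8 k j)"
    and c: "\<And>j. j < n \<Longrightarrow> c j = (\<Sum>k<n. V k j)" "\<And>j. j < n \<Longrightarrow> rq s 3 j 0 = c j"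
    and cs: "cut_spec n u c (imem s 13 0 0) a" 
    and ak: "\<And>k. k < n \<Longrightarrow> rq s 5 k 0 = (\<Sum>j<n. a j * V k j)"
    and m: "imem s 11 0 0 = m" "m < n" "\<And>k. k < n \<Longrightarrow> rq s 5 k 0 \<le> rq s 5 m 0" "rq s 5 m 0 > 0"
  shows "runs n update s (\<lambda>s'. loop_inv (Suc t) s' \<or> found s')"
  unfolding update_def
proof -
  define eta where "eta = 1 / (4 * (real n)\<^sup>2)"
  define f where "f k = 1 - eta * rq s 5 k 0 / rq s 5 m 0" for k
  define V' where "V' k j = (V k j + (f k - 1) * V m j) / f k" for k j
  define g where "g = imem s 13 0 0"
  define upd where "upd \<longleftrightarrow> \<not> g < n \<and> bv m * f m < eta / rq s 5 m 0"
  define bv' where "bv' k = (if upd \<and> k = m then eta / rq s 5 m 0 else bv k * f k)" for k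
  define bp' where "bp' k j = (if upd \<and> k = m then c j else bp k j)" for k j
  note cf = cut_spec_facts[OF cs[folded g_def]]
  have Cs: "imem s 0 0 0 = n" "rq s 14 0 0 = eta" "rq s 13 0 0 = weight"
    using C by (auto simp: constants_ok_def eta_def weight_def)
  have eta: "0 < eta" "eta \<le> 1 / 4" using n_pos by (auto simp: eta_def divide_simps)
  have fm: "f m \<noteq> 0" using m(4) eta by (simp add: f_def)
  have step: "cone_inv n u ps (Suc t) V' bv' bp'"
  proof (rule cone_step[OF inv n_pos eta_def ak m(2,3,4) c(1) cf(1,2,3) f_def V'_def bv'_def bp'_def])
    show "upd \<Longrightarrow> bv m * f m \<le> eta / rq s 5 m 0" by (simp add: upd_def)
    show "upd \<Longrightarrow> good_query n u ps c (\<Sum>j<n. a j * ps j)" using cf(5) by (simp add: upd_def)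
    show "\<not> upd \<Longrightarrow> (\<forall>j<n. 0 \<le> a j) \<or> eta / rq s 5 m 0 \<le> bv m * f m" using cf(4) by (auto simp: upd_def)
  qed assumption+
  show "runs n (Seq rescale (Seq record_query check_found)) s (\<lambda>s'. loop_inv (Suc t) s' \<or> found s')"
  proof (rule runs_SeqI[OF runs_rescale[OF Cs(1) m(1,2), of f]], goal_cases)
    case (3 s1)
    note F1 = framed_unfold[OF 3(2), simplified]
    have s1: "rq s1 2 k j = V' k j" "rq s1 7 k 0 = bv k * f k" if "k < n" "j < n" for k j
      using 3(1) that by (auto simp: V'_def V bv)
    have Cs1: "imem s1 0 0 0 = n" "imem s1 11 0 0 = m" "imem s1 13 0 0 = g" "rq s1 14 0 0 = eta" "rq s1 13 0 0 = weight"
      "qmem s1 5 = qmem s 5" "qmem s1 3 = qmem s 3" "qmem s1 8 = qmem s 8" "imem s1 12 0 0 = 0"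
      using F1 Cs m(1) z by (auto simp: g_def)
    have upd1: "upd \<longleftrightarrow> \<not> imem s1 13 0 0 < n \<and> rq s1 7 m 0 < rq s1 14 0 0 / rq s1 5 m 0"
      using s1(2)[OF m(2) m(2)] Cs1 by (simp add: upd_def)
    show ?case
    proof (rule runs_SeqI[OF runs_record_query[OF Cs1(1,2) m(2) upd1]], goal_cases)
      case (1 s2)
      note F2 = framed_unfold[OF 1(2), simplified]
      have s2: "rq s2 7 k 0 = bv' k" if "k < n" for k
        using 1(1) that s1 Cs1 by (simp add: bv'_def)
      have s2b: "rq s2 8 k j = bp' k j" if "k < n" "j < n" for k j
        using 1(1) that Cs1 c(2) by (simp add: bp'_def bp)
      have Cs2: "imem s2 0 0 0 = n" "imem s2 12 0 0 = 0" "rq s2 13 0 0 = weight" "qmem s2 2 = qmem s1 2"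
        using F2 Cs1 by auto
      show ?case
      proof (rule runs_weaken[OF runs_check_found[OF Cs2(1,2)]], goal_cases)
        case (1 s3)
        note F3 = framed_unfold[OF 1(2), simplified]
        have C3: "constants_ok n u s3"
          using C F1 F2 F3 by (simp add: constants_ok_def)
        have q3: "qmem s3 2 = qmem s1 2" "qmem s3 7 = qmem s2 7" "qmem s3 8 = qmem s2 8" using F3 Cs2 by auto
        from 1(1) show ?case
        proof (elim disjE, goal_cases)
          case 1
          have "cone_inv n u ps (Suc t) (\<lambda>k j. rq s3 2 k j) (\<lambda>k. rq s3 7 k 0) (\<lambda>k j. rq s3 8 k j)"
            by (rule cone_inv_cong[OF step]) (auto simp: q3 s1 s2 s2b)
          then show ?case using 1 C3 q3 Cs2 by (simp add: loop_inv_def)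
        next
          case 2
          then obtain k where k: "k < n" "weight \<le> bv' k" "\<And>j. j < n \<Longrightarrow> rq s3 9 j 0 = bp' k j"
            using s2 s2b Cs2 by auto
          from cone_inv_found[OF step k(1,2) weight_pos k(3)] show ?case
            using 2 C3 by (simp add: found_def)
        qed
      qed
    qed
  qed (use fm Cs in \<open>auto simp: f_def\<close>)
qed

lemma runs_iterate:
  assumes "loop_inv t s"
  shows "runs n iterate s (\<lambda>s'. loop_inv (Suc t) s' \<or> found s')"
  unfolding iterate_def
proof -
  define V where "V k j = rq s 2 k j" for k j
  define c where "c j = (\<Sum>k<n. V k j)" for j
  from assms have C: "constants_ok n u s" and z: "imem s 12 0 0 = 0"
    and inv: "cone_inv n u ps t (\<lambda>k j. rq s 2 k j) (\<lambda>k. rq s 7 k 0) (\<lambda>k j. rq s 8 k j)"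
    by (auto simp: loop_inv_def)
  have n0: "imem s 0 0 0 = n" and u0: "\<And>i j. i < n \<Longrightarrow> j < n \<Longrightarrow> rq s 0 i j = real (u i j)" using C by (auto simp: constants_ok_def)
  show "runs n (Seq center (Seq cut (Seq cut_values (Cond (QLess (QConst 0) (QGet 5 (IS 11) Z)) update accept_center)))) s
     (\<lambda>s'. loop_inv (Suc t) s' \<or> found s')"
  proof (rule runs_SeqI[OF runs_center[OF n0]], goal_cases)
    case (1 s1)
    note F1 = framed_unfold[OF 1(2), unfolded center_def, simplified]
    have n1: "imem s1 0 0 0 = n" and u1: "\<And>i j. i < n \<Longrightarrow> j < n \<Longrightarrow> rq s1 0 i j = real (u i j)"
      and c1: "\<And>j. j < n \<Longrightarrow> rq s1 3 j 0 = c j" using F1 n0 u0 1(1) by (auto simp: c_def V_def)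
    show ?case
    proof (rule runs_SeqI[OF runs_cut[OF n1 n_pos u1 c1]], goal_cases)
      case (4 s2)
      note F2 = framed_unfold[OF 4(2), simplified]
      have n2: "imem s2 0 0 0 = n" using F2 n1 by simp
      define a where "a j = rq s2 4 j 0" for j
      show ?case
      proof (rule runs_SeqI[OF runs_cut_values[OF n2 n_pos]], goal_cases)
        case (1 s3)
        note F3 = framed_unfold[OF 1(2), simplified]
        define m where "m = imem s3 11 0 0"
        have q3: "qmem s3 2 = qmem s 2" "qmem s3 7 = qmem s 7" "qmem s3 8 = qmem s 8" "qmem s3 3 = qmem s1 3"
          "imem s3 13 = imem s2 13" using F1 F2 F3 by auto
        have C3: "constants_ok n u s3" using C F1 F2 F3 by (simp add: constants_ok_def)
        have n3: "imem s3 0 0 0 = n" using C3 by (simp add: constants_ok_def)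
        have z3: "imem s3 12 0 0 = 0" using z F1 F2 F3 by simp
        have cs: "cut_spec n u c (imem s3 13 0 0) a" using 4(1) q3 by (simp add: a_def[abs_def])
        have q22: "qmem s2 2 = qmem s 2" using F1 F2 by auto
        have ak: "rq s3 5 k 0 = (\<Sum>j<n. a j * V k j)" if "k < n" for k
          using 1(1) that q22 by (simp add: a_def V_def)
        have m: "m < n" "\<And>k. k < n \<Longrightarrow> rq s3 5 k 0 \<le> rq s3 5 m 0" using 1(1) by (auto simp: m_def)
        show ?case
        proof (rule runs_Cond, goal_cases)
          case 1
          then have pos: "rq s3 5 m 0 > 0" by (simp add: m_def)
          show ?case
            by (rule runs_update[OF inv C3 z3, of c a m])
              (use q3 c1 cs ak m pos in \<open>auto simp: m_def V_def c_def\<close>)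
        next
          case 2
          then have neg: "rq s3 5 m 0 \<le> 0" by (simp add: m_def not_less)
          \<comment> \<open>No generator is cut off, hence the cut is nonpositive at
            \<open>ps\<close>. A coordinate cut would be positive there, so this is a demand cut
            with excess at most 0, and the centre is accepted.\<close>
          have ak0: "(\<Sum>j<n. a j * rq s 2 k j) \<le> 0" if "k < n" for k using ak[OF that] m(2)[OF that] neg unfolding V_def by linarith
          have aps: "(\<Sum>j<n. a j * ps j) \<le> 0" by (rule cone_inv_cut_nonpos[OF inv ak0])
          note cf = cut_spec_facts[OF cs]
          have g: "\<not> imem s3 13 0 0 < n" using cf(4) aps by auto
          have "0 \<le> (\<Sum>j<n. ps j) / weight" using ps_pos weight_pos by (intro divide_nonneg_pos sum_nonneg) (auto intro: less_imp_le)
          with aps have "(\<Sum>j<n. a j * ps j) \<le> (\<Sum>j<n. ps j) / weight" by linarith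
          then have gq: "good_query n u ps c ((\<Sum>j<n. ps j) / weight)"
            by (rule good_query_mono[OF cf(5)[OF g]])
          show ?case
          proof (rule runs_weaken[OF runs_accept_center[OF n3]], goal_cases)
            case (1 s4)
            have "constants_ok n u s4"
              by (rule constants_framed[OF C3 1(2)]) (auto simp: accept_center_def)
            moreover have "good_query n u ps (\<lambda>j. rq s4 9 j 0) ((\<Sum>j<n. ps j) / weight)"
              by (rule good_query_cong[OF gq]) (use 1(1) q3 c1 in auto)
            ultimately show ?case using 1(1) by (simp add: found_def)
          qed
        qed
      qed
    qed auto
  qed
qed

text \<open>Logarithms in \<open>cone_inv_bound\<close> give
  \<open>t / (16 n^2) <= n * (3 l + 100 n^3 l + ln t)\<close>: the \<open>n^3\<close> is the
  exponent in \<open>market_big\<close>, a factor \<open>n\<close> comes from the size of the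
  determinant and \<open>n^2\<close> from its growth rate. The term \<open>ln t\<close> is absorbed
  afterwards.\<close>

lemma iteration_bound:
  assumes "loop_inv t s"
  shows "real t \<le> 4000 * real n ^ 6 * ln (real (market_base n u))"
proof (cases "t = 0")
  case True
  then show ?thesis using market_base_facts(1)[OF market] by simp
next
  case False
  define b where "b = real (market_base n u)"
  define l where "l = ln b"
  note facts = market_base_facts[OF market]
  have n1: "1 \<le> real n" using n_pos by simp
  have b4: "b \<ge> 4" "real n \<le> b" using facts(1,2) by (auto simp: b_def)
  have W: "weight = b ^ (100 * n ^ 3)" by (simp add: weight_def market_big_def b_def power_mult[symmetric] mult.commute)
  have ie: "(1 + 1 / (8 * (real n)\<^sup>2)) ^ t \<le> fact n * (1 + real n * real t * weight) ^ n"
    using assms n_pos by (intro cone_inv_bound) (auto simp: loop_inv_def)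
  define x where "x = 1 / (8 * (real n)\<^sup>2)"
  have x: "0 < x" "x \<le> 1"
  proof -
    show "0 < x" using n_pos by (simp add: x_def)
    have "1 \<le> (real n)\<^sup>2" using n1 by (rule one_le_power)
    then have "1 \<le> 8 * (real n)\<^sup>2" by linarith
    then show "x \<le> 1" unfolding x_def by (rule divide_le_eq_1_pos[THEN iffD2, rotated]) (use n_pos in simp)
  qed
  have lx: "x / 2 \<le> ln (1 + x)"
  proof -
    have "- ln (1 + x) \<le> 1 / (1 + x) - 1"
      using ln_le_minus_one[of "1 / (1 + x)"] x by (simp add: ln_div)
    moreover have "1 / (1 + x) - 1 \<le> - (x / 2)" using x by (simp add: field_simps)
    ultimately show ?thesis by linarith
  qed
  have t1: "1 \<le> real t" using False by simp
  have ln_n: "ln (real n) \<le> l" using b4 n1 by (simp add: l_def)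
  have l1: "1 \<le> l"
  proof -
    have "exp 1 \<le> b" using exp_le b4 by linarith
    then show ?thesis using b4 by (simp add: l_def ln_ge_iff)
  qed
  have "1 + real n * real t * weight \<le> b\<^sup>2 * real t * weight"
  proof -
    have w1: "1 \<le> weight" unfolding W using b4 by simp
    have "1 * 1 \<le> real n * real t * weight" using n1 t1 w1 by (metis mult_mono mult_1 zero_le_one order_trans mult.commute)
    then have "1 + real n * real t * weight \<le> (2 * real n) * real t * weight" by simp
    also have "\<dots> \<le> b\<^sup>2 * real t * weight"
      using b4 w1 by (intro mult_right_mono) (auto simp: power2_eq_square intro!: mult_mono)
    finally show ?thesis .
  qed
  then have "ln (1 + real n * real t * weight) \<le> ln (b\<^sup>2 * real t * weight)"
  proof (subst ln_le_cancel_iff)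
    show "0 < 1 + real n * real t * weight" using weight_pos by (intro add_pos_nonneg) auto
    show "0 < b\<^sup>2 * real t * weight" using b4 t1 weight_pos by (intro mult_pos_pos) auto
  qed
  also have "\<dots> = 2 * l + ln (real t) + 100 * real n ^ 3 * l"
    using b4 t1 by (simp add: W ln_mult ln_realpow l_def)
  finally have lr: "ln (1 + real n * real t * weight) \<le> 2 * l + ln (real t) + 100 * real n ^ 3 * l" .
  have "real t * (x / 2) \<le> real t * ln (1 + x)" using lx by (intro mult_left_mono) auto
  also have "\<dots> = ln ((1 + x) ^ t)" using x by (simp add: ln_realpow)
  also have "\<dots> \<le> ln (fact n * (1 + real n * real t * weight) ^ n)"
    using ie x weight_pos by (subst ln_le_cancel_iff) (auto simp: x_def intro!: mult_pos_pos zero_less_power add_pos_nonneg)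
  also have "\<dots> = ln (fact n) + real n * ln (1 + real n * real t * weight)"
  proof -
    have "0 < 1 + real n * real t * weight" using weight_pos by (intro add_pos_nonneg) auto
    then show ?thesis by (simp add: ln_mult ln_realpow)
  qed
  also have "ln (fact n :: real) \<le> real n * l"
  proof -
    have "(fact n :: real) \<le> real n ^ n" using fact_le_power[of n, where 'a = real] by simp
    then have "ln (fact n :: real) \<le> ln (real n ^ n)" using n1 by (subst ln_le_cancel_iff) auto
    also have "\<dots> \<le> real n * l" using n1 ln_n by (simp add: ln_realpow)
    finally show ?thesis .
  qed
  finally have "real t * (x / 2) \<le> real n * l + real n * (2 * l + ln (real t) + 100 * real n ^ 3 * l)"
    using mult_left_mono[OF lr, of "real n"] by linarith
  then have le: "(real t * (x / 2)) * (16 * (real n)\<^sup>2) \<le> (real n * l + real n * (2 * l + ln (real t) + 100 * real n ^ 3 * l)) * (16 * (real n)\<^sup>2)"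
    by (intro mult_right_mono) auto
  have "real t = (real t * (x / 2)) * (16 * (real n)\<^sup>2)" using n1 by (simp add: x_def)
  also note le
  also have "(real n * l + real n * (2 * l + ln (real t) + 100 * real n ^ 3 * l)) * (16 * (real n)\<^sup>2) =
      16 * real n ^ 3 * (3 * l + 100 * real n ^ 3 * l + ln (real t))"
    by (simp add: power2_eq_square power3_eq_cube algebra_simps)
  finally have tb: "real t \<le> 16 * real n ^ 3 * (3 * l + 100 * real n ^ 3 * l + ln (real t))" .
  \<comment> \<open>In \<open>ln t <= ln K + t / K\<close> this \<open>K\<close> turns the term
    \<open>16 * n^3 * ln t\<close> into at most \<open>t / 2\<close> plus a term without
    \<open>t\<close>.\<close>
  define K where "K = 32 * real n ^ 3"
  have n3: "1 \<le> real n ^ 3" using n1 by simp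
  have K: "K > 0" using n_pos by (simp add: K_def)
  have "ln (real t) \<le> ln K + real t / K"
    using ln_le_minus_one[of "real t / K"] t1 K by (simp add: ln_div)
  moreover have "ln K \<le> 6 * l"
  proof -
    have "ln (32 :: real) \<le> ln (b ^ 3)"
      using power_mono[of 4 b 3] b4 by (subst ln_le_cancel_iff) auto
    moreover have "ln K = ln 32 + 3 * ln (real n)" using n1 by (simp add: K_def ln_mult ln_realpow)
    moreover have "ln (b ^ 3) = 3 * l" using b4 by (simp add: ln_realpow l_def)
    ultimately show ?thesis using ln_n by linarith
  qed
  ultimately have "3 * l + 100 * real n ^ 3 * l + ln (real t) \<le> 9 * l + 100 * real n ^ 3 * l + real t / K" by linarith
  moreover have "9 * l \<le> 9 * (real n ^ 3 * l)" using mult_right_mono[OF n3, of l] l1 by simp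
  ultimately have "3 * l + 100 * real n ^ 3 * l + ln (real t) \<le> 109 * (real n ^ 3 * l) + real t / K" by linarith
  then have "16 * real n ^ 3 * (3 * l + 100 * real n ^ 3 * l + ln (real t)) \<le> 16 * real n ^ 3 * (109 * (real n ^ 3 * l) + real t / K)"
    by (intro mult_left_mono) auto
  also have "\<dots> = 1744 * (real n ^ 6 * l) + real t / 2"
  proof -
    have "16 * real n ^ 3 * (real t / K) = real t / 2" using n_pos by (simp add: K_def)
    moreover have "16 * real n ^ 3 * (109 * (real n ^ 3 * l)) = 1744 * (real n ^ 6 * l)" by (simp flip: power_add)
    ultimately show ?thesis by (simp add: distrib_left)
  qed
  finally have "real t \<le> 3488 * (real n ^ 6 * l)" using tb by linarith
  also have "\<dots> \<le> 4000 * (real n ^ 6 * l)" using l1 by (intro mult_right_mono) auto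
  finally show ?thesis by (simp add: l_def b_def mult.assoc)
qed

text \<open>The bound on \<open>t\<close> also proves termination: past \<open>T\<close> iterations
  the invariant is contradictory, so the search has succeeded by then.\<close>

lemma exec_search:
  assumes "loop_inv 0 s"
  shows "\<exists>k m s'. exec search s k m s' \<and> found s' \<and>
    real k \<le> (4000 * real n ^ 6 * ln (real (market_base n u)) + 3) * real (1 + cost n iterate)"
proof -
  define T where "T = nat \<lfloor>4000 * real n ^ 6 * ln (real (market_base n u))\<rfloor>"
  have T: "t \<le> T" if "loop_inv t s" for t s
    using iteration_bound[OF that] by (simp add: T_def le_nat_floor)
  have main: "\<exists>k m s'. exec search s k m s' \<and> found s' \<and> k \<le> (Suc T - t) * (1 + cost n iterate) + 1" if "loop_inv t s" for t s
    using that
  proof (induction "Suc T - t" arbitrary: t s)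
    case 0
    then show ?case using T[OF 0(2)] by simp
  next
    case (Suc x)
    have b: "bval (ILess (IS 12) (IConst 1)) s" using Suc.prems by (simp add: loop_inv_def)
    obtain k m s1 where s1: "exec iterate s k m s1" "k \<le> cost n iterate" "loop_inv (Suc t) s1 \<or> found s1"
      using runs_iterate[OF Suc.prems] by (auto simp: runs_def)
    have t: "Suc T - t = Suc (Suc T - Suc t)" using T[OF Suc.prems] by simp
    have "\<exists>k m s'. exec search s1 k m s' \<and> found s' \<and> k \<le> (Suc T - Suc t) * (1 + cost n iterate) + 1"
      using s1(3)
    proof
      assume l: "loop_inv (Suc t) s1"
      show ?thesis by (rule Suc.hyps(1)[OF _ l]) (use Suc.hyps(2) in simp)
    next
      assume f: "found s1"
      then have "\<not> bval (ILess (IS 12) (IConst 1)) s1" by (simp add: found_def)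
      from exec.WhileFalse[OF this, of iterate] f show ?thesis unfolding search_def
        by (intro exI[of _ 1] exI[of _ 0] exI[of _ s1]) auto
    qed
    then obtain k' m' s' where s': "exec search s1 k' m' s'" "found s'" "k' \<le> (Suc T - Suc t) * (1 + cost n iterate) + 1" by blast
    have "exec search s (bops (ILess (IS 12) (IConst 1)) + k + k') (bmuls (ILess (IS 12) (IConst 1)) + m + m') s'"
      unfolding search_def by (rule exec.WhileTrue[OF b s1(1) s'(1)[unfolded search_def]])
    moreover have "bops (ILess (IS 12) (IConst 1)) + k + k' \<le> (Suc T - t) * (1 + cost n iterate) + 1"
      unfolding t using s1(2) s'(3) by simp
    ultimately show ?case using s'(2) by blast
  qed
  from main[OF assms] obtain k m s' where k: "exec search s k m s'" "found s'" "k \<le> Suc T * (1 + cost n iterate) + 1" by auto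
  have l0: "0 \<le> 4000 * real n ^ 6 * ln (real (market_base n u))" using market_base_facts(1)[OF market] by simp
  have "k \<le> (T + 2) * (1 + cost n iterate)" using k(3) by (simp add: algebra_simps)
  then have "real k \<le> real ((T + 2) * (1 + cost n iterate))" by (rule of_nat_mono)
  also have "\<dots> = (real T + 2) * real (1 + cost n iterate)" by (simp only: of_nat_mult of_nat_add of_nat_numeral)
  also have "\<dots> \<le> (4000 * real n ^ 6 * ln (real (market_base n u)) + 3) * real (1 + cost n iterate)"
  proof (rule mult_right_mono)
    have "real T \<le> 4000 * real n ^ 6 * ln (real (market_base n u))" unfolding T_def using l0 by (rule of_nat_floor)
    then show "real T + 2 \<le> 4000 * real n ^ 6 * ln (real (market_base n u)) + 3" by simp
  qed simp
  finally show ?thesis using k(1,2) by blast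
qed

end

subsection \<open>The rounding program\<close>

definition best_goods :: com where
  "best_goods = For 6 (BestLoop 10 (IS 6) 9)"

lemma best_goods_writes [simp]: "iwrites best_goods = {2, 6, 10}" "qwrites best_goods = {}"
  by (auto simp: best_goods_def)

lemma runs_best_goods:
  assumes n: "imem s 0 0 0 = n" "0 < n" and u: "\<And>i j. i < n \<Longrightarrow> j < n \<Longrightarrow> rq s 0 i j = real (u i j)"
    and q: "\<And>j. j < n \<Longrightarrow> rq s 9 j 0 = q j" "\<And>j. j < n \<Longrightarrow> q j > 0"
  shows "runs n best_goods s (\<lambda>t. \<forall>i<n. best_at n u q i (imem t 10 i 0))"
  unfolding best_goods_def
proof (rule runs_For[where Inv = "\<lambda>k t. \<forall>i<k. best_at n u q i (imem t 10 i 0)"], goal_cases)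
  case (6 i t)
  note F = framed_unfold[OF 6(5), simplified]
  show ?case
    by (rule runs_weaken[OF runs_BestLoop[where n = n and u = u and q = q and i = i and ?w0.0 = i]])
      (use 6 F n u q in \<open>auto simp: less_Suc_eq\<close>)
qed (use n in auto)

definition edge_lhs :: qexp where
  "edge_lhs = QMul (Q2 0 6 2) (QGet 9 (IGet 10 (IS 6) Z) Z)"

definition edge_rhs :: qexp where
  "edge_rhs = QMul (QGet 0 (IS 6) (IGet 10 (IS 6) Z)) (Q1 9 2)"

definition scaled :: "qexp \<Rightarrow> qexp" where
  "scaled d = QMul (QAdd (QConst 1) d) edge_lhs"

text \<open>The tolerance is widened only if some edge lies between \<open>d\<close> and
  \<open>20 n^2 * d\<close>, and that edge then becomes near. So \<open>n^2\<close> rounds suffice,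
  and two nested \<open>For\<close> loops replace an unbounded search. The factor is the one that
  \<open>stationary_equilibrium\<close> demands of the gap.\<close>

definition find_gap :: com where
  "find_gap = Seq (QSet 15 Z Z (QDiv (QConst 1) (qpow (Q0 12) 40))) (For 4 (For 5 (Seq (ISet 14 Z Z Z)
     (Seq (For 6 (For 2 (Cond (BAnd (QLess (scaled (Q0 15)) edge_rhs) (BNot (QLess (scaled (QMul (Q0 20) (Q0 15))) edge_rhs)))
        (ISet 14 Z Z (IConst 1)) Skip)))
     (Cond (ILess Z (IS 14)) (QSet 15 Z Z (QMul (Q0 20) (Q0 15))) Skip)))))"

lemma find_gap_writes [simp]: "iwrites find_gap = {2, 4, 5, 6, 14}" "qwrites find_gap = {15}"
  by (auto simp: find_gap_def)

definition gapfree :: "nat \<Rightarrow> (nat \<Rightarrow> nat \<Rightarrow> real) \<Rightarrow> (nat \<Rightarrow> nat \<Rightarrow> real) \<Rightarrow> real \<Rightarrow> real \<Rightarrow> bool" where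
  "gapfree n x y M d \<longleftrightarrow> (\<forall>i<n. \<forall>j<n. \<not> ((1 + d) * x i j < y i j \<and> y i j \<le> (1 + M * d) * x i j))"

definition near_edges :: "nat \<Rightarrow> (nat \<Rightarrow> nat \<Rightarrow> real) \<Rightarrow> (nat \<Rightarrow> nat \<Rightarrow> real) \<Rightarrow> real \<Rightarrow> (nat \<times> nat) set" where
  "near_edges n x y d = {(i, j) \<in> {..<n} \<times> {..<n}. y i j \<le> (1 + d) * x i j}"

lemma near_edges_grow:
  assumes "\<not> gapfree n x y M d" "\<And>i j. i < n \<Longrightarrow> j < n \<Longrightarrow> 0 \<le> x i j" "1 \<le> M" "0 \<le> d"
  shows "card (near_edges n x y d) < card (near_edges n x y (M * d))"
proof (rule psubset_card_mono)
  show "finite (near_edges n x y (M * d))"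
    by (rule finite_subset[of _ "{..<n} \<times> {..<n}"]) (auto simp: near_edges_def)
  have "d \<le> M * d" using mult_right_mono[of 1 M d] assms by simp
  then have "(1 + d) * x i j \<le> (1 + M * d) * x i j" if "i < n" "j < n" for i j
    using assms(2)[OF that] by (intro mult_right_mono) auto
  then have "near_edges n x y d \<subseteq> near_edges n x y (M * d)"
    unfolding near_edges_def by fastforce
  moreover obtain i j where "i < n" "j < n" "(1 + d) * x i j < y i j" "y i j \<le> (1 + M * d) * x i j"
    using assms(1) by (auto simp: gapfree_def)
  then have "(i, j) \<in> near_edges n x y (M * d) - near_edges n x y d" by (auto simp: near_edges_def)
  ultimately show "near_edges n x y d \<subset> near_edges n x y (M * d)" by blast
qed

lemma runs_find_gap:
  assumes n: "imem s 0 0 0 = n" and h: "rq s 12 0 0 = h" and M: "rq s 20 0 0 = M" "1 \<le> M" and h0: "0 < h"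
    and x: "\<And>i j. i < n \<Longrightarrow> j < n \<Longrightarrow> x i j = rq s 0 i j * rq s 9 (imem s 10 i 0) 0"
    and y: "\<And>i j. i < n \<Longrightarrow> j < n \<Longrightarrow> y i j = rq s 0 i (imem s 10 i 0) * rq s 9 j 0"
    and x0: "\<And>i j. i < n \<Longrightarrow> j < n \<Longrightarrow> 0 \<le> x i j"
  shows "runs n find_gap s (\<lambda>t. gapfree n x y M (rq t 15 0 0) \<and> 1 / h ^ 40 \<le> rq t 15 0 0 \<and> rq t 15 0 0 \<le> M ^ n\<^sup>2 / h ^ 40)"
proof -
  define d0 where "d0 = 1 / h ^ 40"
  have d0: "0 < d0" using h0 by (simp add: d0_def)
  \<comment> \<open>Either a gap has been reached, or each of the \<open>e\<close> rounds has
    widened the tolerance and added a near edge.\<close>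
  define I where "I e d \<longleftrightarrow> (\<exists>e'\<le>e. d = d0 * M ^ e' \<and> (gapfree n x y M d \<or> (e' = e \<and> e \<le> card (near_edges n x y d))))" for e d
  have body: "runs n (Seq (ISet 14 Z Z Z)
     (Seq (For 6 (For 2 (Cond (BAnd (QLess (scaled (Q0 15)) edge_rhs) (BNot (QLess (scaled (QMul (Q0 20) (Q0 15))) edge_rhs)))
        (ISet 14 Z Z (IConst 1)) Skip)))
     (Cond (ILess Z (IS 14)) (QSet 15 Z Z (QMul (Q0 20) (Q0 15))) Skip))) t (\<lambda>t'. I (Suc e) (rq t' 15 0 0))"
    if t: "imem t 0 = imem s 0" "imem t 10 = imem s 10" "\<And>a. a \<noteq> 15 \<Longrightarrow> qmem t a = qmem s a" and I: "I e (rq t 15 0 0)" for t e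
  proof (rule runs_SeqI[where P = "\<lambda>t'. imem t' 14 0 0 = 0"], goal_cases)
    case 1
    then show ?case by (intro runs_ISet) simp
  next
    case (2 t1)
    define d where "d = rq t 15 0 0"
    define bad where "bad i j \<longleftrightarrow> (1 + d) * x i j < y i j \<and> y i j \<le> (1 + M * d) * x i j" for i j
    note F1 = framed_unfold[OF 2(2), simplified]
    show ?case
    proof (rule runs_SeqI[where P = "\<lambda>t'. imem t' 14 0 0 \<noteq> 0 \<longleftrightarrow> (\<exists>i<n. \<exists>j<n. bad i j)"], goal_cases)
      case 1
      show ?case
      proof (rule runs_For[where Inv = "\<lambda>k t'. imem t' 14 0 0 \<noteq> 0 \<longleftrightarrow> (\<exists>i<k. \<exists>j<n. bad i j)"], goal_cases)
        case (6 i t2)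
        note F2 = framed_unfold[OF 6(5), simplified]
        show ?case
        proof (rule runs_For[where Inv = "\<lambda>k t'. imem t' 14 0 0 \<noteq> 0 \<longleftrightarrow> (\<exists>i'<i. \<exists>j<n. bad i' j) \<or> (\<exists>j<k. bad i j)"], goal_cases)
          case (6 j t3)
          note F3 = framed_unfold[OF 6(5), simplified]
          have im: "imem t3 6 0 0 = i" "imem t3 2 0 0 = j" "imem t3 10 = imem s 10"
            using F1 F2 F3 t 6 \<open>imem t2 6 0 0 = i\<close> by auto
          have qm: "qmem t3 = qmem t" using F1 F2 F3 by auto
          have l: "real_of_rat (qval (scaled e) t3) = (1 + real_of_rat (qval e t3)) * x i j" for e
            using t(3) x[OF \<open>i < n\<close> \<open>j < n\<close>] by (simp add: scaled_def edge_lhs_def im qm of_rat_simps)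
          have r: "real_of_rat (qval edge_rhs t3) = y i j"
            using t(3) y[OF \<open>i < n\<close> \<open>j < n\<close>] by (simp add: edge_rhs_def im qm of_rat_simps)
          have c: "bval (BAnd (QLess (scaled (Q0 15)) edge_rhs) (BNot (QLess (scaled (QMul (Q0 20) (Q0 15))) edge_rhs))) t3 \<longleftrightarrow> bad i j"
          proof -
            have "bval (BAnd (QLess (scaled (Q0 15)) edge_rhs) (BNot (QLess (scaled (QMul (Q0 20) (Q0 15))) edge_rhs))) t3 \<longleftrightarrow>
              real_of_rat (qval (scaled (Q0 15)) t3) < real_of_rat (qval edge_rhs t3) \<and>
              \<not> real_of_rat (qval (scaled (QMul (Q0 20) (Q0 15))) t3) < real_of_rat (qval edge_rhs t3)"
              by (simp only: bval.simps of_rat_less)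
            also have "\<dots> \<longleftrightarrow> bad i j"
              unfolding l r bad_def d_def using t(3)[of 20] M by (simp add: qm of_rat_simps not_less)
            finally show ?thesis .
          qed
          show ?case
          proof (rule runs_Cond, goal_cases)
            case 1
            then have "bad i j" unfolding c .
            then show ?case by (intro runs_ISet) auto
          next
            case 2
            then have "\<not> bad i j" unfolding c .
            then show ?case using 6(2) by (intro runs_Skip) (auto simp: less_Suc_eq)
          qed
        qed (use 6 F1 F2 t n in \<open>auto simp: less_Suc_eq\<close>)
      qed (use F1 t n 2(1) in auto)
    next
      case (2 t2)
      note F2 = framed_unfold[OF 2(2), simplified]
      have gf: "gapfree n x y M d \<longleftrightarrow> \<not> (\<exists>i<n. \<exists>j<n. bad i j)" by (auto simp: gapfree_def bad_def)
      have d15: "qmem t2 15 = qmem t 15" "qmem t2 20 = qmem s 20" using F1 F2 t(3) by auto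
      from I obtain e' where e': "e' \<le> e" "d = d0 * M ^ e'" "gapfree n x y M d \<or> (e' = e \<and> e \<le> card (near_edges n x y d))"
        unfolding I_def d_def by blast
      have dpos: "0 \<le> d" using e'(2) d0 M by simp
      show ?case
      proof (rule runs_Cond, goal_cases)
        case 1
        then have nf: "\<not> gapfree n x y M d" using 2(1) gf by simp
        have "e < card (near_edges n x y (M * d))"
          using near_edges_grow[OF nf x0 M(2) dpos] e'(3) nf by auto
        then have "I (Suc e) (M * d)" unfolding I_def using e'(2,3) nf by (intro exI[of _ "Suc e"]) auto
        then show ?case using M d15 by (intro runs_QSet) (simp add: of_rat_simps d_def)
      next
        case 2
        then have "gapfree n x y M d" using \<open>_ \<longleftrightarrow> (\<exists>i<n. _)\<close> gf by simp
        then have "I (Suc e) d" unfolding I_def using e'(1,2) le_SucI by blast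
        then show ?case using d15 by (intro runs_Skip) (simp add: d_def)
      qed
    qed
  qed
  show ?thesis
    unfolding find_gap_def
  proof (intro runs_Seq runs_QSet, rule runs_For[where Inv = "\<lambda>k t. I (k * n) (rq t 15 0 0)"], goal_cases)
    case (6 k t)
    note F1 = framed_unfold[OF 6(5), simplified]
    show ?case
    proof (rule runs_For[where Inv = "\<lambda>l t. I (k * n + l) (rq t 15 0 0)"], goal_cases)
      case (6 l t')
      note F2 = framed_unfold[OF 6(5), simplified]
      show ?case
        by (rule runs_weaken[OF body[of t' "k * n + l"]]) (use 6 F1 F2 in auto)
    qed (use 6 F1 n in \<open>auto simp: add.commute\<close>)
  next
    case (5)
    have "I 0 d0" unfolding I_def by (intro exI[of _ 0]) auto
    then show ?case using h by (simp add: of_rat_simps of_rat_power d0_def)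
  next
    case (7 t)
    then obtain e' where e': "e' \<le> n * n" "rq t 15 0 0 = d0 * M ^ e'"
      "gapfree n x y M (rq t 15 0 0) \<or> (e' = n * n \<and> n * n \<le> card (near_edges n x y (rq t 15 0 0)))"
      unfolding I_def by blast
    have "1 * d0 \<le> M ^ e' * d0" using M d0 by (intro mult_right_mono) auto
    moreover have "M ^ e' * d0 \<le> M ^ (n * n) * d0" using M d0 e'(1) by (intro mult_right_mono power_increasing) auto
    moreover have "gapfree n x y M (rq t 15 0 0)"
      using e'(3)
    proof
      \<comment> \<open>After \<open>n * n\<close> widenings all edges are near, so none is left to
        violate the gap.\<close>
      assume c: "e' = n * n \<and> n * n \<le> card (near_edges n x y (rq t 15 0 0))"
      have "near_edges n x y (rq t 15 0 0) = {..<n} \<times> {..<n}"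
        by (rule card_seteq) (use c in \<open>auto simp: near_edges_def\<close>)
      then have "\<And>i j. i < n \<Longrightarrow> j < n \<Longrightarrow> (i, j) \<in> near_edges n x y (rq t 15 0 0)" by auto
      then show ?thesis by (auto simp: near_edges_def gapfree_def not_less)
    qed
    ultimately show ?case using e'(2) by (simp add: d0_def power2_eq_square)
  qed (use n in auto)
qed

text \<open>\<open>pp\<close> are the exact prices, which the program does not know.\<close>

definition ratio_table :: "nat \<Rightarrow> (nat \<Rightarrow> real) \<Rightarrow> (nat \<Rightarrow> nat \<Rightarrow> bool) \<Rightarrow> state \<Rightarrow> bool" where
  "ratio_table n pp S t \<longleftrightarrow> (\<forall>j<n. \<forall>k<n. rq t 16 j k = (if S j k then pp j / pp k else 0))"

text \<open>Each nearly optimal good is joined only to the best good of the agent; transitivity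
  yields the other pairs. The ratio of exact prices equals a ratio of utilities, so it is available
  although \<open>pp\<close> is not.\<close>

definition link_edges :: com where
  "link_edges = For 6 (For 2 (Cond (BNot (QLess (scaled (Q0 15)) edge_rhs))
     (Seq (QSet 16 (IS 2) (IGet 10 (IS 6) Z) (QDiv (Q2 0 6 2) (QGet 0 (IS 6) (IGet 10 (IS 6) Z))))
          (QSet 16 (IGet 10 (IS 6) Z) (IS 2) (QDiv (QGet 0 (IS 6) (IGet 10 (IS 6) Z)) (Q2 0 6 2)))) Skip))"

lemma link_edges_writes [simp]: "iwrites link_edges = {2, 6}" "qwrites link_edges = {16}"
  by (auto simp: link_edges_def)

lemma runs_link_edges:
  assumes n: "imem s 0 0 0 = n" and u: "\<And>i j. i < n \<Longrightarrow> j < n \<Longrightarrow> rq s 0 i j = real (u i j)"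
    and B: "\<And>i. i < n \<Longrightarrow> imem s 10 i 0 = B i" "\<And>i. i < n \<Longrightarrow> B i < n"
    and E: "\<And>i j. i < n \<Longrightarrow> j < n \<Longrightarrow> E i j \<longleftrightarrow> rq s 0 i (B i) * rq s 9 j 0 \<le> (1 + rq s 15 0 0) * (rq s 0 i j * rq s 9 (B i) 0)"
    and pp: "\<And>j. j < n \<Longrightarrow> pp j > 0" "\<And>i j. i < n \<Longrightarrow> j < n \<Longrightarrow> E i j \<Longrightarrow> real (u i (B i)) * pp j = real (u i j) * pp (B i)"
      "\<And>i. i < n \<Longrightarrow> u i (B i) > 0"
    and R0: "\<And>j k. rq s 16 j k = 0"
  shows "runs n link_edges s (ratio_table n pp (\<lambda>j k. \<exists>i<n. E i j \<and> k = B i \<or> E i k \<and> j = B i))"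
proof -
  have val: "real (u i j) / real (u i (B i)) = pp j / pp (B i)" "real (u i (B i)) / real (u i j) = pp (B i) / pp j"
    if "i < n" "j < n" "E i j" for i j
  proof -
    have e: "real (u i (B i)) * pp j = real (u i j) * pp (B i)" by (rule pp(2)[OF that])
    have "0 < real (u i (B i)) * pp j" using pp(1)[OF that(2)] pp(3)[OF that(1)] by simp
    then have uj: "real (u i j) \<noteq> 0" using e by (metis less_irrefl mult_zero_left)
    show "real (u i j) / real (u i (B i)) = pp j / pp (B i)" "real (u i (B i)) / real (u i j) = pp (B i) / pp j"
      using e uj pp(1)[OF that(2)] pp(3)[OF that(1)] pp(1)[OF B(2)[OF that(1)]] by (auto simp: field_simps)
  qed
  define T where "T i l j k \<longleftrightarrow> (\<exists>i'<i. \<exists>j'<n. E i' j' \<and> ((j = j' \<and> k = B i') \<or> (k = j' \<and> j = B i'))) \<or>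
     (\<exists>j'<l. E i j' \<and> ((j = j' \<and> k = B i) \<or> (k = j' \<and> j = B i)))" for i l j k
  have T_n: "T i n = T (Suc i) 0" for i unfolding T_def by (intro ext) (auto simp: less_Suc_eq)
  show ?thesis
    unfolding link_edges_def
  proof (rule runs_For[where Inv = "\<lambda>i. ratio_table n pp (T i 0)"], goal_cases)
    case (6 i t)
    note F1 = framed_unfold[OF 6(5), simplified]
    show ?case
    proof (rule runs_For[where Inv = "\<lambda>l. ratio_table n pp (T i l)"], goal_cases)
      case (6 j t')
      note F2 = framed_unfold[OF 6(5), simplified]
      have i: "i < n" and j: "j < n" by fact+
      have im: "imem t' 6 0 0 = i" "imem t' 2 0 0 = j" "imem t' 10 i 0 = B i"
        using F1 F2 6 \<open>imem t 6 0 0 = i\<close> B(1)[OF i] by auto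
      have qm: "\<And>a. a \<noteq> 16 \<Longrightarrow> qmem t' a = qmem s a" using F1 F2 by auto
      have c: "bval (BNot (QLess (scaled (Q0 15)) edge_rhs)) t' \<longleftrightarrow> E i j"
      proof -
        have "bval (BNot (QLess (scaled (Q0 15)) edge_rhs)) t' \<longleftrightarrow> real_of_rat (qval edge_rhs t') \<le> real_of_rat (qval (scaled (Q0 15)) t')"
          by (simp only: bval.simps of_rat_less_eq not_less)
        also have "\<dots> \<longleftrightarrow> E i j" unfolding E[OF i j] by (simp add: scaled_def edge_lhs_def edge_rhs_def im qm of_rat_simps)
        finally show ?thesis .
      qed
      have Ts: "T i (Suc j) a k \<longleftrightarrow> T i j a k \<or> (E i j \<and> ((a = j \<and> k = B i) \<or> (k = j \<and> a = B i)))" for a k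
        by (auto simp: T_def less_Suc_eq)
      show ?case
      proof (rule runs_Cond, goal_cases)
        case 1
        then have Eij: "E i j" unfolding c .
        have v: "real_of_rat (qmem s 0 i j / qmem s 0 i (B i)) = pp j / pp (B i)"
          "real_of_rat (qmem s 0 i (B i) / qmem s 0 i j) = pp (B i) / pp j"
          using val[OF i j Eij] u[OF i j] u[OF i B(2)[OF i]] by (simp_all add: of_rat_simps)
        show ?case
        proof (intro runs_Seq runs_QSet, unfold ratio_table_def, intro allI impI, goal_cases)
          case (1 a k)
          then have old: "rq t' 16 a k = (if T i j a k then pp a / pp k else 0)" using 6(2) by (simp add: ratio_table_def)
          consider "a = B i" "k = j" | "\<not> (a = B i \<and> k = j)" "a = j" "k = B i"
            | "\<not> (a = B i \<and> k = j)" "\<not> (a = j \<and> k = B i)" by blast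
          then show ?case
          proof cases
            case 1
            then show ?thesis using Eij v(2) by (simp add: im qm Ts)
          next
            case 2
            then show ?thesis using Eij v(1) by (auto simp: im qm Ts)
          next
            case 3
            then show ?thesis using old by (auto simp: im qm Ts)
          qed
        qed
      next
        case 2
        then have "\<not> E i j" unfolding c .
        then show ?case using 6(2) by (intro runs_Skip) (simp add: ratio_table_def Ts)
      qed
    qed (use 6 F1 n T_n in \<open>auto simp: ratio_table_def\<close>)
  next
    case 5
    show ?case by (auto simp: ratio_table_def T_def R0)
  next
    case (7 t)
    have "T n 0 j k \<longleftrightarrow> (\<exists>i<n. E i j \<and> k = B i \<or> E i k \<and> j = B i)" if "j < n" "k < n" for j k
      using that by (auto simp: T_def)
    then show ?case using 7(1) by (simp add: ratio_table_def)
  qed (use n in auto)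
qed

text \<open>Floyd-Warshall with products of ratios. The entry 0 means no relation and known ratios
  are positive, so positivity of a product tests both links. Every path gives the same ratio,
  because exact prices exist.\<close>

definition closure :: com where
  "closure = For 3 (For 6 (For 2 (Cond (QLess (QConst 0) (QMul (Q2 16 6 3) (Q2 16 3 2)))
     (QSet 16 (IS 6) (IS 2) (QMul (Q2 16 6 3) (Q2 16 3 2))) Skip)))"

lemma closure_writes [simp]: "iwrites closure = {2, 3, 6}" "qwrites closure = {16}"
  by (auto simp: closure_def)

fun warshall :: "(nat \<Rightarrow> nat \<Rightarrow> bool) \<Rightarrow> nat \<Rightarrow> nat \<Rightarrow> nat \<Rightarrow> bool" where
  "warshall S 0 = S"
| "warshall S (Suc m) = (\<lambda>a b. warshall S m a b \<or> (warshall S m a m \<and> warshall S m m b))"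

lemma warshall_mono: "S a b \<Longrightarrow> warshall S m a b"
  by (induction m) auto

lemma warshall_sym: "(\<And>a b. S a b \<Longrightarrow> S b a) \<Longrightarrow> warshall S m a b \<Longrightarrow> warshall S m b a"
  by (induction m arbitrary: a b) auto

text \<open>Composition through a processed vertex \<open>l\<close> survives the later stages, so
  paths need not be mentioned: at \<open>m = n\<close> this is transitivity on all of
  \<open>{..<n}\<close>.\<close>

lemma warshall_trans: "l < m \<Longrightarrow> warshall S m a l \<Longrightarrow> warshall S m l b \<Longrightarrow> warshall S m a b"
proof (induction m arbitrary: a b)
  case (Suc m)
  show ?case
  proof (cases "l = m")
    case True
    then show ?thesis using Suc.prems by auto
  next
    case False
    then have l: "l < m" using Suc.prems by simp
    note IH = Suc.IH[OF l]
    from Suc.prems(2,3) show ?thesis using IH[of a b] IH[of a m] IH[of m b] by auto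
  qed
qed simp

lemma runs_closure:
  assumes n: "imem s 0 0 0 = n" and R: "ratio_table n pp S s" and pp: "\<And>j. j < n \<Longrightarrow> pp j > 0"
  shows "runs n closure s (ratio_table n pp (warshall S n))"
  unfolding closure_def
proof (rule runs_For[where Inv = "\<lambda>m. ratio_table n pp (warshall S m)"], goal_cases)
  case (6 m t)
  note F1 = framed_unfold[OF 6(5), simplified]
  define W where "W = warshall S m"
  \<comment> \<open>At stage \<open>m\<close> row and column \<open>m\<close> do not change, so
    reading them from the partly updated table is harmless.\<close>
  define T where "T a b a' b' \<longleftrightarrow> W a' b' \<or> ((a' < a \<or> (a' = a \<and> b' < b)) \<and> W a' m \<and> W m b')" for a b a' b' :: nat
  have eq: "ratio_table n pp (T a n) = ratio_table n pp (T (Suc a) 0)" for a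
    unfolding ratio_table_def by (intro ext) (auto simp: T_def less_Suc_eq)
  show ?case
  proof (rule runs_For[where Inv = "\<lambda>a. ratio_table n pp (T a 0)"], goal_cases)
    case (6 a t1)
    note F2 = framed_unfold[OF 6(5), simplified]
    show ?case
    proof (rule runs_For[where Inv = "\<lambda>b. ratio_table n pp (T a b)"], goal_cases)
      case (6 b t2)
      note F3 = framed_unfold[OF 6(5), simplified]
      have a: "a < n" and b: "b < n" and m: "m < n" by fact+
      have im: "imem t2 3 0 0 = m" "imem t2 6 0 0 = a" "imem t2 2 0 0 = b"
        using F2 F3 6 \<open>imem t 3 0 0 = m\<close> \<open>imem t1 6 0 0 = a\<close> by auto
      have am: "rq t2 16 a m = (if W a m then pp a / pp m else 0)" using 6(2) a m by (auto simp: ratio_table_def T_def)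
      have mb: "rq t2 16 m b = (if W m b then pp m / pp b else 0)" using 6(2) b m by (auto simp: ratio_table_def T_def)
      have v: "real_of_rat (qval (QMul (Q2 16 6 3) (Q2 16 3 2)) t2) = (if W a m \<and> W m b then pp a / pp b else 0)"
        using pp[OF m] by (simp add: im of_rat_simps am mb)
      have c: "bval (QLess (QConst 0) (QMul (Q2 16 6 3) (Q2 16 3 2))) t2 \<longleftrightarrow> W a m \<and> W m b"
      proof -
        have "bval (QLess (QConst 0) (QMul (Q2 16 6 3) (Q2 16 3 2))) t2 \<longleftrightarrow> 0 < real_of_rat (qval (QMul (Q2 16 6 3) (Q2 16 3 2)) t2)"
          by (simp only: bval.simps qval.simps(1) zero_less_of_rat_iff)
        then show ?thesis unfolding v using pp[OF a] pp[OF b] by simp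
      qed
      have Ts: "T a (Suc b) a' b' \<longleftrightarrow> T a b a' b' \<or> (a' = a \<and> b' = b \<and> W a m \<and> W m b)" for a' b'
        by (auto simp: T_def less_Suc_eq)
      show ?case
      proof (rule runs_Cond, goal_cases)
        case 1
        then have "W a m \<and> W m b" unfolding c .
        then show ?case using v 6(2) by (intro runs_QSet) (auto simp: im ratio_table_def Ts)
      next
        case 2
        then have "\<not> (W a m \<and> W m b)" unfolding c .
        then show ?case using 6(2) by (intro runs_Skip) (auto simp: ratio_table_def Ts)
      qed
    qed (use 6 F1 F2 n eq in \<open>auto simp: ratio_table_def\<close>)
  next
    case (7 t')
    then show ?case by (auto simp: ratio_table_def T_def W_def)
  qed (use 6 F1 n in \<open>auto simp: ratio_table_def T_def W_def\<close>)
qed (use n R in \<open>auto simp: ratio_table_def\<close>)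

section \<open>The chain and its stationary vector in the program\<close>

definition build_chain :: com where
  "build_chain = For 6 (Seq (SumLoop 3 17 Z (QGet 16 (IS 3) (IGet 10 (IS 6) Z)))
     (For 2 (QSet 18 (IS 6) (IS 2) (QDiv (QGet 16 (IS 2) (IGet 10 (IS 6) Z)) (Q0 17)))))"

lemma build_chain_writes [simp]: "iwrites build_chain = {2, 3, 6}" "qwrites build_chain = {17, 18}"
  by (auto simp: build_chain_def)

lemma runs_build_chain:
  assumes n: "imem s 0 0 0 = n" and B: "\<And>i. i < n \<Longrightarrow> imem s 10 i 0 = B i"
  shows "runs n build_chain s (\<lambda>t. \<forall>i<n. \<forall>j<n. rq t 18 i j = rq s 16 j (B i) / (\<Sum>k<n. rq s 16 k (B i)))"
  unfolding build_chain_def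
proof (rule runs_For[where Inv = "\<lambda>l t. \<forall>i<l. \<forall>j<n. rq t 18 i j = rq s 16 j (B i) / (\<Sum>k<n. rq s 16 k (B i))"], goal_cases)
  case (6 i t)
  note F = framed_unfold[OF 6(5), simplified]
  have n': "imem t 0 0 0 = n" by fact
  have b: "imem t 10 i 0 = B i" "imem t 6 0 0 = i" using F B 6 by auto
  have "runs n (SumLoop 3 17 Z (QGet 16 (IS 3) (IGet 10 (IS 6) Z))) t
     (\<lambda>t'. rq t' 17 0 0 = (\<Sum>k<n. rq s 16 k (B i)) \<and> (\<forall>x. x \<noteq> 0 \<longrightarrow> qmem t' 17 x = qmem t 17 x))"
    by (rule runs_SumLoop) (use n' b F in auto)
  then show ?case
  proof (rule runs_SeqI, goal_cases)
    case (1 t1)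
    note G = framed_unfold[OF 1(2), simplified]
    show ?case
    proof (rule runs_For[where Inv = "\<lambda>m t. (\<forall>i'<i. \<forall>j<n. rq t 18 i' j = rq s 16 j (B i') / (\<Sum>k<n. rq s 16 k (B i'))) \<and>
        (\<forall>j<m. rq t 18 i j = rq s 16 j (B i) / (\<Sum>k<n. rq s 16 k (B i)))"], goal_cases)
      case (6 j t2)
      note H = framed_unfold[OF 6(5), simplified]
      have q: "qmem t2 16 = qmem s 16" "rq t2 17 0 0 = (\<Sum>k<n. rq s 16 k (B i))" "imem t2 6 0 0 = i" "imem t2 10 i 0 = B i"
        using F G H b 1(1) by auto
      show ?case by (rule runs_QSet) (use 6 q in \<open>auto simp: of_rat_simps less_Suc_eq\<close>)
    qed (use 6 G n' in \<open>auto simp: less_Suc_eq\<close>)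
  qed
qed (use n in auto)

definition eliminate_states :: com where
  "eliminate_states = For 4 (Seq (ISet 3 Z Z (ISub (ISub (IS 0) (IConst 1)) (IS 4))) (Seq (QSet 19 (IS 3) Z (QConst 0))
     (Seq (For 2 (Cond (ILess (IS 2) (IS 3)) (QSet 19 (IS 3) Z (QAdd (Q1 19 3) (Q2 18 3 2))) Skip))
     (For 6 (For 2 (Cond (BAnd (ILess (IS 6) (IS 3)) (ILess (IS 2) (IS 3)))
        (QSet 18 (IS 6) (IS 2) (QAdd (Q2 18 6 2) (QDiv (QMul (Q2 18 6 3) (Q2 18 3 2)) (Q1 19 3)))) Skip))))))"

lemma eliminate_states_writes [simp]: "iwrites eliminate_states = {2, 3, 4, 6}" "qwrites eliminate_states = {18, 19}"
  by (auto simp: eliminate_states_def)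

text \<open>Eliminating \<open>k\<close> and then smaller states writes only to entries with both
  indices below \<open>k\<close>. So one array serves for the elimination and for back
  substitution.\<close>

lemma gth_column_stable:
  assumes "i < k" "k < n" "n - Suc k \<le> d" "d \<le> n"
  shows "gth n P d i k = gth n P (n - Suc k) i k"
  using assms(3,4)
proof (induction d rule: dec_induct)
  case (step d)
  then have "\<not> k < n - Suc d" by simp
  then show ?case using step by (simp add: eliminate_def)
qed simp

lemma runs_eliminate_states:
  assumes n: "imem s 0 0 0 = n" and P: "\<And>i j. i < n \<Longrightarrow> j < n \<Longrightarrow> rq s 18 i j = P i j"
  shows "runs n eliminate_states s (\<lambda>t. (\<forall>i<n. \<forall>j<n. rq t 18 i j = gth n P n i j) \<and>
    (\<forall>k<n. rq t 19 k 0 = (\<Sum>j<k. gth n P (n - Suc k) k j)))"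
  unfolding eliminate_states_def
proof (rule runs_For[where Inv = "\<lambda>d t. (\<forall>i<n. \<forall>j<n. rq t 18 i j = gth n P d i j) \<and>
    (\<forall>k<n. n - d \<le> k \<longrightarrow> rq t 19 k 0 = (\<Sum>j<k. gth n P (n - Suc k) k j))"], goal_cases)
  case (6 d t)
  define k where "k = n - Suc d"
  have k: "k < n" "n - Suc k = d" using 6(1) by (auto simp: k_def)
  define A where "A = gth n P d"
  have A: "rq t 18 i j = A i j" if "i < n" "j < n" for i j using 6(2) that by (simp add: A_def)
  have S19: "rq t 19 k' 0 = (\<Sum>j<k'. gth n P (n - Suc k') k' j)" if "k' < n" "k < k'" for k'
    using 6(2) that by (simp add: k_def)
  have n': "imem t 0 0 0 = n" by fact
  show ?case
  proof (rule runs_SeqI[where P = "\<lambda>t1. imem t1 3 0 0 = k"], goal_cases)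
    case 1
    then show ?case by (intro runs_ISet) (use 6 n' in \<open>simp add: k_def\<close>)
  next
    case (2 t1)
    note G1 = framed_unfold[OF 2(2), simplified]
    show ?case
    proof (rule runs_SeqI[where P = "\<lambda>t2. rq t2 19 k 0 = 0 \<and> (\<forall>k'. k' \<noteq> k \<longrightarrow> qmem t2 19 k' = qmem t 19 k')"], goal_cases)
      case 1
      then show ?case by (intro runs_QSet) (use 2(1) G1 in auto)
    next
      case (2 t2)
      note G2 = framed_unfold[OF 2(2), simplified]
      have k2: "imem t2 3 0 0 = k" using \<open>imem t1 3 0 0 = k\<close> G2 by simp
      show ?case
      proof (rule runs_SeqI[where P = "\<lambda>t3. rq t3 19 k 0 = (\<Sum>j<k. A k j) \<and> (\<forall>k'. k' \<noteq> k \<longrightarrow> qmem t3 19 k' = qmem t 19 k')"], goal_cases)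
        case 1
        show ?case
        proof (rule runs_For[where Inv = "\<lambda>m t3. rq t3 19 k 0 = (\<Sum>j<min m k. A k j) \<and> (\<forall>k'. k' \<noteq> k \<longrightarrow> qmem t3 19 k' = qmem t 19 k')"], goal_cases)
          case (6 m t3)
          note G3 = framed_unfold[OF 6(5), simplified]
          have k3: "imem t3 3 0 0 = k" "imem t3 2 0 0 = m" "qmem t3 18 = qmem t 18" using k2 G3 G2 G1 6 by auto
          show ?case
          proof (rule runs_Cond, goal_cases)
            case 1
            then have "m < k" using k3 by simp
            then have "min (Suc m) k = Suc (min m k)" "min m k = m" by auto
            then show ?case by (intro runs_QSet) (use 6 k3 A k in \<open>auto simp: of_rat_simps\<close>)
          next
            case 2
            then have "min (Suc m) k = min m k" using k3 by auto
            then show ?case using 6(2) by (intro runs_Skip) simp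
          qed
        qed (use 2(1) n' G1 G2 k in \<open>auto simp: min_def\<close>)
      next
        case (2 t3)
        note G3 = framed_unfold[OF 2(2), simplified]
        have k3: "imem t3 3 0 0 = k" "qmem t3 18 = qmem t 18" "imem t3 0 0 0 = n" using k2 G3 G2 G1 n' by auto
        \<comment> \<open>Row and column \<open>k\<close> are read but not written here, so
          elimination in place uses the old values throughout.\<close>
        define T where "T i l i' j' = (if i' < i \<or> (i' = i \<and> j' < l) then eliminate k A i' j' else A i' j')" for i l i' j' :: nat
        show ?case
        proof (rule runs_For[where Inv = "\<lambda>i t4. \<forall>i'<n. \<forall>j'<n. rq t4 18 i' j' = T i 0 i' j'"], goal_cases)
          case (6 i t4)
          note G4 = framed_unfold[OF 6(5), simplified]
          show ?case
          proof (rule runs_For[where Inv = "\<lambda>l t5. \<forall>i'<n. \<forall>j'<n. rq t5 18 i' j' = T i l i' j'"], goal_cases)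
            case (6 l t5)
            note G5 = framed_unfold[OF 6(5), simplified]
            have i: "i < n" and l: "l < n" by fact+
            have x: "imem t5 3 0 0 = k" "imem t5 6 0 0 = i" "imem t5 2 0 0 = l" "rq t5 19 k 0 = (\<Sum>j<k. A k j)"
              using k3 G4 G5 6 \<open>imem t4 6 0 0 = i\<close> 2(1) by auto
            have v: "rq t5 18 i l = A i l" "rq t5 18 i k = A i k" "rq t5 18 k l = A k l"
              using 6(2) i l k by (simp_all add: T_def eliminate_def)
            have Ts: "T i (Suc l) i' j' = (if i' = i \<and> j' = l then eliminate k A i l else T i l i' j')" for i' j'
              by (auto simp: T_def less_Suc_eq)
            show ?case
            proof (rule runs_Cond, goal_cases)
              case 1
              then have "i < k" "l < k" using x by auto
              then show ?case by (intro runs_QSet) (use 6(2) v x in \<open>auto simp: of_rat_simps Ts eliminate_def\<close>)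
            next
              case 2
              then have "\<not> (i < k \<and> l < k)" using x by auto
              then have e: "eliminate k A i l = A i l" by (auto simp: eliminate_def)
              have "T i (Suc l) i' j' = T i l i' j'" for i' j' unfolding Ts e by (auto simp: T_def)
              then show ?case using 6(2) by (intro runs_Skip) simp
            qed
          qed (use 6 k3 G4 in \<open>auto simp: T_def less_Suc_eq\<close>)
        next
          case (7 t4)
          note G4 = framed_unfold[OF 7(2), simplified]
          have "gth n P (Suc d) = eliminate k A" by (simp add: k_def A_def)
          moreover have "rq t4 19 k' 0 = (\<Sum>j<k'. gth n P (n - Suc k') k' j)" if "k' < n" "n - Suc d \<le> k'" for k'
          proof (cases "k' = k")
            case True
            then show ?thesis using 2(1) G4 k by (simp add: A_def)
          next
            case False
            then have "k < k'" using that by (simp add: k_def)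
            then show ?thesis using S19[of k'] 2(1) G4 that by simp
          qed
          ultimately show ?case using 7(1) by (simp add: T_def)
        qed (use k3 A in \<open>auto simp: T_def\<close>)
      qed
    qed
  qed
qed (use n P in auto)

definition back_substitute :: com where
  "back_substitute = For 3 (Cond (QLess (QConst 0) (Q1 19 3))
     (Seq (QSet 21 (IS 3) Z (QConst 0)) (For 6 (Cond (ILess (IS 6) (IS 3))
        (QSet 21 (IS 3) Z (QAdd (Q1 21 3) (QDiv (QMul (Q1 21 6) (Q2 18 6 3)) (Q1 19 3)))) Skip)))
     (QSet 21 (IS 3) Z (Q1 9 3)))"

lemma back_substitute_writes [simp]: "iwrites back_substitute = {3, 6}" "qwrites back_substitute = {21}"
  by (auto simp: back_substitute_def)

lemma runs_back_substitute:
  assumes n: "imem s 0 0 0 = n"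
  shows "runs n back_substitute s (\<lambda>t. \<forall>k<n. rq t 21 k 0 =
    (if rq s 19 k 0 > 0 then (\<Sum>i<k. rq t 21 i 0 * rq s 18 i k / rq s 19 k 0) else rq s 9 k 0))"
  unfolding back_substitute_def
proof (rule runs_For[where Inv = "\<lambda>m t. \<forall>k<m. rq t 21 k 0 =
    (if rq s 19 k 0 > 0 then (\<Sum>i<k. rq t 21 i 0 * rq s 18 i k / rq s 19 k 0) else rq s 9 k 0)"], goal_cases)
  case (6 k t)
  note F = framed_unfold[OF 6(5), simplified]
  \<comment> \<open>Only entry \<open>k\<close> is written, and the equations up to \<open>k\<close>
    read only smaller entries, so the earlier ones persist.\<close>
  have keep: "(\<forall>k'<Suc k. rq t' 21 k' 0 = (if rq s 19 k' 0 > 0 then (\<Sum>i<k'. rq t' 21 i 0 * rq s 18 i k' / rq s 19 k' 0) else rq s 9 k' 0))"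
    if "\<forall>k'. k' \<noteq> k \<longrightarrow> qmem t' 21 k' = qmem t 21 k'"
      "rq t' 21 k 0 = (if rq s 19 k 0 > 0 then (\<Sum>i<k. rq t 21 i 0 * rq s 18 i k / rq s 19 k 0) else rq s 9 k 0)" for t'
  proof -
    have sm: "(\<Sum>i<k'. rq t' 21 i 0 * rq s 18 i k' / rq s 19 k' 0) = (\<Sum>i<k'. rq t 21 i 0 * rq s 18 i k' / rq s 19 k' 0)"
      if "k' \<le> k" for k'
      using \<open>\<forall>k'. k' \<noteq> k \<longrightarrow> _\<close> that by (intro sum.cong) auto
    show ?thesis
    proof (intro allI impI)
      fix k' assume "k' < Suc k"
      then consider "k' = k" | "k' < k" by linarith
      then show "rq t' 21 k' 0 = (if rq s 19 k' 0 > 0 then (\<Sum>i<k'. rq t' 21 i 0 * rq s 18 i k' / rq s 19 k' 0) else rq s 9 k' 0)"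
      proof cases
        case 1
        then show ?thesis using that(2) sm[of k] by simp
      next
        case 2
        then have "rq t' 21 k' 0 = rq t 21 k' 0" using that(1) by simp
        then show ?thesis using 6(2) 2 sm[of k'] by simp
      qed
    qed
  qed
  have k: "imem t 3 0 0 = k" "imem t 0 0 0 = n" by fact+
  show ?case
  proof (rule runs_Cond, goal_cases)
    case 1
    then have S: "rq s 19 k 0 > 0" using F k by simp
    show ?case
    proof (intro runs_Seq runs_QSet, rule runs_For[where Inv = "\<lambda>m t'. (\<forall>k'. k' \<noteq> k \<longrightarrow> qmem t' 21 k' = qmem t 21 k') \<and>
        rq t' 21 k 0 = (\<Sum>i<min m k. rq t 21 i 0 * rq s 18 i k / rq s 19 k 0)"], goal_cases)
      case (6 i t1)
      note G = framed_unfold[OF 6(5), simplified]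
      have x: "imem t1 3 0 0 = k" "imem t1 6 0 0 = i" "qmem t1 18 = qmem s 18" "qmem t1 19 = qmem s 19"
        using F G k 6 by auto
      show ?case
      proof (rule runs_Cond, goal_cases)
        case 1
        then have ik: "i < k" using x by simp
        then have "min (Suc i) k = Suc (min i k)" "min i k = i" by auto
        then show ?case by (intro runs_QSet) (use 6(2) x ik in \<open>auto simp: of_rat_simps\<close>)
      next
        case 2
        then have "min (Suc i) k = min i k" using x by auto
        then show ?case using 6(2) by (intro runs_Skip) simp
      qed
    next
      case (7 t1)
      have "min n k = k" using 6(1) by simp
      then show ?case by (intro keep) (use 7(1) S in auto)
    qed (use k in auto)
  next
    case 2
    then have S: "\<not> rq s 19 k 0 > 0" using F k by simp
    show ?case
    proof (rule runs_QSet, rule keep, goal_cases)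
      case 1
      show ?case by (simp add: k)
    next
      case 2
      show ?case using S k F by simp
    qed
  qed
qed (use n in auto)

definition copy_output :: com where
  "copy_output = For 2 (QSet 1 (IS 2) Z (Q1 21 2))"

lemma runs_copy_output:
  assumes n: "imem s 0 0 0 = n"
  shows "runs n copy_output s (\<lambda>t. \<forall>j<n. rq t 1 j 0 = rq s 21 j 0)"
  unfolding copy_output_def
proof (rule runs_For[where Inv = "\<lambda>m t. \<forall>j<m. rq t 1 j 0 = rq s 21 j 0"], goal_cases)
  case (6 j t)
  note F = framed_unfold[OF 6(5), simplified]
  show ?case by (rule runs_QSet) (use 6 F in \<open>auto simp: less_Suc_eq\<close>)
qed (use n in auto)

definition finish :: com where
  "finish = Seq best_goods (Seq find_gap (Seq link_edges (Seq closure (Seq build_chain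
     (Seq eliminate_states (Seq back_substitute copy_output))))))"

lemma (in market_flow) runs_finish:
  assumes fnd: "found s" and R0: "\<And>j k. qmem s 16 j k = 0"
    and bounds: "\<And>i. i < n \<Longrightarrow> ps i \<le> real (market_base n u ^ (8 * n))" "(\<Sum>i<n. ps i) \<le> real (market_base n u ^ (8 * n))"
  shows "runs n finish s (\<lambda>t. equilibrium_prices n u (\<lambda>i. rq t 1 i 0))"
proof -
  define H where "H = real (market_big n u)"
  define q where "q j = rq s 9 j 0" for j
  from fnd have C: "imem s 0 0 0 = n" "\<And>i j. i < n \<Longrightarrow> j < n \<Longrightarrow> rq s 0 i j = real (u i j)"
    "rq s 12 0 0 = H" "rq s 20 0 0 = 20 * real (n\<^sup>2)"
    and gq: "good_query n u ps q ((\<Sum>j<n. ps j) / weight)"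
    by (auto simp: found_def constants_ok_def H_def q_def[abs_def])
  have q: "q j > 0" if "j < n" for j using gq that by (simp add: good_query_def)
  have H0: "H > 0" using market_base_facts(1)[OF market] by (simp add: H_def market_big_def)
  have "runs n best_goods s (\<lambda>t. \<forall>i<n. best_at n u q i (imem t 10 i 0))"
    by (rule runs_best_goods) (use C n_pos q in \<open>auto simp: q_def\<close>)
  then show ?thesis
    unfolding finish_def
  proof (rule runs_SeqI, goal_cases)
    case (1 t1)
    note F1 = framed_unfold[OF 1(2), simplified]
    define B where "B i = imem t1 10 i 0" for i
    have B: "B i < n" "\<And>j. j < n \<Longrightarrow> real (u i j) * q (B i) \<le> real (u i (B i)) * q j" if "i < n" for i
      using 1(1) that by (auto simp: B_def best_at_def)
    have n1: "imem t1 0 0 0 = n" using F1 C by simp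
    have q1: "qmem t1 = qmem s" using F1 by auto
    define x where "x i j = real (u i j) * q (B i)" for i j
    define y where "y i j = real (u i (B i)) * q j" for i j
    have "runs n find_gap t1 (\<lambda>t. gapfree n x y (20 * real (n\<^sup>2)) (rq t 15 0 0) \<and> 1 / H ^ 40 \<le> rq t 15 0 0 \<and>
        rq t 15 0 0 \<le> (20 * real (n\<^sup>2)) ^ n\<^sup>2 / H ^ 40)"
    proof (rule runs_find_gap)
      have "1 \<le> (real n)\<^sup>2" using n_pos by (intro one_le_power) auto
      then show "1 \<le> 20 * real (n\<^sup>2)" by simp
      show "x i j = rq t1 0 i j * rq t1 9 (imem t1 10 i 0) 0" if "i < n" "j < n" for i j
        using C(2)[OF that] by (simp add: x_def q1 B_def q_def)
      show "y i j = rq t1 0 i (imem t1 10 i 0) * rq t1 9 j 0" if "i < n" "j < n" for i j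
        using C(2)[OF that(1) B(1)[OF that(1)]] by (simp add: y_def q1 B_def q_def)
      show "0 \<le> x i j" if "i < n" "j < n" for i j using q[OF B(1)[OF that(1)]] by (simp add: x_def)
    qed (use n1 C q1 H0 in auto)
    then show ?case
    proof (rule runs_SeqI, goal_cases)
      case (1 t2)
      note F2 = framed_unfold[OF 1(2), simplified]
      define d where "d = rq t2 15 0 0"
      define E where "E i j \<longleftrightarrow> real (u i (B i)) * q j \<le> (1 + d) * (real (u i j) * q (B i))" for i j
      have gf: "gapfree n x y (20 * real (n\<^sup>2)) d" and db: "1 / H ^ 40 \<le> d" "d \<le> (20 * real (n\<^sup>2)) ^ n\<^sup>2 / H ^ 40"
        using 1(1) by (auto simp: d_def)
      have P0: "0 \<le> (\<Sum>j<n. ps j)" using ps_pos by (intro sum_nonneg) (auto intro: less_imp_le)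
      have P1: "(\<Sum>j<n. ps j) \<le> real (market_base n u) ^ (8 * n)" using bounds(2) by simp
      note mc = market_constants[OF market H_def db P0 P1]
      have e0: "0 \<le> (\<Sum>j<n. ps j) / weight" using P0 weight_pos by simp
      have e1: "10 * sqrt ((\<Sum>j<n. ps j) / weight) \<le> d" using mc(4) by (simp add: weight_def H_def)
      have uD: "u i j \<le> market_base n u ^ (8 * n)" if "i < n" "j < n" for i j
      proof -
        have "u i j \<le> market_base n u" using market_base_facts(3)[OF market] market_base_facts(4)[OF market that] by linarith
        also have "\<dots> \<le> market_base n u ^ (8 * n)" using market_base_facts(1)[OF market] n_pos by (intro self_le_power) auto
        finally show ?thesis .
      qed
      \<comment> \<open>From here on \<open>pp\<close> serves only to interpret the ratio table; the
        program never computes it.\<close>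
      obtain pp where pp: "\<And>i. i < n \<Longrightarrow> pp i > 0" "\<And>i. i < n \<Longrightarrow> \<bar>ln (pp i) - ln (q i)\<bar> \<le> real (n\<^sup>2) * d"
        "\<And>i j k. i < n \<Longrightarrow> j < n \<Longrightarrow> k < n \<Longrightarrow> E i j \<Longrightarrow> E i k \<Longrightarrow> real (u i k) * pp j = real (u i j) * pp k"
        "\<And>i j. i < n \<Longrightarrow> j < n \<Longrightarrow> F i j > 0 \<Longrightarrow> ps j * pp i = ps i * pp j"
        "\<And>i j. i < n \<Longrightarrow> j < n \<Longrightarrow> F i j > 0 \<Longrightarrow> E i j" "\<And>i. i < n \<Longrightarrow> E i (B i)" "\<And>i. i < n \<Longrightarrow> u i (B i) > 0"
        by (rule exact_prices[OF market flow ps gq B E_def mc(1,2) e0 e1 uD bounds(1) mc(5)]) blast+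
      have n2: "imem t2 0 0 0 = n" "\<And>i. imem t2 10 i 0 = B i" using F2 n1 by (auto simp: B_def)
      have q2: "qmem t2 0 = qmem s 0" "qmem t2 9 = qmem s 9" "qmem t2 16 = qmem s 16" using F2 q1 by auto
      have "runs n link_edges t2 (ratio_table n pp (\<lambda>j k. \<exists>i<n. E i j \<and> k = B i \<or> E i k \<and> j = B i))"
      proof (rule runs_link_edges)
        show "E i j \<longleftrightarrow> rq t2 0 i (B i) * rq t2 9 j 0 \<le> (1 + rq t2 15 0 0) * (rq t2 0 i j * rq t2 9 (B i) 0)"
          if "i < n" "j < n" for i j
          using C(2)[OF that] C(2)[OF that(1) B(1)[OF that(1)]] by (simp add: q2 E_def q_def d_def)
        show "real (u i (B i)) * pp j = real (u i j) * pp (B i)" if "i < n" "j < n" "E i j" for i j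
          using pp(3)[OF that(1,2) B(1)[OF that(1)] that(3) pp(6)[OF that(1)]] .
      qed (use n2 q2 C B pp R0 in auto)
      then show ?case
      proof (rule runs_SeqI, goal_cases)
        case (1 t3)
        note F3 = framed_unfold[OF 1(2), simplified]
        define S where "S j k \<longleftrightarrow> (\<exists>i<n. E i j \<and> k = B i \<or> E i k \<and> j = B i)" for j k
        define conn where "conn = warshall S n"
        have n3: "imem t3 0 0 0 = n" using F3 n2 by simp
        have rt: "ratio_table n pp S t3" using 1(1) by (simp add: S_def[abs_def])
        show ?case
        proof (rule runs_SeqI[OF runs_closure[OF n3 rt pp(1)]], goal_cases)
          case (2 t4)
          note F4 = framed_unfold[OF 2(2), simplified]
          define R where "R j k = rq t4 16 j k" for j k
          define P where "P i j = R j (B i) / (\<Sum>k<n. R k (B i))" for i j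
          have n4: "imem t4 0 0 0 = n" "\<And>i. imem t4 10 i 0 = B i" using F4 F3 n2 by auto
          have Ssym: "S a b \<Longrightarrow> S b a" for a b by (auto simp: S_def)
          interpret RM: rounded_market n u F ps q pp B E conn d R P
          proof unfold_locales
            show "real (u i j) * q (B i) * (1 + 20 * real (n\<^sup>2) * d) \<le> real (u i (B i)) * q j"
              if "i < n" "j < n" "\<not> E i j" for i j
            proof -
              have "(1 + d) * x i j < y i j" using that(3) by (simp add: E_def x_def y_def)
              then have "\<not> y i j \<le> (1 + 20 * real (n\<^sup>2) * d) * x i j" using gf that by (auto simp: gapfree_def)
              then show ?thesis by (simp add: x_def y_def mult.commute)
            qed
            show "R j k = (if conn j k then pp j / pp k else 0)" if "j < n" "k < n" for j k
              using 2(1) that by (simp add: R_def ratio_table_def conn_def)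
            show "conn j (B i)" if "i < n" "j < n" "E i j" for i j
              unfolding conn_def by (rule warshall_mono) (use that in \<open>auto simp: S_def\<close>)
            show "conn k j" if "conn j k" for j k
              using that unfolding conn_def by (rule warshall_sym[rotated]) (rule Ssym)
            show "conn j l" if "k < n" "conn j k" "conn k l" for j k l
              using that unfolding conn_def by (rule warshall_trans)
          qed (use market flow ps q B pp mc in \<open>auto simp: P_def\<close>)
          show ?case
          proof (rule runs_SeqI[OF runs_build_chain[OF n4]], goal_cases)
            case (1 t5)
            note F5 = framed_unfold[OF 1(2), simplified]
            have P5: "rq t5 18 i j = P i j" if "i < n" "j < n" for i j
              using 1(1) that by (simp add: P_def R_def)
            have n5: "imem t5 0 0 0 = n" using F5 n4 by simp
            show ?case
            proof (rule runs_SeqI[OF runs_eliminate_states[OF n5 P5]], goal_cases)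
              case (3 t6)
              note F6 = framed_unfold[OF 3(2), simplified]
              have n6: "imem t6 0 0 0 = n" using F6 n5 by simp
              have q6: "rq t6 9 k 0 = q k" for k using F6 F5 F4 F3 q2 by (simp add: q_def)
              show ?case
              proof (rule runs_SeqI[OF runs_back_substitute[OF n6]], goal_cases)
                case (1 t7)
                note F7 = framed_unfold[OF 1(2), simplified]
                have n7: "imem t7 0 0 0 = n" using F7 n6 by simp
                define p where "p k = rq t7 21 k 0" for k
                define Sk where "Sk k = rq t6 19 k 0" for k
                have Sk: "Sk k = (\<Sum>j<k. gth n P (n - Suc k) k j)" if "k < n" for k
                  using 3(1) that by (simp add: Sk_def)
                have pk: "p k = (if Sk k > 0 then (\<Sum>i<k. p i * gth n P (n - Suc k) i k / Sk k) else q k)" if k: "k < n" for k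
                proof -
                  have "rq t6 18 i k = gth n P (n - Suc k) i k" if "i < k" for i
                    using 3(1) that k gth_column_stable[OF that k, of n P] by simp
                  then have "(\<Sum>i<k. rq t7 21 i 0 * rq t6 18 i k / rq t6 19 k 0) = (\<Sum>i<k. p i * gth n P (n - Suc k) i k / Sk k)"
                    by (intro sum.cong) (auto simp: p_def Sk_def)
                  then show ?thesis using 1(1) k q6[of k] by (simp add: p_def Sk_def)
                qed
                note gs = gth_stationary[OF RM.P_nonneg RM.P_row pp(1) RM.pp_stationary q Sk pk RM.link_def]
                have "equilibrium_prices n u p"
                  by (rule RM.stationary_equilibrium) (rule gs; assumption)+
                then show ?case
                proof (intro runs_weaken[OF runs_copy_output[OF n7]], goal_cases)
                  case (1 t8)
                  show ?case by (rule equilibrium_prices_cong[OF 1(1)]) (use 1(2) in \<open>simp add: p_def\<close>)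
                qed
              qed
            qed
          qed
        qed
      qed
    qed
  qed
qed

section \<open>The whole program and its cost\<close>

definition market_program :: com where
  "market_program = Seq initialise (Seq search finish)"

text \<open>With \<open>y = n * U >= 2\<close> the base is at most
  \<open>2 * y + y^2 <= y ^ 3\<close>.\<close>

lemma market_base_log:
  assumes "\<And>i j. i < n \<Longrightarrow> j < n \<Longrightarrow> u i j \<le> U" "2 \<le> n * U"
  shows "ln (real (market_base n u)) \<le> 3 * ln (real (n * U))"
proof -
  define y where "y = n * U"
  have y: "2 \<le> y" "n \<le> y" using assms(2) by (auto simp: y_def) (cases U; simp)
  have "(\<Sum>i<n. \<Sum>j<n. u i j) \<le> (\<Sum>i<n. \<Sum>j<n. U)" using assms(1) by (intro sum_mono) auto
  also have "\<dots> = n * y" by (simp add: y_def)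
  also have "\<dots> \<le> y * y" using y by (intro mult_right_mono) auto
  finally have "market_base n u \<le> y + y + y * y" using y by (simp add: market_base_def)
  moreover have "2 * y \<le> y * y" "2 * (y * y) \<le> y * (y * y)" by (rule mult_right_mono[OF y(1)], simp)+
  ultimately have "market_base n u \<le> y * (y * y)" by linarith
  then have le: "market_base n u \<le> y ^ 3" by (simp add: power3_eq_cube mult.assoc)
  have "ln (real (market_base n u)) \<le> ln (real y ^ 3)"
    using of_nat_mono[OF le, where 'a = real] by (intro ln_mono) (simp_all add: market_base_def del: of_nat_sum of_nat_add)
  also have "\<dots> = 3 * ln (real y)" using y by (simp add: ln_realpow)
  finally show ?thesis by (simp add: y_def)
qed

lemma depths: "depth initialise = 3" "depth iterate = 2" "depth finish = 4"
  by (simp_all add: initialise_def init_base_def init_big_def iterate_def center_def cut_def find_nonpos_def demand_def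
      cut_values_def update_def rescale_def record_query_def check_found_def accept_center_def SumLoop_def BestLoop_def
      finish_def best_goods_def find_gap_def link_edges_def closure_def build_chain_def eliminate_states_def
      back_substitute_def copy_output_def)

lemma cost_power: "\<exists>C. \<forall>n>0. real (cost n c) \<le> C * real n ^ depth c \<and> 0 \<le> C"
proof -
  obtain C where C: "\<And>n. cost n c \<le> C * Suc n ^ depth c" using cost_depth by blast
  have "real (cost n c) \<le> (real C * 2 ^ depth c) * real n ^ depth c" if "n > 0" for n
  proof -
    have "real (cost n c) \<le> real (C * Suc n ^ depth c)" using C by (rule of_nat_mono)
    also have "\<dots> = real C * real (Suc n) ^ depth c" by simp
    also have "\<dots> \<le> real C * (2 * real n) ^ depth c" using that by (intro mult_left_mono power_mono) auto
    finally show ?thesis by (simp add: power_mult_distrib)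
  qed
  then show ?thesis by (intro exI[of _ "real C * 2 ^ depth c"]) auto
qed

lemma exec_market_program:
  assumes m: "exchange_market n u"
  shows "\<exists>k m t. exec market_program (market_input n u) k m t \<and> equilibrium_prices n u (market_output t) \<and>
    real k \<le> real (cost n initialise) + (4000 * real n ^ 6 * ln (real (market_base n u)) + 3) * real (1 + cost n iterate)
      + real (cost n finish)"
proof -
  define s0 where "s0 = market_input n u"
  obtain F where F: "eqflow n u (\<lambda>i j. real (F i j))" "\<And>i. i < n \<Longrightarrow> (\<Sum>j<n. F i j) \<le> market_base n u ^ (8 * n)"
    "(\<Sum>i<n. \<Sum>j<n. F i j) \<le> market_base n u ^ (8 * n)" using market_flow_bounds[OF m] by blast
  define ps where "ps i = (\<Sum>j<n. real (F i j))" for i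
  interpret MF: market_flow n u F ps
    by unfold_locales (use m F ps_def in auto)
  have s0: "imem s0 0 0 0 = n" "\<And>i j. i < n \<Longrightarrow> j < n \<Longrightarrow> rq s0 0 i j = real (u i j)"
    "\<And>a i j. a \<noteq> 0 \<Longrightarrow> qmem s0 a i j = 0" "imem s0 12 0 0 = 0"
    by (auto simp: s0_def market_input_def)
  have "runs n initialise s0 (\<lambda>t. constants_ok n u t \<and> (\<forall>k<n. \<forall>j<n. rq t 2 k j = (if k = j then 1 else 0)))"
    by (rule runs_initialise) (use s0 in auto)
  then obtain k1 m1 t1 where t1: "exec initialise s0 k1 m1 t1" "k1 \<le> cost n initialise" "constants_ok n u t1"
    "\<forall>k<n. \<forall>j<n. rq t1 2 k j = (if k = j then 1 else 0)" by (auto simp: runs_def)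
  have iw: "iwrites initialise = {2, 3, 6}" "qwrites initialise = {2, 10, 11, 12, 13, 14, 20}"
    by (auto simp: initialise_def init_base_def init_big_def)
  note G1 = framed_unfold[OF exec_framed[OF t1(1)], unfolded iw, simplified]
  have "MF.loop_inv 0 t1"
    unfolding MF.loop_inv_def
  proof (intro conjI allI impI)
    show "cone_inv n u ps 0 (\<lambda>k j. rq t1 2 k j) (\<lambda>k. rq t1 7 k 0) (\<lambda>k j. rq t1 8 k j)"
      by (rule cone_inv_init) (use t1(4) G1 s0 MF.ps_pos in auto)
  qed (use t1(3) G1 s0 MF.weight_pos in auto)
  from MF.exec_search[OF this] obtain k2 m2 t2 where t2: "exec search t1 k2 m2 t2" "MF.found t2"
    "real k2 \<le> (4000 * real n ^ 6 * ln (real (market_base n u)) + 3) * real (1 + cost n iterate)" by blast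
  have "iwrites search = iwrites iterate" "qwrites search = qwrites iterate" by (auto simp: search_def)
  then have sw: "iwrites search = {2, 3, 6, 11, 12, 13}" "qwrites search = {2, 3, 4, 5, 6, 7, 8, 9}" by simp_all
  note G2 = framed_unfold[OF exec_framed[OF t2(1)], unfolded sw, simplified]
  have "runs n finish t2 (\<lambda>t. equilibrium_prices n u (\<lambda>i. rq t 1 i 0))"
  proof (rule MF.runs_finish[OF t2(2)])
    show "qmem t2 16 j k = 0" for j k using G1 G2 s0 by simp
    show "ps i \<le> real (market_base n u ^ (8 * n))" if "i < n" for i
      using of_nat_mono[OF F(2)[OF that], where 'a = real] by (simp add: ps_def)
    show "(\<Sum>i<n. ps i) \<le> real (market_base n u ^ (8 * n))"
      using of_nat_mono[OF F(3), where 'a = real] by (simp add: ps_def)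
  qed
  then obtain k3 m3 t3 where t3: "exec finish t2 k3 m3 t3" "k3 \<le> cost n finish" "equilibrium_prices n u (\<lambda>i. rq t3 1 i 0)"
    by (auto simp: runs_def)
  have "exec market_program s0 (k1 + (k2 + k3)) (m1 + (m2 + m3)) t3"
    unfolding market_program_def by (rule exec.Seq[OF t1(1) exec.Seq[OF t2(1) t3(1)]])
  moreover have "equilibrium_prices n u (market_output t3)" using t3(3) by (simp add: market_output_def[abs_def])
  moreover have "real (k1 + (k2 + k3)) \<le> real (cost n initialise)
      + (4000 * real n ^ 6 * ln (real (market_base n u)) + 3) * real (1 + cost n iterate) + real (cost n finish)"
    using t1(2) t2(3) t3(2) by simp
  ultimately show ?thesis unfolding s0_def by blast
qed

theorem theorem2:
  "\<exists>(prog :: com) (C :: real). \<forall>(n :: nat) (U :: nat) (u :: nat \<Rightarrow> nat \<Rightarrow> nat).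
     exchange_market n u \<and> (\<forall>i<n. \<forall>j<n. u i j \<le> U) \<longrightarrow>
     (\<exists>k m t. exec prog (market_input n u) k m t \<and>
        equilibrium_prices n u (market_output t) \<and>
        (n * U \<ge> 2 \<longrightarrow>
           real k \<le> C * real n ^ 9 * ln (real (n * U)) \<and>
           real m \<le> C * real n ^ 8 * ln (real (n * U))))"
proof -
  obtain C1 where C1: "\<And>n. n > 0 \<Longrightarrow> real (cost n initialise) \<le> C1 * real n ^ 3 \<and> 0 \<le> C1"
    using cost_power[of initialise] unfolding depths by blast
  obtain C2 where C2: "\<And>n. n > 0 \<Longrightarrow> real (cost n iterate) \<le> C2 * real n ^ 2 \<and> 0 \<le> C2"
    using cost_power[of iterate] unfolding depths by blast
  obtain C3 where C3: "\<And>n. n > 0 \<Longrightarrow> real (cost n finish) \<le> C3 * real n ^ 4 \<and> 0 \<le> C3"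
    using cost_power[of finish] unfolding depths by blast
  \<comment> \<open>The factor 3 passes from the logarithm of the base to that of
    \<open>n * U\<close>; 4003 is 4000 plus the additive 3 in the search bound, absorbed by
    \<open>n ^ 6 * l >= 1\<close>.\<close>
  define C where "C = 3 * (C1 + 4003 * (1 + C2) + C3)"
  show ?thesis
  proof (intro exI[of _ market_program] exI[of _ C] allI impI, elim conjE)
    fix n U :: nat and u :: "nat \<Rightarrow> nat \<Rightarrow> nat"
    assume m: "exchange_market n u" and U: "\<forall>i<n. \<forall>j<n. u i j \<le> U"
    define l where "l = ln (real (market_base n u))"
    have n0: "n > 0" using m by (simp add: exchange_market_def)
    obtain k mu t where e: "exec market_program (market_input n u) k mu t" "equilibrium_prices n u (market_output t)"
      "real k \<le> real (cost n initialise) + (4000 * real n ^ 6 * l + 3) * real (1 + cost n iterate) + real (cost n finish)"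
      using exec_market_program[OF m] unfolding l_def by blast
    have n1: "1 \<le> real n" using n0 by simp
    have b4: "4 \<le> real (market_base n u)" using market_base_facts(1)[OF m] by simp
    have l1: "1 \<le> l"
    proof -
      have "exp 1 \<le> real (market_base n u)" using exp_le b4 by linarith
      then show ?thesis using b4 by (simp add: l_def ln_ge_iff)
    qed
    have pw: "real n ^ a \<le> real n ^ 8 * l" if "a \<le> 8" for a
    proof -
      have "real n ^ a * 1 \<le> real n ^ 8 * l" using n1 l1 that by (intro mult_mono power_increasing) auto
      then show ?thesis by simp
    qed
    have "real (cost n initialise) \<le> C1 * (real n ^ 8 * l)"
      using C1[OF n0] mult_left_mono[OF pw[of 3], of C1] by auto
    moreover have "real (cost n finish) \<le> C3 * (real n ^ 8 * l)"
      using C3[OF n0] mult_left_mono[OF pw[of 4], of C3] by auto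
    moreover have "(4000 * real n ^ 6 * l + 3) * real (1 + cost n iterate) \<le> 4003 * (1 + C2) * (real n ^ 8 * l)"
    proof -
      have "1 * 1 \<le> real n ^ 6 * l" using n1 l1 by (intro mult_mono one_le_power) auto
      then have a: "4000 * real n ^ 6 * l + 3 \<le> 4003 * (real n ^ 6 * l)" by linarith
      have "1 \<le> real n ^ 2" using n1 by (rule one_le_power)
      then have b: "real (1 + cost n iterate) \<le> (1 + C2) * real n ^ 2" using C2[OF n0] by (simp add: distrib_right)
      have "(4000 * real n ^ 6 * l + 3) * real (1 + cost n iterate) \<le> (4003 * (real n ^ 6 * l)) * ((1 + C2) * real n ^ 2)"
        using a b l1 n1 by (intro mult_mono) auto
      also have "\<dots> = 4003 * (1 + C2) * ((real n ^ 6 * real n ^ 2) * l)" by (simp only: mult_ac)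
      also have "real n ^ 6 * real n ^ 2 = real n ^ 8" by (simp flip: power_add)
      finally show ?thesis .
    qed
    ultimately have k: "real k \<le> (C1 + 4003 * (1 + C2) + C3) * (real n ^ 8 * l)"
      using e(3) by (simp only: distrib_right)
    have "2 \<le> n * U \<longrightarrow> real k \<le> C * real n ^ 9 * ln (real (n * U)) \<and> real mu \<le> C * real n ^ 8 * ln (real (n * U))"
    proof
      assume nU: "2 \<le> n * U"
      define L where "L = ln (real (n * U))"
      have L0: "0 \<le> L" using nU of_nat_mono[OF nU, where 'a = real] by (simp add: L_def)
      have lL: "l \<le> 3 * L" unfolding l_def L_def using U nU by (intro market_base_log) auto
      have c0: "0 \<le> C1 + 4003 * (1 + C2) + C3" using C1[OF n0] C2[OF n0] C3[OF n0] by simp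
      have "real k \<le> (C1 + 4003 * (1 + C2) + C3) * (real n ^ 8 * (3 * L))"
        using k mult_left_mono[OF mult_left_mono[OF lL, of "real n ^ 8"] c0] by simp
      also have "\<dots> = C * real n ^ 8 * L" by (simp add: C_def)
      \<comment> \<open>All operations together satisfy the bound required of the multiplications,
        which settles both claims.\<close>
      finally have k8: "real k \<le> C * real n ^ 8 * L" .
      have "C * real n ^ 8 * L \<le> C * real n ^ 9 * L"
        using n1 L0 c0 by (intro mult_right_mono mult_left_mono power_increasing) (auto simp: C_def)
      moreover have "real mu \<le> real k" using exec_muls_le[OF e(1)] by simp
      ultimately show "real k \<le> C * real n ^ 9 * ln (real (n * U)) \<and> real mu \<le> C * real n ^ 8 * ln (real (n * U))"
        using k8 unfolding L_def by linarith
    qed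
    with e(1,2) show "\<exists>k m t. exec market_program (market_input n u) k m t \<and> equilibrium_prices n u (market_output t) \<and>
        (2 \<le> n * U \<longrightarrow> real k \<le> C * real n ^ 9 * ln (real (n * U)) \<and> real m \<le> C * real n ^ 8 * ln (real (n * U)))"
      by blast
  qed
qed

end
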